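(* Let $p$ be a prime and let $A$ be a multiset of elements of $\mathbb{Z}_p^2$ with $|A|=2p-2$ (counted with multiplicity). Let $m_1\geq m_2\geq m_3$ be the three largest multiplicities of elements occurring in $A$, and suppose $m_1\leq p-3$. Suppose moreover that at least one of the following holds: (1) $p\leq 23$; (2) $m_2\geq 2p/3$ and $m_1+m_2\geq 2p-14$; (3) $p\leq 37$ and $m_1+m_2+m_3\geq 2p-5$. Then $A$ contains a zero-sum. Moreover, the integers $8$, $9$ and $10$ satisfy property B.
   Context: $\mathbb{Z}_n=\mathbb{Z}/n\mathbb{Z}$. A multiset $A$ in an abelian group contains a zero-sum if there is a non-empty sub-multiset of $A$ whose elements sum to $0$, and is zero-sum free otherwise. A zero-sum free multiset $A\subseteq\mathbb{Z}_n^2$ is maximal if it has $2n-2$ elements (counted with multiplicity). An integer $n\geq 2$ satisfies property B if in every zero-sum free multiset of $2n-2$ elements of $\mathbb{Z}_n^2$ some element occurs with multiplicity at least $n-2$. *)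

theory Defs
  imports Complex_Main "HOL-Algebra.Elementary_Groups" "HOL-Algebra.FiniteProduct"
    "HOL-Library.Multiset" "HOL-Library.More_List" "HOL-Computational_Algebra.Primes"
begin

(* Abelian groups are the multiplicatively written commutative groups of HOL-Algebra, so the
   sum of a multiset is a product of powers. It is meaningful for multisets over carrier G. *)
definition multiset_sum :: "('a, 'b) monoid_scheme \<Rightarrow> 'a multiset \<Rightarrow> 'a" where
  "multiset_sum G B = finprod G (\<lambda>x. x [^]\<^bsub>G\<^esub> count B x) (set_mset B)"

definition contains_zero_sum :: "('a, 'b) monoid_scheme \<Rightarrow> 'a multiset \<Rightarrow> bool" where
  "contains_zero_sum G A \<longleftrightarrow> (\<exists>B. B \<subseteq># A \<and> B \<noteq> {#} \<and> multiset_sum G B = \<one>\<^bsub>G\<^esub>)"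

definition zero_sum_free :: "('a, 'b) monoid_scheme \<Rightarrow> 'a multiset \<Rightarrow> bool" where
  "zero_sum_free G A \<longleftrightarrow> \<not> contains_zero_sum G A"

definition Z_squared :: "nat \<Rightarrow> (int \<times> int) monoid" where
  "Z_squared n = integer_mod_group n \<times>\<times> integer_mod_group n"

definition property_B :: "nat \<Rightarrow> bool" where
  "property_B n \<longleftrightarrow> n \<ge> 2 \<and>
     (\<forall>A. set_mset A \<subseteq> carrier (Z_squared n) \<longrightarrow> size A = 2 * n - 2 \<longrightarrow>
        zero_sum_free (Z_squared n) A \<longrightarrow> (\<exists>x\<in>#A. count A x \<ge> n - 2))"

(* One entry per distinct element, in decreasing order: {#a, a, b, b, c#} gives [2, 2, 1]. *)
definition multiplicities :: "'a multiset \<Rightarrow> nat list" where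
  "multiplicities A = rev (sorted_list_of_multiset (image_mset (count A) (mset_set (set_mset A))))"

(* The k-th largest multiplicity, counting from k = 1; it is 0 if A has fewer than k distinct
   elements. *)
definition largest_multiplicity :: "nat \<Rightarrow> 'a multiset \<Rightarrow> nat" where
  "largest_multiplicity k A = nth_default 0 (multiplicities A) (k - 1)"

end

theory Submission
  imports Defs "HOL-Library.Product_Plus" "HOL-Number_Theory.Cong"
    "HOL-Library.Numeral_Type"
begin

text \<open>A zero-sum free multiset of size \<open>2 n - 2\<close> over \<open>\<int>\<^sub>n\<^sup>2\<close> becomes a minimal zero-sum multiset \<open>S\<close> of size
  \<open>2 n - 1\<close> by adding the negative of its sum. It suffices that \<open>S\<close> has an element of multiplicity at
  least \<open>n - 1\<close>. This holds for all primes \<open>n\<close> from 5 on, and for 8, 9 and 10.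

  For a prime \<open>p\<close>, the product of \<open>1 - X\<^sup>x\<close> over \<open>2 p - 2\<close> elements \<open>x\<close> lies in the one-dimensional top power
  of the augmentation ideal of the group ring modulo \<open>p\<close>, and it depends multilinearly on these elements;
  if they form a zero-sum free multiset, it is the generator with all coefficients 1. Removing two or three
  elements from \<open>S\<close> thus gives linear and bilinear forms with prescribed values on \<open>S\<close>. The constant
  coefficient of a product of \<open>2 p - 4\<close> factors gives one further relation for each bilinear form.
  Comparing these relations for the triples of elements of \<open>S\<close> yields the large multiplicity.

  For \<open>n = 2 m\<close>, the three nonzero classes modulo 2 split \<open>S\<close> into pairs inside a class and one triple
  across the classes. The sums of these \<open>2 m - 1\<close> blocks form a minimal zero-sum multiset over \<open>\<int>\<^sub>m\<^sup>2\<close>, whose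
  structure is known. Exchanging elements between blocks carries this structure over to \<open>S\<close>.

  For \<open>n = 9\<close>, the group ring modulo 3 restricts how the elements of \<open>S\<close> are distributed over the four
  lines of \<open>\<int>\<^sub>3\<^sup>2\<close>: a finite check leaves distributions with eight elements on one line. These eight
  elements are equal, or a second line carries eight elements and \<open>S\<close> has a shorter zero-sum.\<close>

text \<open>Closing a zero-sum free multiset up to \<open>S\<close> gains symmetry: \<open>S\<close>
  without any one of its elements is zero-sum free, so a single form attains the value 1 at several
  elements. Dropping the added element again costs at most one in a multiplicity, hence n - 2 after
  n - 1. The group ring argument needs a prime power modulus, and its forms see elements only modulo
  the prime. For 9 they see classes modulo 3; a difference 3u of two elements of one class enters
  through (1 - X^u)^3 = 1 - X^(3u). Doubling runs along 2, 4, 8 and 5, 10; that m is a prime power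
  supplies the bound 2m - 2 for zero-sum free multisets. The step from 2 to 4 is separate, because
  for m >= 4 an exchange of two block sums still leaves the frequent one recognisable. The obstacle
  in doubling is that the block sums may have two frequent elements, so that an exchange might pass
  from one to the other; hence the decomposition is chosen within the family of all of them.\<close>

definition null_mod :: "nat \<Rightarrow> int \<times> int \<Rightarrow> bool" where
  "null_mod n v \<longleftrightarrow> int n dvd fst v \<and> int n dvd snd v"

definition zsf :: "nat \<Rightarrow> (int \<times> int) multiset \<Rightarrow> bool" where
  "zsf n M \<longleftrightarrow> (\<forall>B. B \<subseteq># M \<longrightarrow> B \<noteq> {#} \<longrightarrow> \<not> null_mod n (\<Sum>\<^sub># B))"

definition mzs :: "nat \<Rightarrow> (int \<times> int) multiset \<Rightarrow> bool" where
  "mzs n M \<longleftrightarrow> null_mod n (\<Sum>\<^sub># M) \<and> (\<forall>B. B \<subset># M \<longrightarrow> B \<noteq> {#} \<longrightarrow> \<not> null_mod n (\<Sum>\<^sub># B))"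

lemma null_mod_0 [simp]: "null_mod n 0"
  by (simp add: null_mod_def)

lemma null_mod_add: "null_mod n v \<Longrightarrow> null_mod n w \<Longrightarrow> null_mod n (v + w)"
  by (auto simp: null_mod_def)

lemma null_mod_diff: "null_mod n v \<Longrightarrow> null_mod n w \<Longrightarrow> null_mod n (v - w)"
  by (auto simp: null_mod_def)

lemma null_mod_minus [simp]: "null_mod n (- v) \<longleftrightarrow> null_mod n v"
  by (simp add: null_mod_def)

lemma null_mod_add_cancel: "null_mod n w \<Longrightarrow> null_mod n (v + w) \<longleftrightarrow> null_mod n v"
  using null_mod_add[of n v w] null_mod_diff[of n "v + w" w] by auto

lemma mzs_zsf: assumes "mzs n M" "N \<subset># M" shows "zsf n N"
  using assms unfolding zsf_def mzs_def by (meson subset_mset.le_less_trans)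

lemma mzs_remove: "mzs n M \<Longrightarrow> x \<in># M \<Longrightarrow> zsf n (M - {#x#})"
  by (rule mzs_zsf[OF _ mset_subset_diff_self])

text \<open>Additive statements about arbitrary elements are reduced to the two basis vectors by
  this rule.\<close>

lemma int_pair_induct [case_names e1 e2 add minus]:
  fixes v :: "int \<times> int"
  assumes e1: "P (1, 0)" and e2: "P (0, 1)"
    and add: "\<And>x y. P x \<Longrightarrow> P y \<Longrightarrow> P (x + y)" and minus: "\<And>x. P x \<Longrightarrow> P (- x)"
  shows "P v"
proof -
  have zero: "P 0" using add[OF e1 minus[OF e1]] by (simp add: zero_prod_def)
  have nat: "P (int k * fst u, int k * snd u)" if "P u" for k u
  proof (induction k)
    case 0 then show ?case using zero by (simp add: zero_prod_def)
  next
    case (Suc k) then show ?case using add[OF that Suc] by (cases u) (simp add: algebra_simps)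
  qed
  have int: "P (k * fst u, k * snd u)" if "P u" for k u
    using nat[OF that, of "nat k"] minus[OF nat[OF that, of "nat (- k)"]] by (cases "k \<ge> 0") auto
  have "v = (fst v * fst (1, 0), fst v * snd (1, 0)) + (snd v * fst (0, 1), snd v * snd (0::int, 1))"
    by (cases v) simp
  then show ?thesis using add[OF int[OF e1] int[OF e2]] by metis
qed

lemma subset_add_mset_self: "M \<subseteq># add_mset x M"
  by (metis add_mset_add_single mset_subset_eq_add_left)

section \<open>Difference operators\<close>

definition diff_op :: "int \<times> int \<Rightarrow> (int \<times> int \<Rightarrow> int) \<Rightarrow> int \<times> int \<Rightarrow> int" where
  "diff_op x f v = f v - f (v + x)"

text \<open>The coefficients of the product of all \<open>1 - X\<^sup>x\<close>, \<open>x \<in> M\<close>, in the group ring of \<open>\<int>\<^sub>n\<^sup>2\<close>: the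
  alternating count of those \<open>B \<subseteq># M\<close> with \<open>v + \<Sum>B = 0\<close>, equal elements of \<open>M\<close> being distinguished.\<close>

definition signed_count :: "nat \<Rightarrow> (int \<times> int) multiset \<Rightarrow> int \<times> int \<Rightarrow> int" where
  "signed_count n M = fold_mset diff_op (\<lambda>v. of_bool (null_mod n v)) M"

interpretation diff_op: comp_fun_commute diff_op
  by unfold_locales (simp add: diff_op_def fun_eq_iff ac_simps)

lemma signed_count_empty [simp]: "signed_count n {#} v = of_bool (null_mod n v)"
  by (simp add: signed_count_def)

lemma signed_count_add_mset:
  "signed_count n (add_mset x M) v = signed_count n M v - signed_count n M (v + x)"
  by (simp add: signed_count_def diff_op_def)

lemma signed_count_periodic: "null_mod n w \<Longrightarrow> signed_count n M (v + w) = signed_count n M v"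
proof (induction M arbitrary: v)
  case empty then show ?case by (simp add: null_mod_add_cancel)
next
  case (add x M)
  then show ?case using add.IH[of v] add.IH[of "v + x"] by (simp add: signed_count_add_mset ac_simps)
qed

text \<open>Only the empty submultiset can contribute to the alternating count.\<close>

lemma signed_count_eq:
  assumes "\<And>B. B \<subseteq># M \<Longrightarrow> B \<noteq> {#} \<Longrightarrow> \<not> null_mod n (v + \<Sum>\<^sub># B)"
  shows "signed_count n M v = of_bool (null_mod n v)"
  using assms
proof (induction M arbitrary: v)
  case empty then show ?case by simp
next
  case (add x M)
  have 1: "signed_count n M v = of_bool (null_mod n v)"
    using add.prems by (intro add.IH) (meson add.prems subset_mset.order_trans subset_add_mset_self)
  have "\<not> null_mod n (v + x + \<Sum>\<^sub># B)" if "B \<subseteq># M" for B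
    using add.prems[of "add_mset x B"] that by (simp add: ac_simps)
  then have "signed_count n M (v + x) = 0"
    using add.IH[of "v + x"] by (metis add.right_neutral empty_le of_bool_eq(1) sum_mset.empty)
  then show ?case using 1 by (simp add: signed_count_add_mset)
qed

lemma signed_count_zsf: "zsf n M \<Longrightarrow> signed_count n M 0 = 1"
  using signed_count_eq[of M n 0] by (simp add: zsf_def)

text \<open>Inverting X turns each factor 1 - X^x into -X^(-x) (1 - X^x); this is the comparison of
  coefficients.\<close>

lemma signed_count_reflect:
  "signed_count n T (- v - \<Sum>\<^sub># T) = (- 1) ^ size T * signed_count n T v"
proof (induction T arbitrary: v)
  case empty then show ?case by simp
next
  case (add x T)
  have "signed_count n (add_mset x T) (- v - \<Sum>\<^sub># (add_mset x T))
      = signed_count n T (- (v + x) - \<Sum>\<^sub># T) - signed_count n T (- v - \<Sum>\<^sub># T)"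
    by (simp add: signed_count_add_mset algebra_simps)
  also have "\<dots> = (- 1) ^ size T * (signed_count n T (v + x) - signed_count n T v)"
    unfolding add.IH by (simp add: algebra_simps)
  finally show ?case by (simp add: signed_count_add_mset algebra_simps)
qed

text \<open>This is 1 - X^(x+y) = (1 - X^x) + X^x (1 - X^y); multiplication by X^x appears as the
  shift of the argument.\<close>

lemma signed_count_add:
  "signed_count n (add_mset (x + y) M) v
     = signed_count n (add_mset x M) v + signed_count n (add_mset y M) (v + x)"
  by (simp add: signed_count_add_mset add.assoc)

lemma signed_count_minus:
  "signed_count n (add_mset (- x) M) v = - signed_count n (add_mset x M) (v - x)"
  by (simp add: signed_count_add_mset)


lemma replicate_mset_plus: "replicate_mset (a + b) x = replicate_mset a x + replicate_mset b x"
  by (induction a) auto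

text \<open>The binomial theorem for (1 - X^x)^k.\<close>

lemma signed_count_replicate:
  "signed_count n (replicate_mset k x + M) v
     = (\<Sum>i\<le>k. (-1) ^ i * int (k choose i) * signed_count n M (v + (int i * fst x, int i * snd x)))"
proof (induction k arbitrary: v)
  case 0 then show ?case by (simp flip: zero_prod_def)
next
  case (Suc k)
  define g where "g i = signed_count n M (v + (int i * fst x, int i * snd x))" for i
  have shift: "signed_count n M (v + x + (int i * fst x, int i * snd x)) = g (Suc i)" for i
    by (cases x, cases v) (simp add: g_def algebra_simps)
  have "signed_count n (replicate_mset (Suc k) x + M) v
     = (\<Sum>i\<le>k. (-1) ^ i * int (k choose i) * g i) - (\<Sum>i\<le>k. (-1) ^ i * int (k choose i) * g (Suc i))"
    by (simp add: signed_count_add_mset Suc.IH shift g_def[symmetric])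
  also have "(\<Sum>i\<le>k. (-1) ^ i * int (k choose i) * g i)
     = g 0 + (\<Sum>i\<le>k. (-1) ^ Suc i * int (k choose Suc i) * g (Suc i))"
    using sum.atMost_Suc_shift[of "\<lambda>i. (-1) ^ i * int (k choose i) * g i" k]
    by (simp add: binomial_eq_0)
  also have "\<dots> - (\<Sum>i\<le>k. (-1) ^ i * int (k choose i) * g (Suc i))
     = g 0 + (\<Sum>i\<le>k. (-1) ^ Suc i * int (Suc k choose Suc i) * g (Suc i))"
    by (simp add: algebra_simps sum_subtractf[symmetric] flip: sum.distrib)
  also have "\<dots> = (\<Sum>i\<le>Suc k. (-1) ^ i * int (Suc k choose i) * g i)"
    by (subst sum.atMost_Suc_shift) simp
  finally show ?case by (simp add: g_def)
qed

locale prime_power =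
  fixes p k q :: nat
  assumes prime_p: "prime p" and k_pos: "k > 0" and q_def: "q = p ^ k"
begin

abbreviation sc where "sc \<equiv> signed_count q"
abbreviation eqp (infix "\<equiv>\<^sub>p" 50) where "a \<equiv>\<^sub>p b \<equiv> [a = b] (mod int p)"

lemma p_ge_2: "p \<ge> 2" using prime_p by (rule prime_ge_2_nat)
lemma q_ge_2: "q \<ge> 2" using p_ge_2 k_pos self_le_power[of p k] unfolding q_def
  by linarith

lemma sc_cong_add_mset:
  assumes "\<And>v. sc M v \<equiv>\<^sub>p sc N v" shows "sc (add_mset x M) v \<equiv>\<^sub>p sc (add_mset x N) v"
  unfolding signed_count_add_mset by (intro cong_diff assms)

lemma sc_cong_add:
  assumes "\<And>v. sc M v \<equiv>\<^sub>p sc N v" shows "sc (L + M) v \<equiv>\<^sub>p sc (L + N) v"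
  by (induction L arbitrary: v) (auto intro: assms sc_cong_add_mset)

text \<open>Modulo p the inner binomial coefficients vanish, so (1 - X^x)^p = 1 - X^(p x). For p = 2
  the last sign is right because 1 = -1.\<close>

lemma sc_frobenius:
  "sc (replicate_mset p x + M) v \<equiv>\<^sub>p sc (add_mset (int p * fst x, int p * snd x) M) v"
proof -
  let ?g = "\<lambda>i. sc M (v + (int i * fst x, int i * snd x))"
  have p0: "{..p} = insert 0 (insert p {0<..<p})" using p_ge_2 by auto
  have "(\<Sum>i\<in>{0<..<p}. (-1) ^ i * int (p choose i) * ?g i) \<equiv>\<^sub>p 0"
    unfolding cong_0_iff using prime_p
    by (intro dvd_sum dvd_mult2 dvd_mult) (auto intro!: dvd_choose_prime)
  moreover have "(-1) ^ p * ?g p \<equiv>\<^sub>p - ?g p"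
  proof (cases "p = 2")
    case True
    then show ?thesis by (simp add: cong_iff_dvd_diff)
  next
    case False
    then have "odd p" using prime_p p_ge_2 prime_odd_nat[of p] by linarith
    then show ?thesis by simp
  qed
  ultimately have "?g 0 + ((-1) ^ p * ?g p + (\<Sum>i\<in>{0<..<p}. (-1) ^ i * int (p choose i) * ?g i))
      \<equiv>\<^sub>p ?g 0 + (- ?g p + 0)" by (intro cong_add) auto
  then show ?thesis
    unfolding signed_count_replicate p0 using p_ge_2
    by (simp add: signed_count_add_mset flip: zero_prod_def)
qed

lemma sc_frobenius_power:
  "sc (replicate_mset (p ^ j) x + M) v \<equiv>\<^sub>p sc (add_mset (int (p ^ j) * fst x, int (p ^ j) * snd x) M) v"
proof (induction j arbitrary: x M v)
  case 0 then show ?case by simp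
next
  case (Suc j)
  have *: "sc (replicate_mset (r * p) x + M) v \<equiv>\<^sub>p
      sc (replicate_mset r (int p * fst x, int p * snd x) + M) v" for r M v
  proof (induction r arbitrary: M v)
    case 0 then show ?case by simp
  next
    case (Suc r)
    let ?y = "(int p * fst x, int p * snd x)"
    have "sc (replicate_mset (Suc r * p) x + M) v
        = sc (replicate_mset (r * p) x + (replicate_mset p x + M)) v"
      by (simp add: replicate_mset_plus add.assoc add.left_commute)
    also have "\<dots> \<equiv>\<^sub>p sc (replicate_mset r ?y + (replicate_mset p x + M)) v" by (rule Suc.IH)
    also have "sc (replicate_mset r ?y + (replicate_mset p x + M)) v \<equiv>\<^sub>p sc (replicate_mset r ?y + (add_mset ?y M)) v"
      by (intro sc_cong_add sc_frobenius)
    finally show ?case by simp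
  qed
  show ?case using cong_trans[OF *[of "p ^ j"] Suc.IH] by (simp add: ac_simps)
qed

text \<open>q equal factors give 1 - X^(q x) = 0 in the group ring of Z_q^2 modulo p.\<close>

lemma sc_replicate_q: "j \<ge> q \<Longrightarrow> sc (replicate_mset j x + M) v \<equiv>\<^sub>p 0"
proof -
  assume j: "j \<ge> q"
  let ?N = "replicate_mset (j - q) x + M"
  have "sc (replicate_mset j x + M) v = sc (replicate_mset q x + ?N) v"
    using j by (simp flip: add.assoc replicate_mset_plus)
  also have "\<dots> \<equiv>\<^sub>p sc (add_mset (int q * fst x, int q * snd x) ?N) v"
    using sc_frobenius_power[of k x ?N v] by (simp only: q_def[symmetric])
  also have "sc (add_mset (int q * fst x, int q * snd x) ?N) v = 0"
    by (simp add: signed_count_add_mset signed_count_periodic null_mod_def)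
  finally show ?thesis .
qed

text \<open>The entries of \<open>R\<close> are expanded one by one into basis vectors; 2q - 1 basis
  vectors contain q equal ones. All arguments \<open>v\<close> are treated at once because each
  expansion produces shifts.\<close>

lemma sc_basis_add_eq_0:
  assumes "i + j + size R \<ge> 2 * q - 1"
  shows "sc (R + (replicate_mset i (1, 0) + replicate_mset j (0, 1))) v \<equiv>\<^sub>p 0"
  using assms
proof (induction R arbitrary: i j v)
  case empty
  then have "i \<ge> q \<or> j \<ge> q" by auto
  then show ?case
    using sc_replicate_q[of i "(1,0)" "replicate_mset j (0, 1)" v]
      sc_replicate_q[of j "(0,1)" "replicate_mset i (1, 0)" v] by (auto simp: add.commute)
next
  case (add x R)
  let ?B = "\<lambda>i j. R + (replicate_mset i (1, 0) + replicate_mset j (0, 1))"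
  have "\<forall>v. sc (add_mset x (?B i j)) v \<equiv>\<^sub>p 0"
  proof (induction x rule: int_pair_induct)
    case e1 show ?case using add.IH[of "Suc i" j] add.prems by simp
  next
    case e2 show ?case using add.IH[of i "Suc j"] add.prems by simp
  next
    case (add x y)
    show ?case
    proof
      fix v show "sc (add_mset (x + y) (?B i j)) v \<equiv>\<^sub>p 0"
        using cong_add[OF add(1)[rule_format, of v] add(2)[rule_format, of "v + x"]]
        by (simp add: signed_count_add)
    qed
  next
    case (minus x)
    show ?case
    proof
      fix v
      have "sc (add_mset x (?B i j)) (v - x) \<equiv>\<^sub>p 0" by (rule minus[rule_format])
      then show "sc (add_mset (- x) (?B i j)) v \<equiv>\<^sub>p 0" by (simp add: signed_count_minus cong_0_iff)
    qed
  qed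
  then show ?case by (simp del: split_paired_All)
qed

lemma sc_eq_0: "size M \<ge> 2 * q - 1 \<Longrightarrow> sc M v \<equiv>\<^sub>p 0"
  using sc_basis_add_eq_0[of 0 0 M v] by simp

text \<open>The Davenport bound for Z_q^2: the coefficient at 0 would be 1, but also 0 modulo
  p.\<close>

lemma zsf_size_le: "zsf q M \<Longrightarrow> size M \<le> 2 * q - 2"
proof (rule ccontr)
  assume "zsf q M" "\<not> size M \<le> 2 * q - 2"
  then have "int p dvd 1" using sc_eq_0[of M 0] signed_count_zsf[of q M] by (simp add: cong_0_iff)
  then show False using p_ge_2 by simp
qed

text \<open>One more factor 1 - X^v annihilates the product, so its coefficients are invariant under
  the shift by v.\<close>

lemma sc_top_const: "size M = 2 * q - 2 \<Longrightarrow> sc M v \<equiv>\<^sub>p sc M 0"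
  using sc_eq_0[of "add_mset v M" 0] q_ge_2
  by (simp add: signed_count_add_mset cong_0_iff cong_iff_dvd_diff dvd_diff_commute)

lemma sc_top_add:
  "size M + 1 = 2 * q - 2 \<Longrightarrow> sc (add_mset (x + y) M) 0 \<equiv>\<^sub>p sc (add_mset x M) 0 + sc (add_mset y M) 0"
  unfolding signed_count_add by (intro cong_add cong_refl sc_top_const) simp

lemma sc_top_minus:
  "size M + 1 = 2 * q - 2 \<Longrightarrow> sc (add_mset (- x) M) 0 \<equiv>\<^sub>p - sc (add_mset x M) 0"
  unfolding signed_count_minus by (intro cong_minus_minus_iff[THEN iffD2] sc_top_const) simp

text \<open>A multiadditive function is determined by its values on multisets of basis vectors; that
  it vanishes at 0 and is odd follows from additivity.\<close>

lemma multiadditive_eq_0: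
  fixes \<Phi> :: "(int \<times> int) multiset \<Rightarrow> int"
  assumes add: "\<And>T x y. size T + 1 = N \<Longrightarrow> \<Phi> (add_mset (x + y) T) \<equiv>\<^sub>p \<Phi> (add_mset x T) + \<Phi> (add_mset y T)"
    and basis: "\<And>i j. i + j = N \<Longrightarrow> \<Phi> (replicate_mset i (1, 0) + replicate_mset j (0, 1)) \<equiv>\<^sub>p 0"
    and "size M = N"
  shows "\<Phi> M \<equiv>\<^sub>p 0"
proof -
  have "\<Phi> (R + (replicate_mset i (1, 0) + replicate_mset j (0, 1))) \<equiv>\<^sub>p 0" if "i + j + size R = N" for R i j
    using that
  proof (induction R arbitrary: i j)
    case empty then show ?case using basis by simp
  next
    case (add x R)
    let ?B = "R + (replicate_mset i (1, 0) + replicate_mset j (0, 1))"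
    have N: "size ?B + 1 = N" using add.prems by simp
    have zero: "\<Phi> (add_mset 0 ?B) \<equiv>\<^sub>p 0"
    proof -
      have "\<Phi> (add_mset 0 ?B) \<equiv>\<^sub>p \<Phi> (add_mset 0 ?B) + \<Phi> (add_mset 0 ?B)"
        using assms(1)[OF N, of 0 0] by (simp only: add_0)
      then show ?thesis by (simp add: cong_iff_dvd_diff)
    qed
    have "\<Phi> (add_mset x ?B) \<equiv>\<^sub>p 0"
    proof (induction x rule: int_pair_induct)
      case e1 show ?case using add.IH[of "Suc i" j] add.prems by simp
    next
      case e2 show ?case using add.IH[of i "Suc j"] add.prems by simp
    next
      case (add x y)
      show ?case using cong_trans[OF assms(1)[OF N] cong_add[OF add]] by simp
    next
      case (minus x)
      have "\<Phi> (add_mset x ?B) + \<Phi> (add_mset (- x) ?B) \<equiv>\<^sub>p 0"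
        using cong_trans[OF cong_sym[OF assms(1)[OF N, of x "- x"]]] zero by simp
      then show ?case using minus by (simp add: cong_0_iff dvd_add_right_iff)
    qed
    then show ?case by simp
  qed
  from this[of 0 0 M] show ?thesis using assms(3) by simp
qed

end

section \<open>Prime moduli\<close>

lemma dvd_sum_mset: "(\<And>t. t \<in># M \<Longrightarrow> d dvd f t) \<Longrightarrow> (d::int) dvd (\<Sum>t\<in>#M. f t)"
  by (induction M) auto

lemma fst_sum_mset: "fst (\<Sum>t\<in>#M. f t) = (\<Sum>t\<in>#M. fst (f t))"
  by (induction M) auto

lemma snd_sum_mset: "snd (\<Sum>t\<in>#M. f t) = (\<Sum>t\<in>#M. snd (f t))"
  by (induction M) auto

lemma sum_replicate_mset_pair: "\<Sum>\<^sub># (replicate_mset k x) = (int k * fst x, int k * snd x)"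
  by (induction k) (auto simp: prod_eq_iff algebra_simps)

lemma cong_sum_mset: "(\<And>t. t \<in># M \<Longrightarrow> [f t = g t] (mod d)) \<Longrightarrow> [(\<Sum>t\<in>#M. f t) = (\<Sum>t\<in>#M. g t)] (mod (d::int))"
  by (induction M) (auto intro: cong_add)

lemma sum_mset_subtract: "(\<Sum>t\<in>#M. f t - g t :: int) = (\<Sum>t\<in>#M. f t) - (\<Sum>t\<in>#M. g t)"
  by (induction M) auto

lemma signed_count_add_mset_null:
  "null_mod n w \<Longrightarrow> signed_count n (add_mset (x + w) M) v = signed_count n (add_mset x M) v"
  using signed_count_periodic[of n w M "v + x"] by (simp add: signed_count_add_mset add.assoc)

context prime_power
begin

lemma sc_top_linear:
  assumes "size M + 1 = 2 * q - 2"
  shows "sc (add_mset x M) 0 \<equiv>\<^sub>p fst x * sc (add_mset (1, 0) M) 0 + snd x * sc (add_mset (0, 1) M) 0"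
proof (induction x rule: int_pair_induct)
  case (add x y)
  show ?case using cong_trans[OF sc_top_add[OF assms] cong_add[OF add]] by (simp add: algebra_simps)
next
  case (minus x)
  show ?case using cong_trans[OF sc_top_minus[OF assms] cong_minus_minus_iff[THEN iffD2, OF minus]]
    by (simp add: algebra_simps)
qed auto

lemma sc_top_bilinear:
  assumes "size M + 2 = 2 * q - 2"
  defines "P \<equiv> \<lambda>x y. sc (add_mset x (add_mset y M)) 0"
  shows "P x y \<equiv>\<^sub>p fst x * fst y * P (1, 0) (1, 0) + (fst x * snd y + snd x * fst y) * P (1, 0) (0, 1)
    + snd x * snd y * P (0, 1) (0, 1)"
proof -
  have comm: "P u v = P v u" for u v by (simp add: P_def add_mset_commute)
  have lin: "P u v \<equiv>\<^sub>p fst u * P (1, 0) v + snd u * P (0, 1) v" for u v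
    unfolding P_def using assms(1) by (intro sc_top_linear) simp
  have "fst x * P (1, 0) y + snd x * P (0, 1) y \<equiv>\<^sub>p
     fst x * (fst y * P (1, 0) (1, 0) + snd y * P (0, 1) (1, 0))
     + snd x * (fst y * P (1, 0) (0, 1) + snd y * P (0, 1) (0, 1))"
    using lin[of y "(1,0)"] lin[of y "(0,1)"]
    by (intro cong_add cong_mult cong_refl) (simp_all only: comm[of _ y])
  with lin[of x y] have "P x y \<equiv>\<^sub>p fst x * (fst y * P (1, 0) (1, 0) + snd y * P (0, 1) (1, 0))
     + snd x * (fst y * P (1, 0) (0, 1) + snd y * P (0, 1) (0, 1))"
    by (rule cong_trans)
  then show ?thesis by (simp add: algebra_simps comm[of "(0,1)" "(1,0)"])
qed

lemma sc_basis_eq_1: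
  assumes "i < q" "j < q"
  shows "sc (replicate_mset i (1, 0) + replicate_mset j (0, 1)) 0 = 1"
proof -
  have null: "null_mod q (int a, int b) \<longleftrightarrow> a = 0 \<and> b = 0" if "a \<le> i" "b \<le> j" for a b
    using that assms by (auto simp: null_mod_def dest: dvd_imp_le)
  have inner: "sc (replicate_mset j (0, 1)) (int a, 0) = of_bool (a = 0)" if "a \<le> i" for a
  proof -
    have "sc (replicate_mset j (0, 1) + {#}) (int a, 0)
        = (\<Sum>b\<le>j. if b = 0 then of_bool (a = 0) else 0)"
      unfolding signed_count_replicate using that by (intro sum.cong) (auto simp: null)
    then show ?thesis by (simp add: sum.delta)
  qed
  have "sc (replicate_mset i (1, 0) + replicate_mset j (0, 1)) 0 = (\<Sum>a\<le>i. if a = 0 then 1 else 0)"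
    unfolding signed_count_replicate by (intro sum.cong) (auto simp: inner)
  then show ?thesis by (simp add: sum.delta)
qed

text \<open>For an odd number of factors, reflection gives opposite coefficients at 0 and at minus
  the sum of \<open>T\<close>. Twice the coefficient at 0 is therefore their difference, that is, a
  product with the additional factor for minus the sum, which is linear in that entry.\<close>

lemma sc_defect_1:
  assumes "size T = 2 * q - 3"
  shows "2 * sc T 0 \<equiv>\<^sub>p - sc (add_mset (\<Sum>\<^sub># T) T) 0"
proof -
  have "odd (size T)" using assms q_ge_2 by (simp add: even_diff_nat)
  then have "sc T (- \<Sum>\<^sub># T) = - sc T 0" using signed_count_reflect[of q T 0] by simp
  then have "2 * sc T 0 = sc (add_mset (- \<Sum>\<^sub># T) T) 0" by (simp add: signed_count_add_mset)
  then show ?thesis using sc_top_minus[of T "\<Sum>\<^sub># T"] assms q_ge_2 by simp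
qed

end

section \<open>The second-order relation for primes from 5 on\<close>

locale prime_ge_5 =
  fixes p :: nat
  assumes prime: "prime p" and ge_5: "p \<ge> 5"
begin

sublocale prime_power p 1 p
  by unfold_locales (simp_all add: prime)

text \<open>\<open>24 * sc\<close> fails to be additive in one entry by a product with 2p - 3
  factors, which \<open>sc_defect_1\<close> expresses by the trilinear form \<open>Q\<close>. The
  two correction terms are cubic in that entry and fail by the same amount.\<close>

lemma sc_defect_2_add:
  assumes "size T + 1 = 2 * p - 4"
  defines "E \<equiv> \<lambda>T. 24 * sc T 0 - 3 * sc (add_mset (\<Sum>\<^sub># T) (add_mset (\<Sum>\<^sub># T) T)) 0
    - (\<Sum>t\<in>#T. sc (add_mset t (add_mset t T)) 0)"
  shows "E (add_mset (x + y) T) \<equiv>\<^sub>p E (add_mset x T) + E (add_mset y T)"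
proof -
  define Q where "Q a b c = sc (add_mset a (add_mset b (add_mset c T))) 0" for a b c
  define s where "s = \<Sum>\<^sub># T"
  have lin: "Q (a + b) c d \<equiv>\<^sub>p Q a c d + Q b c d" for a b c d
    unfolding Q_def by (intro sc_top_add) (use assms(1) ge_5 in simp)
  have comm: "Q a b c = Q b a c" "Q a b c = Q a c b" for a b c
    by (simp_all add: Q_def add_mset_commute)
  have comm3: "Q a b c = Q c a b" for a b c using comm by metis
  define q1 where "q1 = Q (1,0) (1,0) (1,0)"
  define q2 where "q2 = Q (1,0) (1,0) (0,1)"
  define q3 where "q3 = Q (1,0) (0,1) (0,1)"
  define q4 where "q4 = Q (0,1) (0,1) (0,1)"
  \<comment> \<open>\<open>R\<close> is the polynomial representing \<open>Q\<close> modulo p and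
    \<open>\<delta>\<close> below is the error; what remains is then a polynomial identity.\<close>
  define R where "R a b c = fst a * fst b * fst c * q1
     + (fst a * fst b * snd c + fst a * snd b * fst c + snd a * fst b * fst c) * q2
     + (fst a * snd b * snd c + snd a * fst b * snd c + snd a * snd b * fst c) * q3
     + snd a * snd b * snd c * q4" for a b c
  have QR: "int p dvd Q a b c - R a b c" for a b c
  proof -
    have 1: "Q u v w \<equiv>\<^sub>p fst u * Q (1, 0) v w + snd u * Q (0, 1) v w" for u v w
      unfolding Q_def by (intro sc_top_linear) (use assms(1) ge_5 in simp)
    have 2: "Q u v w \<equiv>\<^sub>p fst v * fst w * Q u (1, 0) (1, 0)
       + (fst v * snd w + snd v * fst w) * Q u (1, 0) (0, 1) + snd v * snd w * Q u (0, 1) (0, 1)" for u v w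
      using sc_top_bilinear[of "add_mset u T" v w] assms(1) ge_5
      by (simp add: Q_def add_mset_commute)
    have c1: "Q (0,1) (1,0) (1,0) = q2" unfolding q2_def by (rule comm3[symmetric])
    have c2: "Q (0,1) (1,0) (0,1) = q3" unfolding q3_def by (rule comm)
    have A: "Q (1,0) b c \<equiv>\<^sub>p fst b * fst c * q1 + (fst b * snd c + snd b * fst c) * q2 + snd b * snd c * q3"
      using 2[of "(1,0)" b c] by (simp add: q1_def q2_def q3_def)
    have B: "Q (0,1) b c \<equiv>\<^sub>p fst b * fst c * q2 + (fst b * snd c + snd b * fst c) * q3 + snd b * snd c * q4"
      using 2[of "(0,1)" b c] by (simp add: c1 c2 q4_def)
    have "Q a b c \<equiv>\<^sub>p fst a * (fst b * fst c * q1 + (fst b * snd c + snd b * fst c) * q2 + snd b * snd c * q3)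
       + snd a * (fst b * fst c * q2 + (fst b * snd c + snd b * fst c) * q3 + snd b * snd c * q4)"
      using cong_trans[OF 1[of a b c] cong_add[OF cong_mult[OF cong_refl A] cong_mult[OF cong_refl B]]] .
    then have "Q a b c \<equiv>\<^sub>p R a b c" by (simp add: R_def algebra_simps)
    then show ?thesis by (simp add: cong_iff_dvd_diff)
  qed
  have E_eq: "E (add_mset a T) = 24 * sc (add_mset a T) 0 - 3 * Q a (s + a) (s + a) - Q a a a
       - (\<Sum>t\<in>#T. Q a t t)" for a
    by (simp add: E_def Q_def s_def add_mset_commute add.commute)
  have sum: "int p dvd (\<Sum>t\<in>#T. Q (x + y) t t - Q x t t - Q y t t)"
  proof (rule dvd_sum_mset)
    fix t
    have "Q (x + y) t t - Q x t t - Q y t t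
        = (Q (x + y) t t - R (x + y) t t) - (Q x t t - R x t t) - (Q y t t - R y t t)"
      by (simp add: R_def algebra_simps)
    then show "int p dvd Q (x + y) t t - Q x t t - Q y t t" using QR by (metis dvd_diff)
  qed
  \<comment> \<open>This is 1 - X^(x+y) = (1 - X^x) + (1 - X^y) - (1 - X^x)(1 - X^y).\<close>
  have first: "sc (add_mset (x + y) T) 0 - sc (add_mset x T) 0 - sc (add_mset y T) 0
     = - sc (add_mset x (add_mset y T)) 0"
    unfolding signed_count_add by (simp add: signed_count_add_mset)
  have "2 * sc (add_mset x (add_mset y T)) 0 \<equiv>\<^sub>p - Q (s + x + y) x y"
    using sc_defect_1[of "add_mset x (add_mset y T)"] assms(1) ge_5 by (simp add: Q_def s_def add_ac)
  then have dp: "int p dvd 2 * sc (add_mset x (add_mset y T)) 0 + Q (s + x + y) x y"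
    by (simp add: cong_iff_dvd_diff)
  define \<delta> where "\<delta> a b c = Q a b c - R a b c" for a b c
  have \<delta>: "int p dvd \<delta> a b c" for a b c unfolding \<delta>_def by (rule QR)
  have Q\<delta>: "Q a b c = R a b c + \<delta> a b c" for a b c by (simp add: \<delta>_def)
  have comb: "int p dvd - 12 * X + (12 * \<delta> (s + x + y) x y
     - 3 * (\<delta> (x + y) (s + (x + y)) (s + (x + y)) - \<delta> x (s + x) (s + x) - \<delta> y (s + y) (s + y))
     - (\<delta> (x + y) (x + y) (x + y) - \<delta> x x x - \<delta> y y y)) - Y"
    if "int p dvd X" "int p dvd Y" for X Y
    using that \<delta> by (intro dvd_add dvd_diff dvd_mult)
  have "E (add_mset (x + y) T) - E (add_mset x T) - E (add_mset y T)
     = - 12 * (2 * sc (add_mset x (add_mset y T)) 0 + Q (s + x + y) x y)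
     + (12 * Q (s + x + y) x y
     - 3 * (Q (x + y) (s + (x + y)) (s + (x + y)) - Q x (s + x) (s + x) - Q y (s + y) (s + y))
     - (Q (x + y) (x + y) (x + y) - Q x x x - Q y y y))
     - (\<Sum>t\<in>#T. Q (x + y) t t - Q x t t - Q y t t)"
    unfolding E_eq using first by (simp add: sum_mset_subtract)
  also have "12 * Q (s + x + y) x y
     - 3 * (Q (x + y) (s + (x + y)) (s + (x + y)) - Q x (s + x) (s + x) - Q y (s + y) (s + y))
     - (Q (x + y) (x + y) (x + y) - Q x x x - Q y y y)
    = 12 * \<delta> (s + x + y) x y
     - 3 * (\<delta> (x + y) (s + (x + y)) (s + (x + y)) - \<delta> x (s + x) (s + x) - \<delta> y (s + y) (s + y))
     - (\<delta> (x + y) (x + y) (x + y) - \<delta> x x x - \<delta> y y y)"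
    unfolding Q\<delta> R_def fst_add snd_add by algebra
  finally have "int p dvd E (add_mset (x + y) T) - E (add_mset x T) - E (add_mset y T)"
    using comb[OF dp sum] by simp
  then show ?thesis by (simp add: cong_iff_dvd_diff algebra_simps)
qed

text \<open>The constants arise by reading X^t as e^t: 1 - e^t = -t e^(t/2) (1 + t^2/24 + ...). If s
  is the sum of \<open>T\<close>, the product of the factors beside -t has degree-two part s^2/8
  plus the sum of t^2/24; multiplication by 24 gives 3 and 1, and each further factor t corresponds
  to an added entry. Formally, the difference of the two sides is additive in each entry and is
  checked on basis vectors.\<close>

lemma sc_defect_2:
  assumes "size T = 2 * p - 4"
  shows "24 * sc T 0 \<equiv>\<^sub>p 3 * sc (add_mset (\<Sum>\<^sub># T) (add_mset (\<Sum>\<^sub># T) T)) 0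
    + (\<Sum>t\<in>#T. sc (add_mset t (add_mset t T)) 0)"
proof -
  define E where "E T = 24 * sc T 0 - 3 * sc (add_mset (\<Sum>\<^sub># T) (add_mset (\<Sum>\<^sub># T) T)) 0
    - (\<Sum>t\<in>#T. sc (add_mset t (add_mset t T)) 0)" for T
  have "E T \<equiv>\<^sub>p 0"
  proof (rule multiadditive_eq_0[OF _ _ assms])
    show "E (add_mset (x + y) T) \<equiv>\<^sub>p E (add_mset x T) + E (add_mset y T)"
      if "size T + 1 = 2 * p - 4" for T x y
      unfolding E_def using sc_defect_2_add[OF that, of x y] .
    fix i j assume ij: "i + j = 2 * p - 4"
    define B where "B i j = replicate_mset i (1, 0) + replicate_mset j (0::int, 1::int)" for i j :: nat
    have sum: "\<Sum>\<^sub># (B i j) = (int i, int j)"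
      by (simp add: B_def sum_replicate_mset_pair)
    have B_add: "add_mset (1, 0) (B i j) = B (Suc i) j" "add_mset (0, 1) (B i j) = B i (Suc j)" for i j
      by (simp_all add: B_def)
    define v where "v i j = (of_bool (i < p \<and> j < p) :: int)" for i j
    have v: "sc (B i j) 0 \<equiv>\<^sub>p v i j" for i j
    proof (cases "i < p \<and> j < p")
      case True then show ?thesis using sc_basis_eq_1[of i j] by (simp add: v_def B_def)
    next
      case False
      then show ?thesis using sc_replicate_q[of i "(1,0)" "replicate_mset j (0, 1)" 0]
        sc_replicate_q[of j "(0,1)" "replicate_mset i (1, 0)" 0] by (auto simp: v_def B_def add.commute)
    qed
    have "size (B i j) + 2 = 2 * p - 2" using ij ge_5 by (simp add: B_def)
    from sc_top_bilinear[OF this, of "(int i, int j)" "(int i, int j)"]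
    have bil: "sc (add_mset (int i, int j) (add_mset (int i, int j) (B i j))) 0 \<equiv>\<^sub>p
       int i * int i * v (i + 2) j + 2 * int i * int j * v (i + 1) (j + 1) + int j * int j * v i (j + 2)"
      unfolding B_add
      by (rule cong_trans) (use v in \<open>auto simp: B_add algebra_simps intro!: cong_add cong_mult\<close>)
    have E_B: "E (B i j) = 24 * sc (B i j) 0 - 3 * sc (add_mset (int i, int j) (add_mset (int i, int j) (B i j))) 0
       - (int i * sc (B (i + 2) j) 0 + int j * sc (B i (j + 2)) 0)"
      unfolding E_def sum by (simp add: B_def)
    have "E (B i j) \<equiv>\<^sub>p 24 * v i j - 3 * (int i * int i * v (i + 2) j
       + 2 * int i * int j * v (i + 1) (j + 1) + int j * int j * v i (j + 2))
       - (int i * v (i + 2) j + int j * v i (j + 2))"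
      unfolding E_B by (intro cong_diff cong_add cong_mult cong_refl v bil)
    also have "24 * v i j - 3 * (int i * int i * v (i + 2) j
       + 2 * int i * int j * v (i + 1) (j + 1) + int j * int j * v i (j + 2))
       - (int i * v (i + 2) j + int j * v i (j + 2)) \<equiv>\<^sub>p 0"
    proof -
      \<comment> \<open>If i or j reaches p, all four values of \<open>v\<close> vanish; otherwise i
        + j = 2p - 4 leaves three possibilities.\<close>
      consider "i \<ge> p \<or> j \<ge> p" | "i = p - 3" "j = p - 1" | "i = p - 2" "j = p - 2" | "i = p - 1" "j = p - 3"
        using ij ge_5 by linarith
      then show ?thesis
      proof cases
        case 1 then show ?thesis by (auto simp: v_def)
      next
        case 2
        then have "int i = int p - 3" "int j = int p - 1" using ge_5 by auto
        moreover have "v i j = 1" "v (i + 2) j = 1" "v (i + 1) (j + 1) = 0" "v i (j + 2) = 0"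
          using 2 ge_5 by (auto simp: v_def)
        moreover have "24 - 3 * ((int p - 3) * (int p - 3)) - (int p - 3) = int p * (17 - 3 * int p)"
          by algebra
        ultimately show ?thesis by (simp add: cong_0_iff)
      next
        case 3
        then have "int i = int p - 2" "int j = int p - 2" using ge_5 by auto
        moreover have "v i j = 1" "v (i + 2) j = 0" "v (i + 1) (j + 1) = 1" "v i (j + 2) = 0"
          using 3 ge_5 by (auto simp: v_def)
        moreover have "24 - 3 * (2 * (int p - 2) * (int p - 2)) = int p * (24 - 6 * int p)"
          by algebra
        ultimately show ?thesis by (simp add: cong_0_iff)
      next
        case 4
        then have "int i = int p - 1" "int j = int p - 3" using ge_5 by auto
        moreover have "v i j = 1" "v (i + 2) j = 0" "v (i + 1) (j + 1) = 0" "v i (j + 2) = 1"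
          using 4 ge_5 by (auto simp: v_def)
        moreover have "24 - 3 * ((int p - 3) * (int p - 3)) - (int p - 3) = int p * (17 - 3 * int p)"
          by algebra
        ultimately show ?thesis by (simp add: cong_0_iff)
      qed
    qed
    finally show "E (replicate_mset i (1, 0) + replicate_mset j (0, 1)) \<equiv>\<^sub>p 0"
      by (simp add: B_def)
  qed
  then show ?thesis by (simp add: E_def cong_iff_dvd_diff algebra_simps)
qed

end

section \<open>Determinant coordinates and the large multiplicity for primes\<close>

definition det :: "int \<times> int \<Rightarrow> int \<times> int \<Rightarrow> int" where
  "det x y = fst x * snd y - snd x * fst y"

definition bil :: "int \<Rightarrow> int \<Rightarrow> int \<Rightarrow> int \<times> int \<Rightarrow> int \<times> int \<Rightarrow> int" where
  "bil A B C x y = fst x * fst y * A + (fst x * snd y + snd x * fst y) * B + snd x * snd y * C"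

text \<open>Elements are integer pairs, so congruent but different representatives would split the
  multiplicity of a residue class; this condition excludes it.\<close>

definition reduced :: "nat \<Rightarrow> (int \<times> int) multiset \<Rightarrow> bool" where
  "reduced n S \<longleftrightarrow> (\<forall>x\<in>#S. \<forall>y\<in>#S. null_mod n (x - y) \<longrightarrow> x = y)"

text \<open>Cramer's rule det(g,h) u = det(u,h) g + det(g,u) h, inserted into both
  arguments.\<close>

lemma cramer_bil:
  "(det g h)\<^sup>2 * bil A B C u u
     = (det u h)\<^sup>2 * bil A B C g g + 2 * (det u h * det g u) * bil A B C g h + (det g u)\<^sup>2 * bil A B C h h"
  unfolding det_def bil_def by algebra

lemma cramer_bil':
  "det g h * bil A B C v u = det u h * bil A B C v g + det g u * bil A B C v h"
  unfolding det_def bil_def by algebra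

lemma sum_mset_linear: "(\<Sum>t\<in>#M. fst t * A + snd t * B) = fst (\<Sum>\<^sub># M) * A + snd (\<Sum>\<^sub># M) * (B::int)"
  by (induction M) (auto simp: algebra_simps)

lemma sum_mset_combination:
  fixes x y z :: int
  shows "(\<Sum>t\<in>#M. f t * x + 2 * g t * y + h t * z)
    = (\<Sum>t\<in>#M. f t) * x + 2 * (\<Sum>t\<in>#M. g t) * y + (\<Sum>t\<in>#M. h t) * z"
  by (induction M) (auto simp: algebra_simps)

lemma sum_mset_square:
  fixes x y :: int
  shows "(\<Sum>t\<in>#M. (x * f t - y * g t)\<^sup>2)
    = x\<^sup>2 * (\<Sum>t\<in>#M. (f t)\<^sup>2) - 2 * x * y * (\<Sum>t\<in>#M. f t * g t) + y\<^sup>2 * (\<Sum>t\<in>#M. (g t)\<^sup>2)"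
  by (induction M) (auto simp: algebra_simps power2_eq_square)

lemma sum_mset_mult_linear:
  fixes x y :: int
  shows "(\<Sum>t\<in>#M. (x * f t - y * g t) * g t) = x * (\<Sum>t\<in>#M. f t * g t) - y * (\<Sum>t\<in>#M. (g t)\<^sup>2)"
  by (induction M) (auto simp: algebra_simps power2_eq_square)

text \<open>The linear combination of the relations for the triples \<open>{g, g, h}\<close>, \<open>{g, g, h'}\<close> and
  \<open>{g, h, h'}\<close> from which the moments \<open>u\<close>, \<open>v\<close>, \<open>w\<close> cancel.\<close>

lemma pair_identity:
  fixes a a' b b' u v w X Y Z :: int
  defines "D \<equiv> b * a' - a * b'"
  defines "Ch \<equiv> \<lambda>a b. b\<^sup>2 * u + 2 * b * (1 - a) * v + (a\<^sup>2 - a) * w + 2 * b\<^sup>2 * (a - 1)"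
  shows "2 * b * (b - b') * ((a - 1) * b'\<^sup>2 + (a' - 1) * b\<^sup>2 + ((a - 1) * b' - (a' - 1) * b)\<^sup>2)
    = b * b' * Ch a b - b\<^sup>2 * Ch a' b'
      - D * b' * ((b\<^sup>2 * u - 2 * b * a * v + a\<^sup>2 * w) * X
        + 2 * (b * v - a * w) * 1 + w * Y - b\<^sup>2 * (6 - 2 * (X + Y + Z)))
      + (b' * (b\<^sup>2 * u - 2 * b * a * v + a\<^sup>2 * w) + 2 * b\<^sup>2 * b') * (D * X - (b - b'))
      + (D * w + 2 * b\<^sup>2 * D) * (b' * Y - (b - D)) + 2 * b * D * b' * (b * Z - (D + b'))"
  unfolding D_def Ch_def by (simp add: algebra_simps power2_eq_square)

lemma dvd_combination:
  assumes "d dvd a" "d dvd b" "d dvd c" "d dvd a'" "d dvd b'" "d dvd (c'::int)"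
  shows "d dvd x * a - y * b - z * c + x' * a' + y' * b' + z' * c'"
  using assms by (intro dvd_add dvd_diff dvd_mult)

lemma sum_mset_if_eq: "(\<Sum>t\<in>#M. if t = h then x else (y::int)) = int (count M h) * x + (int (size M) - int (count M h)) * y"
  by (induction M) (auto simp: algebra_simps)

lemma count_eq_size: "(\<And>t. t \<in># M \<Longrightarrow> t = g) \<Longrightarrow> count M g = size M"
  by (induction M) auto

lemma exists_count_ge_2:
  assumes "card (set_mset S) < size S" shows "\<exists>g. count S g \<ge> 2"
proof (rule ccontr)
  assume "\<not> ?thesis"
  then have "count S g \<le> 1" for g
    using not_less_eq_eq[of "count S g" 1] by (auto simp: numeral_2_eq_2)
  then have "size S \<le> (\<Sum>g\<in>set_mset S. 1)"
    unfolding size_multiset_overloaded_eq by (intro sum_mono)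
  then show False using assms by simp
qed

context prime_ge_5
begin

lemma prime_int: "prime (int p)" using prime by simp

lemma p_dvd_mult_iff: "int p dvd a * b \<longleftrightarrow> int p dvd a \<or> int p dvd b"
  using prime_int by (rule prime_dvd_mult_iff)

lemma not_p_dvd_2: "\<not> int p dvd 2"
  using ge_5 by (auto dest!: zdvd_imp_le)

lemma inverse_mod:
  assumes "\<not> int p dvd x" obtains y where "y * x \<equiv>\<^sub>p 1"
proof -
  have "coprime x (int p)" using prime_imp_coprime[OF prime_int assms] by (simp add: coprime_commute)
  then show ?thesis using that cong_solve_coprime_int[of x "int p"] by (auto simp: mult.commute)
qed

text \<open>The projective line modulo p has p + 1 points: \<open>f\<close> is the slope, with the
  value p for the vertical direction.\<close>

lemma card_pairwise_independent:
  assumes "finite X" "\<And>x y. x \<in> X \<Longrightarrow> y \<in> X \<Longrightarrow> int p dvd det x y \<Longrightarrow> x = y"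
  shows "card X \<le> p + 1"
proof -
  define f where "f x = (if int p dvd fst x then int p
     else ((SOME y. y * fst x \<equiv>\<^sub>p 1) * snd x) mod int p)" for x
  have inv: "(SOME y. y * fst x \<equiv>\<^sub>p 1) * fst x \<equiv>\<^sub>p 1" if "\<not> int p dvd fst x" for x :: "int \<times> int"
    by (rule someI_ex) (use inverse_mod[OF that] in blast)
  have lt: "k mod int p < int p" "k mod int p \<ge> 0" for k using ge_5 by simp_all
  have "inj_on f X"
  proof (rule inj_onI)
    fix x y assume xy: "x \<in> X" "y \<in> X" "f x = f y"
    have "int p dvd det x y"
    proof (cases "int p dvd fst x")
      case True
      then have "int p dvd fst y" using xy(3) lt by (auto simp: f_def split: if_splits) (metis less_irrefl lt)
      then show ?thesis using True by (simp add: det_def)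
    next
      case False
      then have y: "\<not> int p dvd fst y" using xy(3) lt by (auto simp: f_def split: if_splits) (metis less_irrefl lt)
      define a where "a = (SOME y. y * fst x \<equiv>\<^sub>p 1)"
      define b where "b = (SOME z. z * fst y \<equiv>\<^sub>p 1)"
      have "int p dvd a * fst x - 1" "int p dvd b * fst y - 1" "int p dvd a * snd x - b * snd y"
        using inv[OF False] inv[OF y] xy(3) False y
        by (auto simp: a_def b_def f_def mod_eq_dvd_iff cong_iff_dvd_diff)
      moreover have "det x y = - fst x * fst y * (a * snd x - b * snd y) + fst y * snd x * (a * fst x - 1)
          - fst x * snd y * (b * fst y - 1)"
        unfolding det_def by algebra
      ultimately show ?thesis by (metis dvd_add dvd_diff dvd_mult)
    qed
    then show "x = y" using assms(2) xy by blast
  qed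
  moreover have "f ` X \<subseteq> {0..int p}" using lt by (simp add: f_def image_subset_iff less_imp_le)
  ultimately have "card X \<le> card {0..int p}" by (metis card_image card_mono finite_atLeastAtMost_int)
  then show ?thesis by simp
qed

context
  fixes S
  assumes mzs: "mzs p S" and size_S: "size S = 2 * p - 1" and reduced: "reduced p S"
begin

lemma sc_remove: "x \<in># S \<Longrightarrow> sc (S - {#x#}) 0 = 1"
  by (intro signed_count_zsf mzs_remove mzs)

text \<open>The elements of \<open>S\<close> other than one x and one y define a linear form with
  value 1 at both x and y, since \<open>S\<close> without y and \<open>S\<close> without x are
  zero-sum free. Proportional vectors with the same nonzero value are equal.\<close>

lemma independent:
  assumes "x \<in># S" "y \<in># S" "int p dvd det x y" shows "x = y"
proof (rule ccontr)
  assume "x \<noteq> y"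
  then have "{#x, y#} \<subseteq># S" using assms by (simp add: insert_subset_eq_iff in_diff_count)
  then obtain M where S: "S = add_mset x (add_mset y M)" by (auto simp: mset_subset_eq_exists_conv)
  have M: "size M + 1 = 2 * p - 2" using size_S S ge_5 by simp
  define A where "A = sc (add_mset (1, 0) M) 0"
  define B where "B = sc (add_mset (0, 1) M) 0"
  have "sc (add_mset y M) 0 = 1" "sc (add_mset x M) 0 = 1"
    using sc_remove[of x] sc_remove[of y] by (simp_all add: S)
  then have "int p dvd fst x * A + snd x * B - 1" "int p dvd fst y * A + snd y * B - 1"
    using sc_top_linear[OF M, of x] sc_top_linear[OF M, of y]
    by (simp_all add: A_def B_def cong_iff_dvd_diff dvd_diff_commute)
  moreover have "fst x - fst y = fst x * (- (fst y * A + snd y * B - 1)) + fst y * (fst x * A + snd x * B - 1) + B * det x y"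
    "snd x - snd y = snd x * (- (fst y * A + snd y * B - 1)) + snd y * (fst x * A + snd x * B - 1) - A * det x y"
    unfolding det_def by algebra+
  ultimately have "null_mod p (x - y)" using assms(3)
    unfolding null_mod_def by (auto simp: dvd_minus_iff intro!: dvd_add dvd_diff dvd_mult simp del: minus_diff_eq)
  then show False using reduced assms \<open>x \<noteq> y\<close> by (auto simp: reduced_def)
qed

text \<open>Refilling two of the three gaps leaves \<open>S\<close> without one element, so the form
  has value 1 there; repetitions in the triple are allowed. The last clause is
  \<open>sc_defect_2\<close> for the remainder \<open>T\<close>, whose sum is -(x + y + z) modulo p:
  24 = 3 (Q + 6) plus the sum over \<open>T\<close>, where Q is the sum of the three diagonal
  values.\<close>

lemma bilinear_form:
  assumes "{#x, y, z#} \<subseteq># S"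
  obtains A B C where
    "\<And>u v. sc (add_mset u (add_mset v (S - {#x, y, z#}))) 0 \<equiv>\<^sub>p bil A B C u v"
    "bil A B C x y \<equiv>\<^sub>p 1" "bil A B C x z \<equiv>\<^sub>p 1" "bil A B C y z \<equiv>\<^sub>p 1"
    "(\<Sum>t\<in>#S. bil A B C t t) \<equiv>\<^sub>p 6 - 2 * (bil A B C x x + bil A B C y y + bil A B C z z)"
proof -
  define T where "T = S - {#x, y, z#}"
  have S: "S = add_mset x (add_mset y (add_mset z T))" using assms by (auto simp: T_def mset_subset_eq_exists_conv)
  have T: "size T = 2 * p - 4" "size T + 2 = 2 * p - 2" using size_S S ge_5 by auto
  define A where "A = sc (add_mset (1, 0) (add_mset (1, 0) T)) 0"
  define B where "B = sc (add_mset (1, 0) (add_mset (0, 1) T)) 0"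
  define C where "C = sc (add_mset (0, 1) (add_mset (0, 1) T)) 0"
  have form: "sc (add_mset u (add_mset v T)) 0 \<equiv>\<^sub>p bil A B C u v" for u v
    using sc_top_bilinear[OF T(2), of u v] by (simp add: A_def B_def C_def bil_def)
  have xyz: "sc (add_mset x (add_mset y T)) 0 = 1" "sc (add_mset x (add_mset z T)) 0 = 1"
    "sc (add_mset y (add_mset z T)) 0 = 1"
    using sc_remove[of x] sc_remove[of y] sc_remove[of z] by (simp_all add: S add_mset_commute)
  have 1: "bil A B C x y \<equiv>\<^sub>p 1" "bil A B C x z \<equiv>\<^sub>p 1" "bil A B C y z \<equiv>\<^sub>p 1"
    using form[of x y] form[of x z] form[of y z] by (simp_all add: xyz cong_sym_eq)
  define k where "k = x + y + z"
  have null: "null_mod p (\<Sum>\<^sub># S)" using mzs by (simp add: mzs_def)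
  have \<sigma>: "\<Sum>\<^sub># T = - k + \<Sum>\<^sub># S" by (simp add: S k_def)
  have "sc (add_mset (\<Sum>\<^sub># T) (add_mset (\<Sum>\<^sub># T) T)) 0 = sc (add_mset (- k) (add_mset (- k) T)) 0"
    unfolding \<sigma> signed_count_add_mset_null[OF null]
    by (subst add_mset_commute) (simp only: signed_count_add_mset_null[OF null])
  moreover have "bil A B C (- k) (- k) = bil A B C x x + bil A B C y y + bil A B C z z
      + 2 * (bil A B C x y + bil A B C x z + bil A B C y z)"
    unfolding bil_def k_def by simp algebra
  ultimately have 2: "sc (add_mset (\<Sum>\<^sub># T) (add_mset (\<Sum>\<^sub># T) T)) 0 \<equiv>\<^sub>p bil A B C x x + bil A B C y y + bil A B C z z
      + 2 * (bil A B C x y + bil A B C x z + bil A B C y z)"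
    using form[of "- k" "- k"] by simp
  also have "bil A B C x x + bil A B C y y + bil A B C z z + 2 * (bil A B C x y + bil A B C x z + bil A B C y z)
      \<equiv>\<^sub>p bil A B C x x + bil A B C y y + bil A B C z z + 2 * (1 + 1 + 1)"
    by (intro cong_add cong_mult cong_refl 1)
  finally have 3: "sc (add_mset (\<Sum>\<^sub># T) (add_mset (\<Sum>\<^sub># T) T)) 0 \<equiv>\<^sub>p bil A B C x x + bil A B C y y + bil A B C z z + 6"
    by simp
  have 4: "(\<Sum>t\<in>#T. sc (add_mset t (add_mset t T)) 0) \<equiv>\<^sub>p (\<Sum>t\<in>#T. bil A B C t t)"
    by (intro cong_sum_mset form)
  have "zsf p T" using mzs S by (intro mzs_zsf[OF mzs]) (simp add: subset_mset_def mset_subset_eq_exists_conv)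
  then have "24 \<equiv>\<^sub>p 3 * (bil A B C x x + bil A B C y y + bil A B C z z + 6) + (\<Sum>t\<in>#T. bil A B C t t)"
    using cong_trans[OF sc_defect_2[OF T(1)] cong_add[OF cong_mult[OF cong_refl 3] 4]]
    by (simp add: signed_count_zsf)
  then have "(\<Sum>t\<in>#S. bil A B C t t) \<equiv>\<^sub>p 6 - 2 * (bil A B C x x + bil A B C y y + bil A B C z z)"
    by (simp add: S cong_iff_dvd_diff dvd_diff_commute algebra_simps)
  then show ?thesis using that form 1 unfolding T_def by blast
qed

text \<open>For a repeated element g, the linear form \<open>a\<close> belonging to the removal of
  g, g and \<open>b u = det g u\<close> serve as coordinates. The relations of the triples {g, g, h}
  and {g, h, k} force c = a - 1 to vanish outside at most one element, whereas the sum of c over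
  \<open>S\<close> is 1 modulo p; this requires a multiplicity of p - 1.\<close>

theorem ex_count_ge_pred_prime: "\<exists>g\<in>#S. count S g \<ge> p - 1"
proof (rule ccontr)
  assume "\<not> ?thesis"
  then have count_le: "count S h + 2 \<le> p" if "h \<in># S" for h using that by force
  \<comment> \<open>Pairwise independent elements number at most p + 1, so some element of
    \<open>S\<close> is repeated.\<close>
  have "card (set_mset S) \<le> p + 1"
    using card_pairwise_independent[of "set_mset S"] independent by blast
  then have "card (set_mset S) < size S" using size_S ge_5 by simp
  then obtain g where g2: "count S g \<ge> 2" using exists_count_ge_2 by blast
  then have g: "g \<in># S" by (metis count_greater_zero_iff less_le_trans pos2)
  define M where "M = S - {#g, g#}"
  have S_gg: "S = add_mset g (add_mset g M)"
    using g2 by (auto simp: M_def multiset_eq_iff)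
  have M: "size M + 1 = 2 * p - 2" using size_S ge_5 by (simp add: S_gg)
  define A1 where "A1 = sc (add_mset (1, 0) M) 0"
  define A2 where "A2 = sc (add_mset (0, 1) M) 0"
  define a where "a u = fst u * A1 + snd u * A2" for u :: "int \<times> int"
  define b where "b u = det g u" for u
  have lin: "sc (add_mset u M) 0 \<equiv>\<^sub>p a u" for u
    unfolding a_def A1_def A2_def by (rule sc_top_linear[OF M])
  have a_g: "int p dvd a g - 1"
    using lin[of g] sc_remove[OF g] by (simp add: S_gg cong_iff_dvd_diff dvd_diff_commute)
  have b_g: "b g = 0" by (simp add: b_def det_def)
  have null: "null_mod p (\<Sum>\<^sub># S)" using mzs by (simp add: mzs_def)
  have sum_a: "int p dvd (\<Sum>t\<in>#S. a t)"
    unfolding a_def sum_mset_linear using null by (simp add: null_mod_def)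
  have sum_b: "int p dvd (\<Sum>t\<in>#S. b t)"
  proof -
    have "(\<Sum>t\<in>#S. b t) = (\<Sum>t\<in>#S. fst t * (- snd g) + snd t * fst g)"
      by (simp add: b_def det_def algebra_simps)
    then show ?thesis unfolding sum_mset_linear using null by (simp add: null_mod_def)
  qed
  \<comment> \<open>The passage to the coordinates (a, b) has determinant \<open>a g\<close>, which
    is 1 modulo p.\<close>
  have det_eq: "det u h \<equiv>\<^sub>p b h * a u - a h * b u" for u h
  proof -
    have "det u h - (b h * a u - a h * b u) = - (a g - 1) * det u h"
      unfolding a_def b_def det_def by algebra
    then show ?thesis using a_g dvd_diff_commute[of "int p" "a g" 1] by (simp add: cong_iff_dvd_diff)
  qed
  have b_nz: "\<not> int p dvd b h" if "h \<in># S" "h \<noteq> g" for h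
    using independent[OF g that(1)] that(2) by (auto simp: b_def)
  define Saa where "Saa = (\<Sum>t\<in>#S. (a t)\<^sup>2)"
  define Sab where "Sab = (\<Sum>t\<in>#S. a t * b t)"
  define Sbb where "Sbb = (\<Sum>t\<in>#S. (b t)\<^sup>2)"
  \<comment> \<open>The sum of the quadratic form over \<open>S\<close> depends on the form only
    through its values on g and h; its coefficients are the second moments of the
    coordinates.\<close>
  have moments: "(b h)\<^sup>2 * (\<Sum>t\<in>#S. bil A B C t t) \<equiv>\<^sub>p
      ((b h)\<^sup>2 * Saa - 2 * b h * a h * Sab + (a h)\<^sup>2 * Sbb) * bil A B C g g
      + 2 * (b h * Sab - a h * Sbb) * bil A B C g h + Sbb * bil A B C h h" for A B C h
  proof -
    have 1: "(b h)\<^sup>2 * (\<Sum>t\<in>#S. bil A B C t t)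
       = (\<Sum>t\<in>#S. (det t h)\<^sup>2 * bil A B C g g + 2 * (det t h * b t) * bil A B C g h + (b t)\<^sup>2 * bil A B C h h)"
      unfolding b_def sum_mset_distrib_left
      by (intro arg_cong[of _ _ sum_mset] image_mset_cong cramer_bil)
    have 2: "(\<Sum>t\<in>#S. (det t h)\<^sup>2 * bil A B C g g + 2 * (det t h * b t) * bil A B C g h + (b t)\<^sup>2 * bil A B C h h)
       \<equiv>\<^sub>p (\<Sum>t\<in>#S. (b h * a t - a h * b t)\<^sup>2 * bil A B C g g
          + 2 * ((b h * a t - a h * b t) * b t) * bil A B C g h + (b t)\<^sup>2 * bil A B C h h)"
      by (rule cong_sum_mset, rule cong_add[OF cong_add[OF cong_mult[OF cong_pow[OF det_eq] cong_refl]
            cong_mult[OF cong_mult[OF cong_refl cong_mult[OF det_eq cong_refl]] cong_refl]] cong_refl])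
    show ?thesis
      using 2 unfolding 1 sum_mset_combination sum_mset_square sum_mset_mult_linear Saa_def Sab_def Sbb_def
      by simp
  qed
  define Ch where "Ch h = (b h)\<^sup>2 * Saa + 2 * b h * (1 - a h) * Sab + ((a h)\<^sup>2 - a h) * Sbb
      + 2 * (b h)\<^sup>2 * (a h - 1)" for h
  \<comment> \<open>In the triple {g, g, h} all values are known: refilling h twice gives
    \<open>M\<close> with h, so the value at (h, h) is \<open>a h\<close>.\<close>
  have Ch: "int p dvd Ch h" if h: "h \<in># S" "h \<noteq> g" for h
  proof -
    have sub: "{#g, g, h#} \<subseteq># S"
      using h by (simp add: S_gg)
    obtain A B C where form: "\<And>u v. sc (add_mset u (add_mset v (S - {#g, g, h#}))) 0 \<equiv>\<^sub>p bil A B C u v"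
      and gg: "bil A B C g g \<equiv>\<^sub>p 1" and gh: "bil A B C g h \<equiv>\<^sub>p 1" "bil A B C g h \<equiv>\<^sub>p 1"
      and sum: "(\<Sum>t\<in>#S. bil A B C t t) \<equiv>\<^sub>p 6 - 2 * (bil A B C g g + bil A B C g g + bil A B C h h)"
      by (rule bilinear_form[OF sub], rule that)
    have "h \<in># M" using h by (simp add: S_gg)
    then have "add_mset h (add_mset h (S - {#g, g, h#})) = add_mset h M"
      by (simp add: S_gg)
    then have hh: "bil A B C h h \<equiv>\<^sub>p a h"
      using cong_trans[OF cong_sym[OF form[of h h]]] lin[of h] by simp
    have 1: "(b h)\<^sup>2 * (\<Sum>t\<in>#S. bil A B C t t) \<equiv>\<^sub>p
      ((b h)\<^sup>2 * Saa - 2 * b h * a h * Sab + (a h)\<^sup>2 * Sbb) * 1 + 2 * (b h * Sab - a h * Sbb) * 1 + Sbb * a h"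
      by (rule cong_trans[OF moments cong_add[OF cong_add[OF cong_mult[OF cong_refl gg]
            cong_mult[OF cong_refl gh(1)]] cong_mult[OF cong_refl hh]]])
    have 2: "(b h)\<^sup>2 * (\<Sum>t\<in>#S. bil A B C t t) \<equiv>\<^sub>p (b h)\<^sup>2 * (6 - 2 * (1 + 1 + a h))"
      by (rule cong_mult[OF cong_refl cong_trans[OF sum cong_diff[OF cong_refl
            cong_mult[OF cong_refl cong_add[OF cong_add[OF gg gg] hh]]]]])
    show ?thesis using cong_trans[OF cong_sym[OF 1] 2] unfolding cong_iff_dvd_diff Ch_def by (simp add: algebra_simps power2_eq_square)
  qed
  define c where "c u = a u - 1" for u
  define F where "F h k = c h * (b k)\<^sup>2 + c k * (b h)\<^sup>2 + (c h * b k - c k * b h)\<^sup>2" for h k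
  \<comment> \<open>For {g, h, k} the diagonal values X, Y, Z are unknown. Cramer's rule ties them
    to the three values 1, and \<open>pair_identity\<close> then eliminates the moments. The result
    carries the factor 2 (b h) (b h - b k), which has to be cancelled.\<close>
  have F: "int p dvd F h k" if hk: "h \<in># S" "k \<in># S" "h \<noteq> g" "k \<noteq> g" "\<not> int p dvd b h - b k" for h k
  proof -
    have "h \<noteq> k" using hk by auto
    then have sub: "{#g, h, k#} \<subseteq># S"
      using hk g by (simp add: insert_subset_eq_iff in_diff_count)
    obtain A B C where "\<And>u v. sc (add_mset u (add_mset v (S - {#g, h, k#}))) 0 \<equiv>\<^sub>p bil A B C u v"
      and gh: "bil A B C g h \<equiv>\<^sub>p 1" and gk: "bil A B C g k \<equiv>\<^sub>p 1" and hk1: "bil A B C h k \<equiv>\<^sub>p 1"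
      and sum: "(\<Sum>t\<in>#S. bil A B C t t) \<equiv>\<^sub>p 6 - 2 * (bil A B C g g + bil A B C h h + bil A B C k k)"
      by (rule bilinear_form[OF sub], rule that)
    define X Y Z where "X = bil A B C g g" and "Y = bil A B C h h" and "Z = bil A B C k k"
    define D where "D = b h * a k - a h * b k"
    have D: "det k h \<equiv>\<^sub>p D" unfolding D_def by (rule det_eq)
    have sym: "bil A B C u v = bil A B C v u" for u v by (simp add: bil_def algebra_simps)
    have expand: "b h * bil A B C v k = det k h * bil A B C v g + b k * bil A B C v h" for v
      unfolding b_def by (rule cramer_bil')
    have *: "b h * y \<equiv>\<^sub>p D * x + b k * z"
      if "bil A B C v k \<equiv>\<^sub>p y" "bil A B C v g \<equiv>\<^sub>p x" "bil A B C v h \<equiv>\<^sub>p z" for v x y z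
    proof -
      have "b h * bil A B C v k \<equiv>\<^sub>p b h * y" by (rule cong_mult[OF cong_refl that(1)])
      then show ?thesis
        using cong_add[OF cong_mult[OF D that(2)] cong_mult[OF cong_refl[of "b k"] that(3)]]
        unfolding expand by (rule cong_trans[OF cong_sym])
    qed
    have "b h * 1 \<equiv>\<^sub>p D * X + b k * 1" by (rule *[of g]) (use gh gk in \<open>simp_all add: X_def\<close>)
    then have d1: "int p dvd D * X - (b h - b k)"
      unfolding cong_iff_dvd_diff by (simp add: dvd_diff_commute algebra_simps)
    have "b h * 1 \<equiv>\<^sub>p D * 1 + b k * Y" by (rule *[of h]) (use gh hk1 sym[of h g] in \<open>simp_all add: Y_def\<close>)
    then have d2: "int p dvd b k * Y - (b h - D)"
      unfolding cong_iff_dvd_diff by (simp add: dvd_diff_commute algebra_simps)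
    have "b h * Z \<equiv>\<^sub>p D * 1 + b k * 1"
      by (rule *[of k]) (use gk hk1 sym[of k g] sym[of k h] in \<open>simp_all add: Z_def\<close>)
    then have d3: "int p dvd b h * Z - (D + b k)"
      unfolding cong_iff_dvd_diff by simp
    have 1: "(b h)\<^sup>2 * (\<Sum>t\<in>#S. bil A B C t t) \<equiv>\<^sub>p
      ((b h)\<^sup>2 * Saa - 2 * b h * a h * Sab + (a h)\<^sup>2 * Sbb) * X + 2 * (b h * Sab - a h * Sbb) * 1 + Sbb * Y"
      unfolding X_def Y_def by (rule cong_trans[OF moments cong_add[OF cong_add[OF cong_refl
            cong_mult[OF cong_refl gh]] cong_refl]])
    have 2: "(b h)\<^sup>2 * (\<Sum>t\<in>#S. bil A B C t t) \<equiv>\<^sub>p (b h)\<^sup>2 * (6 - 2 * (X + Y + Z))"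
      unfolding X_def Y_def Z_def by (rule cong_mult[OF cong_refl sum])
    have W: "int p dvd ((b h)\<^sup>2 * Saa - 2 * b h * a h * Sab + (a h)\<^sup>2 * Sbb) * X
        + 2 * (b h * Sab - a h * Sbb) * 1 + Sbb * Y - (b h)\<^sup>2 * (6 - 2 * (X + Y + Z))"
      using cong_trans[OF cong_sym[OF 1] 2] unfolding cong_iff_dvd_diff .
    have "2 * b h * (b h - b k) * F h k = b h * b k * Ch h - (b h)\<^sup>2 * Ch k
      - D * b k * (((b h)\<^sup>2 * Saa - 2 * b h * a h * Sab + (a h)\<^sup>2 * Sbb) * X
        + 2 * (b h * Sab - a h * Sbb) * 1 + Sbb * Y - (b h)\<^sup>2 * (6 - 2 * (X + Y + Z)))
      + (b k * ((b h)\<^sup>2 * Saa - 2 * b h * a h * Sab + (a h)\<^sup>2 * Sbb) + 2 * (b h)\<^sup>2 * b k) * (D * X - (b h - b k))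
      + (D * Sbb + 2 * (b h)\<^sup>2 * D) * (b k * Y - (b h - D)) + 2 * b h * D * b k * (b h * Z - (D + b k))"
      unfolding F_def Ch_def c_def D_def by (rule pair_identity)
    then have "int p dvd 2 * b h * (b h - b k) * F h k"
      using dvd_combination[OF Ch[OF hk(1,3)] Ch[OF hk(2,4)] W d1 d2 d3] by metis
    then show ?thesis using hk(5) not_p_dvd_2 b_nz[OF hk(1,3)] by (simp add: p_dvd_mult_iff)
  qed
  have c_g: "int p dvd c g" using a_g by (simp add: c_def)
  have sum_c: "(\<Sum>t\<in>#S. c t) = (\<Sum>t\<in>#S. a t) - (2 * int p - 1)"
    using size_S ge_5 by (simp add: c_def sum_mset_subtract of_nat_diff)
  define \<psi> where "\<psi> h t = (if int p dvd b t - b h then c h + c t + (c t - c h)\<^sup>2 else 0)" for h t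
  have \<psi>: "int p dvd (\<Sum>t\<in>#S. \<psi> h t) + 2 * c h" if h: "h \<in># S" "h \<noteq> g" for h
  proof -
    have "(\<Sum>t\<in>#S. c h * (b t)\<^sup>2 + (b h * c t - c h * b t)\<^sup>2) \<equiv>\<^sub>p (\<Sum>t\<in>#S. (b h)\<^sup>2 * (\<psi> h t - c t))"
    proof (rule cong_sum_mset)
      fix t assume t: "t \<in># S"
      show "c h * (b t)\<^sup>2 + (b h * c t - c h * b t)\<^sup>2 \<equiv>\<^sub>p (b h)\<^sup>2 * (\<psi> h t - c t)"
      proof (cases "int p dvd b t - b h")
        case True
        have "c h * (b t)\<^sup>2 + (b h * c t - c h * b t)\<^sup>2 - (b h)\<^sup>2 * (c h + c t + (c t - c h)\<^sup>2 - c t)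
          = (b t - b h) * (c h * (b t + b h) + c h * (c h * (b t + b h) - 2 * b h * c t))" 
          by (simp add: algebra_simps power2_eq_square)
        then show ?thesis using True by (simp add: \<psi>_def cong_iff_dvd_diff)
      next
        case False
        show ?thesis
        proof (cases "t = g")
          case True
          have "c h * (b t)\<^sup>2 + (b h * c t - c h * b t)\<^sup>2 - (b h)\<^sup>2 * (0 - c t) = c g * ((b h)\<^sup>2 * (c g + 1))"
            unfolding True b_g by (simp add: algebra_simps power2_eq_square)
          then show ?thesis using c_g False by (simp add: \<psi>_def cong_iff_dvd_diff)
        next
          assume "t \<noteq> g"
          then have "int p dvd F h t" using F[of h t] h t False by (simp add: dvd_diff_commute)
          moreover have "c h * (b t)\<^sup>2 + (b h * c t - c h * b t)\<^sup>2 - (b h)\<^sup>2 * (0 - c t) = F h t"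
            unfolding F_def by (simp add: algebra_simps power2_eq_square)
          ultimately show ?thesis using False by (simp add: \<psi>_def cong_iff_dvd_diff)
        qed
      qed
    qed
    moreover have "(\<Sum>t\<in>#S. (b h)\<^sup>2 * (\<psi> h t - c t)) = (b h)\<^sup>2 * ((\<Sum>t\<in>#S. \<psi> h t) - (\<Sum>t\<in>#S. c t))"
      by (simp add: sum_mset_subtract flip: sum_mset_distrib_left)
    moreover have "(\<Sum>t\<in>#S. c h * (b t)\<^sup>2 + (b h * c t - c h * b t)\<^sup>2)
       = Ch h - (b h)\<^sup>2 - 2 * (b h)\<^sup>2 * c h + (b h)\<^sup>2 * (2 * int p - 2 * (\<Sum>t\<in>#S. a t)) + 2 * b h * c h * (\<Sum>t\<in>#S. b t)"
    proof -
      have "(\<Sum>t\<in>#S. c h * (b t)\<^sup>2 + (b h * c t - c h * b t)\<^sup>2)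
         = c h * Sbb + ((b h)\<^sup>2 * (\<Sum>t\<in>#S. (c t)\<^sup>2) - 2 * b h * c h * (\<Sum>t\<in>#S. c t * b t) + (c h)\<^sup>2 * Sbb)"
        by (simp add: sum_mset.distrib sum_mset_square Sbb_def flip: sum_mset_distrib_left)
      moreover have "(\<Sum>t\<in>#S. (c t)\<^sup>2) = Saa - 2 * (\<Sum>t\<in>#S. a t) + (2 * int p - 1)"
      proof -
        have "(\<Sum>t\<in>#M. (c t)\<^sup>2) = (\<Sum>t\<in>#M. (a t)\<^sup>2) - 2 * (\<Sum>t\<in>#M. a t) + int (size M)" for M
          by (induction M) (auto simp: c_def power2_eq_square algebra_simps)
        then show ?thesis using size_S ge_5 by (simp add: Saa_def of_nat_diff)
      qed
      moreover have "(\<Sum>t\<in>#S. c t * b t) = Sab - (\<Sum>t\<in>#S. b t)"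
        by (simp add: c_def Sab_def left_diff_distrib sum_mset_subtract)
      ultimately show ?thesis
        by (simp only:) (simp add: Ch_def c_def algebra_simps power2_eq_square)
    qed
    ultimately have "int p dvd Ch h - (b h)\<^sup>2 - 2 * (b h)\<^sup>2 * c h + (b h)\<^sup>2 * (2 * int p - 2 * (\<Sum>t\<in>#S. a t))
       + 2 * b h * c h * (\<Sum>t\<in>#S. b t) - (b h)\<^sup>2 * ((\<Sum>t\<in>#S. \<psi> h t) - ((\<Sum>t\<in>#S. a t) - (2 * int p - 1)))"
      by (simp add: cong_iff_dvd_diff sum_c)
    moreover have "(b h)\<^sup>2 * ((\<Sum>t\<in>#S. \<psi> h t) + 2 * c h) = 1 * Ch h - 0 * 0 - 0 * 0
       + (- (b h)\<^sup>2) * (\<Sum>t\<in>#S. a t) + 2 * b h * c h * (\<Sum>t\<in>#S. b t)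
       + (- 1) * (Ch h - (b h)\<^sup>2 - 2 * (b h)\<^sup>2 * c h + (b h)\<^sup>2 * (2 * int p - 2 * (\<Sum>t\<in>#S. a t))
       + 2 * b h * c h * (\<Sum>t\<in>#S. b t) - (b h)\<^sup>2 * ((\<Sum>t\<in>#S. \<psi> h t) - ((\<Sum>t\<in>#S. a t) - (2 * int p - 1))))"
      by (simp add: algebra_simps)
    ultimately have "int p dvd (b h)\<^sup>2 * ((\<Sum>t\<in>#S. \<psi> h t) + 2 * c h)"
      using dvd_combination[OF Ch[OF h] dvd_0_right dvd_0_right sum_a sum_b] by metis
    then show ?thesis using b_nz[OF h] by (simp add: p_dvd_mult_iff power2_eq_square)
  qed
  have c_neq: "\<not> int p dvd c h - c k" if "h \<in># S" "k \<in># S" "h \<noteq> k" "int p dvd b h - b k" for h k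
  proof
    assume "int p dvd c h - c k"
    moreover have "b k * a h - a k * b h = (b k - b h) * a h + b h * (c h - c k)"
      by (simp add: c_def algebra_simps)
    ultimately have "int p dvd b k * a h - a k * b h"
      using that(4) dvd_diff_commute[of "int p" "b h"] by simp
    then have "int p dvd det h k" using cong_dvd_iff[OF det_eq[of h k]] by simp
    then show False using independent[OF that(1,2)] that(3) by simp
  qed
  \<comment> \<open>The sum of \<open>\<psi>\<close> is now 2 (count S h) (c h), so 2 (count S h +
    1) (c h) vanishes, while count S h + 1 < p.\<close>
  have c_single: "int p dvd c h" if h: "h \<in># S" "h \<noteq> g" and single: "\<And>t. t \<in># S \<Longrightarrow> int p dvd b t - b h \<Longrightarrow> t = h" for h
  proof -
    have "(\<Sum>t\<in>#S. \<psi> h t) = (\<Sum>t\<in>#S. if t = h then 2 * c h else 0)"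
      using single by (intro arg_cong[of _ _ sum_mset] image_mset_cong) (auto simp: \<psi>_def)
    then have "int p dvd 2 * (int (count S h + 1) * c h)"
      using \<psi>[OF h] by (simp add: sum_mset_if_eq algebra_simps)
    moreover have "\<not> p dvd count S h + 1" using count_le[OF h(1)] by (auto dest!: dvd_imp_le)
    ultimately show ?thesis using not_p_dvd_2 by (simp only: p_dvd_mult_iff int_dvd_int_iff) simp
  qed
  \<comment> \<open>Since b h = b h', the difference of the relations for (h, k) and (h', k) has the
    factor b k (c h - c h'), which is invertible.\<close>
  have c_pair: "int p dvd (1 + c h + c h') * b k - 2 * c k * b h"
    if hk: "h \<in># S" "h' \<in># S" "k \<in># S" "h \<noteq> g" "h' \<noteq> g" "k \<noteq> g" "h \<noteq> h'" "int p dvd b h - b h'"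
      "\<not> int p dvd b h - b k" for h h' k
  proof -
    have "\<not> int p dvd b h' - b k" using hk(8,9) dvd_add[of "int p" "b h - b h'" "b h' - b k"] by auto
    then have "int p dvd F h k" "int p dvd F h' k" using F[of h k] F[of h' k] hk by simp_all
    moreover have "b k * (c h - c h') * ((1 + c h + c h') * b k - 2 * c k * b h)
      = F h k - F h' k - (c k * (b h + b h') - 2 * c h' * c k * b k + (c k)\<^sup>2 * (b h + b h')) * (b h - b h')"
      unfolding F_def by (simp add: algebra_simps power2_eq_square)
    ultimately have "int p dvd b k * (c h - c h') * ((1 + c h + c h') * b k - 2 * c k * b h)"
      using hk(8) by simp
    then show ?thesis using b_nz[of k] c_neq[of h h'] hk by (simp add: p_dvd_mult_iff)
  qed
  \<comment> \<open>The sum of \<open>a\<close> vanishes and \<open>S\<close> has 2p - 1 elements,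
    so the sum of c is -(2p - 1).\<close>
  have sum_c_1: "(\<Sum>t\<in>#S. c t) \<equiv>\<^sub>p 1"
    using sum_a by (simp add: sum_c cong_iff_dvd_diff)
  obtain h0 where h0: "h0 \<in># S" "h0 \<noteq> g"
  proof -
    have "count S g \<noteq> size S" using size_S count_le[OF g] by simp
    then show ?thesis using that count_eq_size[of S g] by blast
  qed
  \<comment> \<open>If b took only one value away from g, p would divide the number of elements
    different from g, which lies strictly between p and 2p.\<close>
  have ex_other: "\<exists>k. k \<in># S \<and> k \<noteq> g \<and> \<not> int p dvd b h - b k" if h: "h \<in># S" "h \<noteq> g" for h
  proof (rule ccontr)
    assume "\<not> ?thesis"
    then have "int p dvd b h - b t" if "t \<in># S" "t \<noteq> g" for t using that by blast
    then have "b t \<equiv>\<^sub>p (if t = g then 0 else b h)" if "t \<in># S" for t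
      using that b_g by (cases "t = g") (simp_all add: cong_iff_dvd_diff dvd_diff_commute[of _ "b t"])
    then have "(\<Sum>t\<in>#S. b t) \<equiv>\<^sub>p (\<Sum>t\<in>#S. if t = g then 0 else b h)"
      by (rule cong_sum_mset)
    then have "int p dvd (int (size S) - int (count S g)) * b h"
      using sum_b by (simp add: sum_mset_if_eq cong_dvd_iff)
    then have "int p dvd int (size S) - int (count S g)" using b_nz[OF h] by (simp add: p_dvd_mult_iff)
    then have "p dvd size S - count S g" using count_le_size[of S g] by (simp flip: of_nat_diff)
    moreover have "size S - count S g = p + (p - 1 - count S g)" using size_S count_le[OF g] by simp
    ultimately have "p dvd p - 1 - count S g" by simp
    then show False using count_le[OF g] by (auto dest!: dvd_imp_le)
  qed
  show False
  proof (cases "\<exists>h h'. h \<in># S \<and> h' \<in># S \<and> h \<noteq> g \<and> h' \<noteq> g \<and> h \<noteq> h' \<and> int p dvd b h - b h'")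
    case False
    have "int p dvd c t" if "t \<in># S" for t
      proof (cases "t = g")
        case True then show ?thesis using c_g by simp
      next
        case tg: False
        show ?thesis
        proof (rule c_single[OF that tg], rule ccontr)
          fix s assume s: "s \<in># S" "int p dvd b s - b t" "s \<noteq> t"
          then have "s \<noteq> g" using b_nz[OF that tg] b_g by auto
          then show False using False s that tg by blast
        qed
      qed
    then have "int p dvd (\<Sum>t\<in>#S. c t)" by (intro dvd_sum_mset)
    then have "int p dvd 1" using cong_dvd_iff[OF sum_c_1] by simp
    then show False using ge_5 by simp
  next
    case True
    then obtain h h' where hh: "h \<in># S" "h' \<in># S" "h \<noteq> g" "h' \<noteq> g" "h \<noteq> h'" "int p dvd b h - b h'" by blast
    obtain k where k: "k \<in># S" "k \<noteq> g" "\<not> int p dvd b h - b k" using ex_other hh by blast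
    \<comment> \<open>For fixed h and k, \<open>c_pair\<close> determines the c of the partner; a
      third element with this b would agree with h' in both coordinates.\<close>
    have only: "t = h \<or> t = h'" if t: "t \<in># S" "int p dvd b h - b t" for t
    proof (rule ccontr)
      assume neq: "\<not> ?thesis"
      have "t \<noteq> g" using t hh(1,3) b_nz[of h] b_g by auto
      then have "int p dvd (1 + c h + c h') * b k - 2 * c k * b h" "int p dvd (1 + c h + c t) * b k - 2 * c k * b h"
        using c_pair[of h h' k] c_pair[of h t k] hh k t neq by auto
      then have "int p dvd ((1 + c h + c h') * b k - 2 * c k * b h) - ((1 + c h + c t) * b k - 2 * c k * b h)"
        by (rule dvd_diff)
      then have "int p dvd (c h' - c t) * b k" by (simp add: algebra_simps)
      moreover have "int p dvd b h' - b t" using dvd_diff[OF t(2) hh(6)] by simp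
      ultimately show False using c_neq[of h' t] b_nz[of k] hh k t neq by (auto simp: p_dvd_mult_iff)
    qed
    have others: "int p dvd c t" if t: "t \<in># S" "t \<noteq> h" "t \<noteq> h'" for t
    proof (cases "t = g")
      case True then show ?thesis using c_g by simp
    next
      case False
      have ht: "\<not> int p dvd b h - b t" using only t by blast
      show ?thesis
      proof (rule c_single[OF t(1) False], rule ccontr)
        fix s assume s: "s \<in># S" "int p dvd b s - b t" "s \<noteq> t"
        have "\<not> int p dvd b h - b s" using ht s(2) dvd_add[of "int p" "b h - b s" "b s - b t"] by auto
        moreover have "s \<noteq> g" using s b_nz[OF t(1) False] b_g by auto
        ultimately have "int p dvd (1 + c h + c h') * b t - 2 * c t * b h" "int p dvd (1 + c h + c h') * b s - 2 * c s * b h"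
          using c_pair[of h h' t] c_pair[of h h' s] hh t s ht False by auto
        moreover have "2 * (b h * (c s - c t)) = ((1 + c h + c h') * b t - 2 * c t * b h)
          - ((1 + c h + c h') * b s - 2 * c s * b h) + (1 + c h + c h') * (b s - b t)"
          by (simp add: algebra_simps)
        ultimately have "int p dvd 2 * (b h * (c s - c t))" using s(2) by simp
        then show False using not_p_dvd_2 b_nz[of h] c_neq[of s t] hh s t by (auto simp: p_dvd_mult_iff)
      qed
    qed
    have kh: "k \<noteq> h" "k \<noteq> h'" using k hh by auto
    then have ck: "int p dvd c k" using others k by blast
    have "int p dvd (1 + c h + c h') * b k - 2 * c k * b h" using c_pair[of h h' k] hh k by auto
    then have "int p dvd (1 + c h + c h') * b k - 2 * c k * b h + 2 * c k * b h" using ck by (intro dvd_add) auto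
    then have sum1: "int p dvd 1 + c h + c h'" using b_nz[of k] k by (simp add: p_dvd_mult_iff)
    have "int p dvd F h k" using F[of h k] hh k by simp
    then have "int p dvd F h k + (- (b h)\<^sup>2 - c k * (b h)\<^sup>2 + 2 * b h * b k * c h) * c k" using ck by (intro dvd_add) auto
    moreover have "F h k + (- (b h)\<^sup>2 - c k * (b h)\<^sup>2 + 2 * b h * b k * c h) * c k = b k * (b k * (c h * (1 + c h)))"
      unfolding F_def by (simp add: algebra_simps power2_eq_square)
    ultimately have disj: "int p dvd c h \<or> int p dvd 1 + c h" using b_nz[of k] k by (simp add: p_dvd_mult_iff)
    \<comment> \<open>Here c is -1 on u and 0 elsewhere, so - count S u would be 1 modulo p,
      although count S u + 1 < p.\<close>
    have two: False if uv: "u \<in># S" "v \<in># S" "{u, v} = {h, h'}" "int p dvd 1 + c u" "int p dvd c v" for u v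
    proof -
      have eq: "(\<Sum>t\<in>#S. c t) \<equiv>\<^sub>p (\<Sum>t\<in>#S. if t = u then - 1 else 0)"
        using others uv by (intro cong_sum_mset) (auto simp: cong_iff_dvd_diff add.commute)
      have "int p dvd 1 - (- int (count S u))"
        using cong_trans[OF cong_sym[OF sum_c_1] eq] by (simp add: sum_mset_if_eq cong_iff_dvd_diff)
      then have "p dvd 1 + count S u" by (simp flip: int_dvd_int_iff)
      then show False using count_le[OF uv(1)] by (auto dest!: dvd_imp_le)
    qed
    from disj show False
    proof
      assume "int p dvd c h"
      moreover from dvd_diff[OF sum1 this] have "int p dvd 1 + c h'" by simp
      ultimately show False using two[of h' h] hh by auto
    next
      assume "int p dvd 1 + c h"
      moreover from dvd_diff[OF sum1 this] have "int p dvd c h'" by simp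
      ultimately show False using two[of h h'] hh by auto
    qed
  qed
qed

end

end

section \<open>Minimal zero-sum multisets with a large multiplicity\<close>

lemma sum_det: "det e (\<Sum>\<^sub># B) = (\<Sum>x\<in>#B. det e x)"
  by (induction B) (auto simp: det_def algebra_simps)

lemma ex_submset_size:
  assumes "n \<le> size F" shows "\<exists>B. B \<subseteq># F \<and> size B = n"
proof -
  obtain xs where xs: "mset xs = F" by (metis ex_mset)
  have "mset (take n xs) \<subseteq># F"
    unfolding xs[symmetric] by (metis append_take_drop_id mset_append mset_subset_eq_add_left)
  moreover have "size (mset (take n xs)) = n" using assms xs by auto
  ultimately show ?thesis by blast
qed

text \<open>If f x and f y differed modulo m, the residues f x, f y and the m - 1 partial sums
  starting with f x + f y would be pairwise different: a difference of two of them is the sum of a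
  nonempty proper submultiset, up to sign. That is m + 1 residues modulo m.\<close>

lemma cyclic_constant:
  fixes f :: "'b \<Rightarrow> int"
  assumes size: "size F = m" and xy: "{#x, y#} \<subseteq># F"
    and nz: "\<And>B. B \<subset># F \<Longrightarrow> B \<noteq> {#} \<Longrightarrow> \<not> int m dvd (\<Sum>z\<in>#B. f z)"
  shows "int m dvd f x - f y"
proof (rule ccontr)
  assume neq: "\<not> int m dvd f x - f y"
  obtain R where F: "F = add_mset x (add_mset y R)" using xy by (auto simp: mset_subset_eq_exists_conv)
  obtain zs where zs: "mset zs = R" by (metis ex_mset)
  have len: "length zs + 2 = m" using size F zs by auto
  define s where "s j = (\<Sum>z\<leftarrow>take j zs. f z)" for j
  define g where "g j = f x + f y + s j" for j
  have s_diff: "\<exists>B. B \<subseteq># R \<and> s j - s i = (\<Sum>z\<in>#B. f z) \<and> size B = j - i" if "i \<le> j" "j \<le> length zs" for i j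
  proof (intro exI conjI)
    have take: "take j zs = take i zs @ take (j - i) (drop i zs)"
      using that by (metis le_add_diff_inverse take_add)
    show "s j - s i = (\<Sum>z\<in>#mset (take (j - i) (drop i zs)). f z)"
      unfolding s_def take by (simp add: sum_mset_sum_list flip: mset_map)
    show "mset (take (j - i) (drop i zs)) \<subseteq># R"
      unfolding zs[symmetric] by (metis append_take_drop_id mset_append mset_subset_eq_add_left mset_subset_eq_add_right subset_mset.order_trans)
    show "size (mset (take (j - i) (drop i zs))) = j - i" using that by simp
  qed
  have nz': "\<not> int m dvd (\<Sum>z\<in>#B. f z)" if "B \<subseteq># F" "B \<noteq> {#}" "size B < m" for B
    using that nz[of B] size by (auto simp: subset_mset.less_le)
  have g_g: "\<not> int m dvd g j - g i" if ij: "i < j" "j \<le> length zs" for i j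
  proof -
    obtain B where B: "B \<subseteq># R" "s j - s i = (\<Sum>z\<in>#B. f z)" "size B = j - i" using s_diff[OF less_imp_le[OF ij(1)] ij(2)] by blast
    have "B \<subseteq># F" using B(1) F by (metis subset_add_mset_self subset_mset.order_trans)
    moreover have "B \<noteq> {#}" "size B < m" using B(3) ij len by auto
    ultimately show ?thesis using nz'[of B] B(2) by (simp add: g_def)
  qed
  have g_xy: "\<not> int m dvd g j - f x" "\<not> int m dvd g j - f y" if j: "j \<le> length zs" for j
  proof -
    obtain B where B: "B \<subseteq># R" "s j - s 0 = (\<Sum>z\<in>#B. f z)" "size B = j" using s_diff[OF le0 j] by auto
    have s: "s j = (\<Sum>z\<in>#B. f z)" using B by (simp add: s_def)
    have "add_mset y B \<subseteq># F" "add_mset x B \<subseteq># F"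
      using B(1) F subset_add_mset_self[of "add_mset y B" x] subset_add_mset_self[of "add_mset x B" y]
      by (auto simp: add_mset_commute intro: subset_mset.order_trans)
    then show "\<not> int m dvd g j - f x" "\<not> int m dvd g j - f y"
      using nz'[of "add_mset y B"] nz'[of "add_mset x B"] B s j len by (simp_all add: g_def algebra_simps)
  qed
  have m0: "m > 0" using len by simp
  define V where "V = insert (f x mod int m) (insert (f y mod int m) ((\<lambda>j. g j mod int m) ` {..length zs}))"
  have inj: "inj_on (\<lambda>j. g j mod int m) {..length zs}"
  proof (rule linorder_inj_onI)
    fix i j assume "i < j" "i \<in> {..length zs}" "j \<in> {..length zs}"
    then show "g i mod int m \<noteq> g j mod int m" using g_g[of i j] by (auto simp: mod_eq_dvd_iff dvd_diff_commute)
  qed auto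
  have "card ((\<lambda>j. g j mod int m) ` {..length zs}) = m - 1" using card_image[OF inj] len by simp
  moreover have "f x mod int m \<noteq> f y mod int m" using neq by (simp add: mod_eq_dvd_iff)
  moreover have "f x mod int m \<notin> (\<lambda>j. g j mod int m) ` {..length zs}" "f y mod int m \<notin> (\<lambda>j. g j mod int m) ` {..length zs}"
    using g_xy by (auto simp: mod_eq_dvd_iff dvd_diff_commute[of _ "f x"] dvd_diff_commute[of _ "f y"])
  ultimately have "card V = m + 1" using m0 by (simp add: V_def)
  moreover have "V \<subseteq> {0..<int m}" using m0 by (auto simp: V_def)
  then have "card V \<le> m" using card_mono[of "{0..<int m}" V] by simp
  ultimately show False by simp
qed

lemma bezout3:
  assumes "coprime (gcd a b) (int m)"
  obtains x y where "[x * a + y * b = 1] (mod int m)"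
proof -
  obtain u v where uv: "u * a + v * b = gcd a b" using bezout_int by blast
  obtain w where "[gcd a b * w = 1] (mod int m)" using cong_solve_coprime_int[OF assms] by blast
  then show ?thesis using that[of "w * u" "w * v"] uv[symmetric] by (simp add: algebra_simps)
qed

text \<open>Modulo the subgroup generated by e, measured by \<open>det e\<close>, no nonempty proper
  part of \<open>F\<close> has sum zero, because copies of e would complete it to a zero-sum.
  \<open>F\<close> has m elements, so it is constant in the cyclic quotient by
  \<open>cyclic_constant\<close>, and its value there generates.\<close>

lemma mzs_core:
  assumes mzs: "mzs m W" and size: "size W = 2 * m - 1" and m: "m \<ge> 2"
    and W: "W = replicate_mset (m - 1) e + F"
  shows mzs_core_cong: "x \<in># F \<Longrightarrow> y \<in># F \<Longrightarrow> \<exists>k. null_mod m (x - y - (k * fst e, k * snd e))"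
    and mzs_core_indep: "x \<in># F \<Longrightarrow> null_mod m ((k * fst x, k * snd x) - (j * fst e, j * snd e)) \<Longrightarrow> int m dvd k"
proof -
  have F: "size F = m" using size m by (simp add: W)
  \<comment> \<open>A common divisor d > 1 with m would make m/d copies of e a zero-sum.\<close>
  have "coprime (gcd (fst e) (snd e)) (int m)"
  proof (rule ccontr)
    define d where "d = gcd (gcd (fst e) (snd e)) (int m)"
    assume "\<not> ?thesis"
    then have d1: "d \<noteq> 1" "d dvd int m" "d dvd fst e" "d dvd snd e"
      unfolding d_def coprime_iff_gcd_eq_1 by (blast intro: dvd_trans)+
    have d0: "d > 0" using m by (simp add: d_def)
    then have d: "d > 1" using d1 by simp
    obtain r where r: "int m = d * r" using d1 by auto
    have rpos: "r > 0" using r m d0 by (metis less_le_trans of_nat_0_less_iff pos2 zero_less_mult_pos)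
    have rm: "r < int m" using r rpos d by simp
    define B where "B = replicate_mset (nat r) e"
    have "null_mod m (\<Sum>\<^sub># B)"
      using d1 rpos by (auto simp: B_def sum_replicate_mset_pair null_mod_def r mult.commute)
    moreover have "B \<subset># W"
    proof -
      have "B \<subseteq># replicate_mset (m - 1) e" using rm rpos unfolding B_def count_le_replicate_mset_subset_eq[symmetric] by simp
      then have "B \<subseteq># W" unfolding W by (meson mset_subset_eq_add_left subset_mset.order_trans)
      moreover have "size B < size W" using size rm rpos m by (simp add: B_def)
      ultimately show ?thesis by (metis less_irrefl subset_mset.less_le)
    qed
    moreover have "B \<noteq> {#}" using rpos by (simp add: B_def)
    ultimately show False using mzs by (auto simp: mzs_def)
  qed
  then obtain \<alpha> \<beta> where \<alpha>\<beta>: "[\<alpha> * fst e + \<beta> * snd e = 1] (mod int m)" using bezout3 by blast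
  have kernel: "\<exists>k. null_mod m (v - (k * fst e, k * snd e))" if "int m dvd det e v" for v
  proof
    define k where "k = \<alpha> * fst v + \<beta> * snd v"
    have 1: "int m dvd \<alpha> * fst e + \<beta> * snd e - 1" using \<alpha>\<beta> by (simp add: cong_iff_dvd_diff)
    have "fst v - k * fst e = - fst v * (\<alpha> * fst e + \<beta> * snd e - 1) - \<beta> * det e v"
      "snd v - k * snd e = - snd v * (\<alpha> * fst e + \<beta> * snd e - 1) + \<alpha> * det e v"
      unfolding k_def det_def by (simp_all add: algebra_simps)
    then show "null_mod m (v - (k * fst e, k * snd e))"
      using 1 that by (simp add: null_mod_def)
  qed
  have nz: "\<not> int m dvd (\<Sum>z\<in>#B. det e z)" if B: "B \<subset># F" "B \<noteq> {#}" for B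
  proof
    assume "int m dvd (\<Sum>z\<in>#B. det e z)"
    then obtain k where k: "null_mod m (\<Sum>\<^sub># B - (k * fst e, k * snd e))"
      using kernel[of "\<Sum>\<^sub># B"] by (auto simp: sum_det)
    \<comment> \<open>The sum of B is k e; r copies of e cancel it, and r <= m - 1 copies are
      available.\<close>
    define r where "r = nat ((- k) mod int m)"
    have r: "int r = (- k) mod int m" "r \<le> m - 1" using m
      by (auto simp: r_def nat_le_iff of_nat_diff)
    have "int m dvd k + int r" unfolding r(1) by (simp add: mod_0_imp_dvd mod_add_right_eq)
    then obtain q where q: "k + int r = int m * q" by blast
    have eq: "\<Sum>\<^sub># (B + replicate_mset r e) = (\<Sum>\<^sub># B - (k * fst e, k * snd e)) + ((k + int r) * fst e, (k + int r) * snd e)"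
      by (simp add: sum_replicate_mset_pair prod_eq_iff algebra_simps)
    have "null_mod m ((k + int r) * fst e, (k + int r) * snd e)"
      unfolding q by (simp add: null_mod_def mult.assoc)
    from null_mod_add[OF k this] have "null_mod m (\<Sum>\<^sub># (B + replicate_mset r e))"
      unfolding eq .
    moreover have "B + replicate_mset r e \<subset># W"
    proof -
      have "replicate_mset r e \<subseteq># replicate_mset (m - 1) e" using r(2) by (simp flip: count_le_replicate_mset_subset_eq)
      then show ?thesis unfolding W add.commute[of _ F] using B(1) by (rule subset_mset.add_less_le_mono[rotated])
    qed
    ultimately show False using mzs B(2) by (auto simp: mzs_def)
  qed
  have const: "int m dvd det e x - det e y" if "x \<in># F" "y \<in># F" for x y
  proof (cases "x = y")
    case False
    then have "{#x, y#} \<subseteq># F" using that by (simp add: insert_subset_eq_iff in_diff_count)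
    from cyclic_constant[OF F this nz] show ?thesis .
  qed simp
  show "\<exists>k. null_mod m (x - y - (k * fst e, k * snd e))" if "x \<in># F" "y \<in># F" for x y
    using kernel[of "x - y"] const[OF that] by (simp add: det_def algebra_simps)
  show "int m dvd k" if x: "x \<in># F" and null: "null_mod m ((k * fst x, k * snd x) - (j * fst e, j * snd e))" for x k j
  proof (rule ccontr)
    assume "\<not> int m dvd k"
    define r where "r = nat (k mod int m)"
    have r: "int r = k mod int m" "0 < r" "r < m" using \<open>\<not> int m dvd k\<close> m
      by (auto simp: r_def dvd_eq_mod_eq_0 nat_less_iff zero_less_nat_eq order.not_eq_order_implies_strict)
    obtain B where B: "B \<subseteq># F" "size B = r" using ex_submset_size[of r F] r(3) F by auto
    have "[(\<Sum>z\<in>#B. det e z) = (\<Sum>z\<in>#B. det e x)] (mod int m)"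
      using const[OF _ x] B(1) by (intro cong_sum_mset) (auto simp: cong_iff_dvd_diff dest: mset_subset_eqD)
    moreover have "(\<Sum>z\<in>#B. det e x) = int r * det e x" using B(2) by (simp add: sum_mset_constant)
    moreover have "int m dvd int r * det e x"
    proof -
      have "det e ((k * fst x, k * snd x) - (j * fst e, j * snd e)) = k * det e x"
        by (simp add: det_def algebra_simps)
      moreover have "int m dvd det e ((k * fst x, k * snd x) - (j * fst e, j * snd e))"
        using null by (simp add: det_def null_mod_def)
      ultimately have "int m dvd k * det e x" by simp
      then show ?thesis unfolding r(1) by (metis dvd_eq_mod_eq_0 mod_mult_left_eq)
    qed
    ultimately have "int m dvd (\<Sum>z\<in>#B. det e z)" using cong_dvd_iff by metis
    moreover have "B \<subset># F" "B \<noteq> {#}" using B r F by (auto simp: subset_mset.less_le)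
    ultimately show False using nz by blast
  qed
qed

section \<open>Doubling the modulus\<close>

definition min_zero_sum :: "'a::ab_group_add multiset \<Rightarrow> bool" where
  "min_zero_sum M \<longleftrightarrow> \<Sum>\<^sub># M = 0 \<and> (\<forall>B. B \<subset># M \<longrightarrow> B \<noteq> {#} \<longrightarrow> \<Sum>\<^sub># B \<noteq> 0)"

abbreviation nmul :: "nat \<Rightarrow> 'a::ab_group_add \<Rightarrow> 'a" where
  "nmul k x \<equiv> \<Sum>\<^sub># (replicate_mset k x)"

definition cyc :: "'a::ab_group_add \<Rightarrow> 'a set" where
  "cyc e = {nmul j e - nmul k e | j k. True}"

lemma nmul_add: "nmul (j + k) x = nmul j x + nmul k x"
  by (simp add: replicate_mset_plus)

lemma nmul_plus: "nmul k (x + y) = nmul k x + nmul k y"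
  by (induction k) auto

lemma nmul_mult: "nmul (j * k) x = nmul j (nmul k x)"
  by (induction j) (auto simp: nmul_add)

lemma cyc_0 [simp]: "0 \<in> cyc e" unfolding cyc_def by (auto intro: exI[of _ 0])

lemma cyc_nmul [simp]: "nmul k e \<in> cyc e"
  unfolding cyc_def by (rule CollectI, intro exI[of _ k] exI[of _ 0]) simp

lemma cyc_self [simp]: "e \<in> cyc e" using cyc_nmul[of 1 e] by simp

lemma cyc_add: assumes "x \<in> cyc e" "y \<in> cyc e" shows "x + y \<in> cyc e"
proof -
  obtain i j k l where "x = nmul i e - nmul j e" "y = nmul k e - nmul l e" using assms by (auto simp: cyc_def)
  then have "x + y = nmul (i + k) e - nmul (j + l) e" by (simp add: nmul_add)
  then show ?thesis by (auto simp: cyc_def)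
qed

lemma cyc_minus: "x \<in> cyc e \<Longrightarrow> - x \<in> cyc e"
  by (auto simp: cyc_def) (metis minus_diff_eq)

lemma cyc_diff: "x \<in> cyc e \<Longrightarrow> y \<in> cyc e \<Longrightarrow> x - y \<in> cyc e"
  using cyc_add[OF _ cyc_minus] by fastforce

lemma subset_image_mset_exists:
  "B \<subseteq># image_mset f M \<Longrightarrow> \<exists>N. N \<subseteq># M \<and> image_mset f N = B"
proof (induction M arbitrary: B)
  case empty then show ?case by simp
next
  case (add x M)
  show ?case
  proof (cases "f x \<in># B")
    case True
    then obtain B' where B: "B = add_mset (f x) B'" by (meson mset_add)
    then obtain N where "N \<subseteq># M" "image_mset f N = B'" using add by auto
    then show ?thesis using B by (intro exI[of _ "add_mset x N"]) auto
  next
    case False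
    have "B \<subseteq># image_mset f M"
      unfolding subseteq_mset_def
    proof
      fix a
      show "count B a \<le> count (image_mset f M) a"
        using mset_subset_eq_count[OF add.prems, of a] False by (cases "a = f x") (auto simp: not_in_iff)
    qed
    then obtain N where N: "N \<subseteq># M" "image_mset f N = B" using add.IH by blast
    then show ?thesis using subset_mset.order_trans[OF N(1) subset_add_mset_self[of M x]] by blast
  qed
qed

text \<open>A proper subfamily of blocks with sum zero unites to a submultiset with sum zero;
  nonempty blocks keep this union nonempty and proper.\<close>

lemma min_zero_sum_blocks:
  assumes "min_zero_sum (\<Sum>\<^sub># \<B>)" "{#} \<notin># \<B>"
  shows "min_zero_sum (image_mset sum_mset \<B>)"
proof -
  have sum: "\<Sum>\<^sub># (image_mset sum_mset \<C>) = \<Sum>\<^sub># (\<Sum>\<^sub># \<C>)" for \<C> :: "'a multiset multiset"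
    by (induction \<C>) auto
  show ?thesis
    unfolding min_zero_sum_def
  proof (intro conjI allI impI)
    show "\<Sum>\<^sub># (image_mset sum_mset \<B>) = 0" using assms(1) by (simp add: sum min_zero_sum_def)
    fix V assume V: "V \<subset># image_mset sum_mset \<B>" "V \<noteq> {#}"
    then obtain \<C> where \<C>: "\<C> \<subseteq># \<B>" "image_mset sum_mset \<C> = V"
      using subset_image_mset_exists subset_mset.less_imp_le by metis
    then obtain \<D> where \<D>: "\<B> = \<C> + \<D>" by (auto simp: mset_subset_eq_exists_conv)
    have ne: "\<C> \<noteq> {#}" "\<D> \<noteq> {#}" using V \<C> \<D> by auto
    then obtain C D where "C \<in># \<C>" "D \<in># \<D>" by (meson multiset_nonemptyE)
    then have "\<Sum>\<^sub># \<C> \<noteq> {#}" "\<Sum>\<^sub># \<D> \<noteq> {#}" using assms(2) \<D> by (auto dest!: multi_member_split)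
    then have "\<Sum>\<^sub># \<C> \<subset># \<Sum>\<^sub># \<B>" "\<Sum>\<^sub># \<C> \<noteq> {#}" unfolding \<D> by (auto simp: subset_mset.less_le)
    then have "\<Sum>\<^sub># (\<Sum>\<^sub># \<C>) \<noteq> 0" using assms(1) by (simp add: min_zero_sum_def)
    then show "\<Sum>\<^sub># V \<noteq> 0" by (simp add: sum flip: \<C>(2))
  qed
qed

lemma min_zero_sum_subset:
  "min_zero_sum M \<Longrightarrow> B \<subseteq># M \<Longrightarrow> B \<noteq> {#} \<Longrightarrow> size B < size M \<Longrightarrow> \<Sum>\<^sub># B \<noteq> 0"
  unfolding min_zero_sum_def by (metis less_irrefl subset_mset.less_le)

text \<open>The form of every minimal zero-sum multiset of size \<open>2 m - 1\<close> over \<open>\<int>\<^sub>m\<^sup>2\<close>, if \<open>m\<close> has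
  the inverse property.\<close>

definition core :: "nat \<Rightarrow> 'a::ab_group_add multiset \<Rightarrow> 'a \<Rightarrow> 'a multiset \<Rightarrow> bool" where
  "core m W e F \<longleftrightarrow> W = replicate_mset (m - 1) e + F \<and> size F = m \<and> min_zero_sum W \<and>
     (\<forall>x\<in>#W. nmul m x = 0) \<and>
     (\<forall>x\<in>#F. \<forall>y\<in>#F. x - y \<in> cyc e) \<and> (\<forall>x\<in>#F. \<forall>k. nmul k x \<in> cyc e \<longrightarrow> m dvd k)"

text \<open>The symmetric form in which e and f both have multiplicity m - 1 and neither is
  distinguished.\<close>

definition double_core :: "nat \<Rightarrow> 'a::ab_group_add multiset \<Rightarrow> bool" where
  "double_core m W \<longleftrightarrow> (\<exists>e f. W = replicate_mset (m - 1) e + replicate_mset (m - 1) f + {#e + f#})"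

text \<open>The group of modulus 2m is a type, so that sums are taken in it directly. Modulus m
  enters only through the bound \<open>davenport\<close> and the structure statement
  \<open>large_multiplicity\<close>.\<close>

locale double_modulus =
  fixes \<phi> :: "int \<times> int \<Rightarrow> 'a::ab_group_add" and m :: nat
  assumes m_ge_2: "m \<ge> 2"
    and \<phi>_add: "\<phi> (u + v) = \<phi> u + \<phi> v"
    and \<phi>_eq_0: "\<phi> v = 0 \<longleftrightarrow> null_mod (2 * m) v"
    and \<phi>_surj: "\<exists>v. \<phi> v = x"
    and davenport: "zsf m M \<Longrightarrow> size M \<le> 2 * m - 2"
    and large_multiplicity: "mzs m W \<Longrightarrow> size W = 2 * m - 1 \<Longrightarrow> reduced m W \<Longrightarrow> \<exists>e\<in>#W. count W e \<ge> m - 1"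
begin

definition H :: "'a set" where "H = range (\<lambda>x. x + x)"

text \<open>Doubling identifies the pairs modulo m with \<open>H\<close>; \<open>half\<close>
  chooses a preimage, by which results for modulus m are transported.\<close>

definition half :: "'a \<Rightarrow> int \<times> int" where "half h = (SOME v. \<phi> (v + v) = h)"

lemma \<phi>_0 [simp]: "\<phi> 0 = 0" by (simp add: \<phi>_eq_0)

lemma \<phi>_minus: "\<phi> (- v) = - \<phi> v"
  using \<phi>_add[of v "- v"] by (simp add: eq_neg_iff_add_eq_0 add.commute)

lemma \<phi>_diff: "\<phi> (u - v) = \<phi> u - \<phi> v"
  using \<phi>_add[of u "- v"] by (simp add: \<phi>_minus)

lemma \<phi>_half: assumes "h \<in> H" shows "\<phi> (half h + half h) = h"
proof -
  obtain x where "h = x + x" using assms by (auto simp: H_def)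
  moreover obtain v where "\<phi> v = x" using \<phi>_surj by blast
  ultimately have "\<phi> (v + v) = h" by (simp add: \<phi>_add)
  then show ?thesis unfolding half_def by (rule someI)
qed

lemma \<phi>_double_eq_0: "\<phi> (v + v) = 0 \<longleftrightarrow> null_mod m v"
  by (simp add: \<phi>_eq_0 null_mod_def flip: mult_2)

lemma \<phi>_sum_half: "set_mset V \<subseteq> H \<Longrightarrow> \<phi> (\<Sum>\<^sub># (image_mset half V) + \<Sum>\<^sub># (image_mset half V)) = \<Sum>\<^sub># V"
proof (induction V)
  case (add x V)
  have "\<phi> (\<Sum>\<^sub># (image_mset half (add_mset x V)) + \<Sum>\<^sub># (image_mset half (add_mset x V)))
     = \<phi> (half x + half x) + \<phi> (\<Sum>\<^sub># (image_mset half V) + \<Sum>\<^sub># (image_mset half V))"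
    by (simp add: \<phi>_add ac_simps)
  then show ?case using add by (simp add: \<phi>_half)
qed simp

lemma null_sum_half: "set_mset V \<subseteq> H \<Longrightarrow> null_mod m (\<Sum>\<^sub># (image_mset half V)) \<longleftrightarrow> \<Sum>\<^sub># V = 0"
  using \<phi>_sum_half[of V] \<phi>_double_eq_0 by metis

lemma half_inj: "x \<in> H \<Longrightarrow> y \<in> H \<Longrightarrow> null_mod m (half x - half y) \<Longrightarrow> x = y"
proof -
  assume xy: "x \<in> H" "y \<in> H" "null_mod m (half x - half y)"
  have "x - y = \<phi> ((half x - half y) + (half x - half y))"
    using \<phi>_half[OF xy(1)] \<phi>_half[OF xy(2)] by (simp add: \<phi>_add \<phi>_diff algebra_simps)
  then show "x = y" using xy(3) \<phi>_double_eq_0[of "half x - half y"] by simp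
qed

lemma size_le_H:
  assumes "set_mset V \<subseteq> H" "min_zero_sum V" shows "size V \<le> 2 * m - 1"
proof (rule ccontr)
  assume "\<not> ?thesis"
  then have big: "size V \<ge> 2 * m" using m_ge_2 by simp
  then have "V \<noteq> {#}" using m_ge_2 by auto
  then obtain x where x: "x \<in># V" by (meson multiset_nonemptyE)
  have "zsf m (image_mset half (V - {#x#}))"
    unfolding zsf_def
  proof (intro allI impI)
    fix B assume "B \<subseteq># image_mset half (V - {#x#})" "B \<noteq> {#}"
    then obtain N where N: "N \<subseteq># V - {#x#}" "image_mset half N = B" "N \<noteq> {#}"
      using subset_image_mset_exists by fastforce
    have NV: "N \<subseteq># V" using N(1) diff_subset_eq_self subset_mset.order_trans by blast
    have "size N < size V" using size_mset_mono[OF N(1)] x big m_ge_2 by (simp add: size_Diff_singleton)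
    then have "\<Sum>\<^sub># N \<noteq> 0" using min_zero_sum_subset[OF assms(2) NV N(3)] by blast
    moreover have "set_mset N \<subseteq> H" using set_mset_mono[OF NV] assms(1) by blast
    ultimately show "\<not> null_mod m (\<Sum>\<^sub># B)" using null_sum_half N(2) by blast
  qed
  then have "size (image_mset half (V - {#x#})) \<le> 2 * m - 2" by (rule davenport)
  then show False using big x m_ge_2 by (simp add: size_Diff_singleton)
qed

lemma half_mzs:
  assumes "set_mset V \<subseteq> H" "min_zero_sum V" shows "mzs m (image_mset half V)"
  unfolding mzs_def
proof (intro conjI allI impI)
  show "null_mod m (\<Sum>\<^sub># (image_mset half V))"
    using assms null_sum_half by (auto simp: min_zero_sum_def)
  fix B assume B: "B \<subset># image_mset half V" "B \<noteq> {#}"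
  then obtain N where N: "N \<subseteq># V" "image_mset half N = B" "N \<noteq> {#}"
    using subset_image_mset_exists[of B half V] by (auto simp: subset_mset.less_le)
  moreover have "size N < size V" using mset_subset_size[OF B(1)] N(2) by auto
  ultimately have "\<Sum>\<^sub># N \<noteq> 0" using min_zero_sum_subset[OF assms(2)] by blast
  moreover have "set_mset N \<subseteq> H" using set_mset_mono[OF N(1)] assms(1) by blast
  ultimately show "\<not> null_mod m (\<Sum>\<^sub># B)" using null_sum_half N(2) by blast
qed

lemma nmul_half:
  assumes "x \<in> H"
  shows "\<phi> ((int k * fst (half x), int k * snd (half x)) + (int k * fst (half x), int k * snd (half x))) = nmul k x"
  using \<phi>_sum_half[of "replicate_mset k x"] assms by (simp add: sum_replicate_mset_pair split: if_splits)

lemma nmul_m: "x \<in> H \<Longrightarrow> nmul m x = 0"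
  unfolding nmul_half[symmetric] \<phi>_double_eq_0 by (simp add: null_mod_def)

text \<open>This is \<open>mzs_core\<close> transported along \<open>half\<close>, for any e that is
  frequent enough.\<close>

lemma core_exists:
  assumes WH: "set_mset W \<subseteq> H" and W: "min_zero_sum W" "size W = 2 * m - 1" and e: "count W e \<ge> m - 1"
  shows "core m W e (W - replicate_mset (m - 1) e)"
proof -
  define F where "F = W - replicate_mset (m - 1) e"
  have WF: "W = replicate_mset (m - 1) e + F" using e by (simp add: F_def count_le_replicate_mset_subset_eq)
  have "count W e > 0" using e m_ge_2 by linarith
  then have eH: "e \<in> H" using WH by auto
  have FH: "set_mset F \<subseteq> H" using WH WF by auto
  let ?W = "image_mset half W"
  have h: "mzs m ?W" "size ?W = 2 * m - 1" "?W = replicate_mset (m - 1) (half e) + image_mset half F"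
    using half_mzs[OF WH W(1)] W(2) by (auto simp: WF)
  have cong: "x - y \<in> cyc e" if "x \<in># F" "y \<in># F" for x y
  proof -
    obtain k where k: "null_mod m (half x - half y - (k * fst (half e), k * snd (half e)))"
      using mzs_core_cong[OF h(1,2) m_ge_2 h(3), of "half x" "half y"] \<open>x \<in># F\<close> \<open>y \<in># F\<close> by auto
    let ?k = "(k * fst (half e), k * snd (half e))"
    have "\<phi> ((half x - half y - ?k) + (half x - half y - ?k)) = 0" using k \<phi>_double_eq_0 by blast
    then have "x - y = \<phi> (?k + ?k)"
      using \<phi>_half[of x] \<phi>_half[of y] that FH by (auto simp: \<phi>_add \<phi>_diff algebra_simps subset_iff)
    moreover have "\<phi> (?k + ?k) \<in> cyc e"
    proof (cases "k \<ge> 0")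
      case True
      then show ?thesis using nmul_half[OF eH, of "nat k"] by simp
    next
      case False
      have "\<phi> (?k + ?k) = - \<phi> (- ?k + - ?k)" by (simp only: \<phi>_minus \<phi>_add) simp
      also have "\<phi> (- ?k + - ?k) = nmul (nat (- k)) e" using nmul_half[OF eH, of "nat (- k)"] False by simp
      finally show ?thesis by (simp add: cyc_minus)
    qed
    ultimately show ?thesis by simp
  qed
  have indep: "m dvd k" if xk: "x \<in># F" "nmul k x \<in> cyc e" for x k
  proof -
    obtain i j where ij: "nmul k x = nmul i e - nmul j e" using xk(2) by (auto simp: cyc_def)
    let ?u = "(int k * fst (half x), int k * snd (half x)) - ((int i - int j) * fst (half e), (int i - int j) * snd (half e))"
    have "x \<in> H" using xk FH by auto
    have "?u + ?u = ((int k * fst (half x), int k * snd (half x)) + (int k * fst (half x), int k * snd (half x)))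
      - ((int i * fst (half e), int i * snd (half e)) + (int i * fst (half e), int i * snd (half e)))
      + ((int j * fst (half e), int j * snd (half e)) + (int j * fst (half e), int j * snd (half e)))"
      by (simp add: prod_eq_iff algebra_simps)
    then have eq: "\<phi> (?u + ?u) = nmul k x - nmul i e + nmul j e"
      using nmul_half[OF \<open>x \<in> H\<close>, of k] nmul_half[OF eH, of i] nmul_half[OF eH, of j]
      by (simp only: \<phi>_add[of "_ - _"] \<phi>_diff)
    have "\<phi> (?u + ?u) = 0" unfolding eq ij by simp
    then have "null_mod m ?u" unfolding \<phi>_double_eq_0 .
    then show ?thesis
      using mzs_core_indep[OF h(1,2) m_ge_2 h(3), of "half x" k "int i - int j"] xk(1) by auto
  qed
  have "size F = m" using arg_cong[OF WF, of size] W(2) m_ge_2 by simp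
  then show ?thesis unfolding core_def F_def[symmetric]
    using WF W(1) cong indep nmul_m WH by auto
qed

lemma core_exists':
  assumes WH: "set_mset W \<subseteq> H" and W: "min_zero_sum W" "size W = 2 * m - 1"
  shows "\<exists>e F. core m W e F"
proof -
  let ?W = "image_mset half W"
  have "reduced m ?W" using WH half_inj by (fastforce simp: reduced_def)
  then obtain v where v: "v \<in># ?W" "count ?W v \<ge> m - 1"
    using large_multiplicity[OF half_mzs[OF WH W(1)]] W(2) unfolding size_image_mset by blast
  then obtain e where e: "e \<in># W" "v = half e" unfolding set_image_mset by blast
  have "half -` {half e} \<inter> set_mset W = {e}"
    using e WH half_inj by (auto simp: subset_iff)
  then have "count ?W v = count W e" by (simp add: count_image_mset e(2))
  then show ?thesis using core_exists[OF assms, of e] v by auto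
qed

end

section \<open>Replacing two blocks of a decomposition\<close>

lemma min_zero_sum_count_less:
  assumes "min_zero_sum W" "nmul k x = 0" "k > 0" "k < size W" shows "count W x < k"
proof (rule ccontr)
  assume "\<not> ?thesis"
  then have "replicate_mset k x \<subseteq># W" by (simp flip: count_le_replicate_mset_subset_eq)
  then show False using min_zero_sum_subset[OF assms(1), of "replicate_mset k x"] assms(2-) by auto
qed

lemma nmul_0 [simp]: "nmul k 0 = 0"
  by (induction k) auto

lemma replicate_two_values:
  assumes "\<And>g. g \<in># F \<Longrightarrow> g = a \<or> g = b" "a \<noteq> b"
  shows "F = replicate_mset (count F a) a + replicate_mset (count F b) b"
  using assms by (intro multiset_eqI) (auto simp flip: not_in_iff)

text \<open>After an exchange the frequent element may be a different one; the second clause lets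
  the old e be used again whenever it has kept its multiplicity.\<close>

definition cored :: "nat \<Rightarrow> 'a::ab_group_add multiset \<Rightarrow> bool" where
  "cored m W \<longleftrightarrow> (\<exists>e F. core m W e F) \<and> (\<forall>e. count W e \<ge> m - 1 \<longrightarrow> core m W e (W - replicate_mset (m - 1) e))"

context
  fixes m :: nat and W F :: "'a::ab_group_add multiset" and e :: 'a
  assumes m: "m \<ge> 3" and core: "core m W e F"
begin

lemma core_W: "W = replicate_mset (m - 1) e + F" using core unfolding core_def by blast
lemma core_size_F: "size F = m" using core unfolding core_def by blast
lemma core_size: "size W = 2 * m - 1" using core_size_F m by (simp add: core_W)
lemma core_min: "min_zero_sum W" using core unfolding core_def by blast
lemma core_nmul: "x \<in># W \<Longrightarrow> nmul m x = 0" using core unfolding core_def by blast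
lemma core_cong: "x \<in># F \<Longrightarrow> y \<in># F \<Longrightarrow> x - y \<in> cyc e" using core unfolding core_def by blast
lemma core_indep: "x \<in># F \<Longrightarrow> nmul k x \<in> cyc e \<Longrightarrow> m dvd k" using core unfolding core_def by blast
lemma core_e_in: "e \<in># W" using m by (simp add: core_W)
lemma core_F_in: "x \<in># F \<Longrightarrow> x \<in># W" by (simp add: core_W)

lemma core_nmul_e: "nmul k e = 0 \<Longrightarrow> k < m \<Longrightarrow> k = 0"
proof (rule ccontr)
  assume "nmul k e = 0" "k < m" "k \<noteq> 0"
  then have "count W e < k" using min_zero_sum_count_less[OF core_min, of k e] core_size by simp
  then show False using \<open>k < m\<close> by (simp add: core_W)
qed

lemma core_not_cyc: "x \<in># F \<Longrightarrow> x \<notin> cyc e"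
  using core_indep[of x 1] m by auto

lemma core_double_not_cyc: "x \<in># F \<Longrightarrow> x + x \<notin> cyc e"
  using core_indep[of x 2] m dvd_imp_le[of m 2] by (auto simp: numeral_2_eq_2)

lemma core_e_notin: "e \<notin># F" using core_not_cyc[of e] by auto

lemma core_in_F_iff: "x \<in># W \<Longrightarrow> x \<noteq> e \<Longrightarrow> x \<in># F" by (auto simp: core_W split: if_splits)

lemma core_count: "count W e = m - 1"
  using core_e_notin by (simp add: core_W not_in_iff)

lemma core_count_F: "x \<noteq> e \<Longrightarrow> count W x = count F x" by (simp add: core_W)

lemma core_count_le: "x \<in># W \<Longrightarrow> count W x \<le> m - 1"
  using min_zero_sum_count_less[OF core_min core_nmul, of x] m core_size by linarith

lemma core_nz: "x \<in># W \<Longrightarrow> x \<noteq> 0"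
  using min_zero_sum_subset[OF core_min, of "{#x#}"] core_size m by auto

lemma core_cyc_Int: "x \<in># F \<Longrightarrow> w \<in> cyc x \<Longrightarrow> w \<in> cyc e \<Longrightarrow> w = 0"
proof -
  assume x: "x \<in># F" and w: "w \<in> cyc x" "w \<in> cyc e"
  have zero: "nmul k x = 0" if k: "nmul k x \<in> cyc e" for k
  proof -
    obtain q where "k = q * m" using core_indep[OF x k] by (metis dvd_def mult.commute)
    then show ?thesis using core_nmul[OF core_F_in[OF x]] by (simp only: nmul_mult nmul_0)
  qed
  obtain i j where ij: "w = nmul i x - nmul j x" using w by (auto simp: cyc_def)
  show "w = 0"
  proof (cases "j \<le> i")
    case True
    then have "w = nmul (i - j) x" using ij nmul_add[of "i - j" j x] by simp
    then show ?thesis using zero w by simp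
  next
    case False
    then have "- w = nmul (j - i) x" using ij nmul_add[of "j - i" i x] by simp
    then show ?thesis using zero[of "j - i"] cyc_minus[OF w(2)] by simp
  qed
qed

lemma core_sum: "nmul (m - 1) e + \<Sum>\<^sub># F = 0"
  using core_min by (simp add: core_W min_zero_sum_def)

text \<open>If e + f occurs l times in \<open>F\<close>, the vanishing sum together with m f = 0
  gives (m - 1 + l) e = 0. As e has order m and f occurs, l = 1.\<close>

lemma double_coreI:
  assumes f: "f \<in># F" and two: "\<And>g. g \<in># F \<Longrightarrow> g = f \<or> g = e + f"
  shows "double_core m W"
proof -
  have "e \<noteq> 0" using core_nz core_e_in by blast
  define k where "k = count F f"
  define l where "l = count F (e + f)"
  have F: "F = replicate_mset k f + replicate_mset l (e + f)"
    using replicate_two_values[of F f "e + f"] two \<open>e \<noteq> 0\<close> by (simp add: k_def l_def)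
  have kl: "k + l = m" using core_size_F by (subst (asm) F) simp
  have "nmul (m - 1) e + (nmul k f + nmul l (e + f)) = 0" using core_sum by (subst (asm) F) simp
  also have "nmul (m - 1) e + (nmul k f + nmul l (e + f)) = nmul (m - 1 + l) e + nmul (k + l) f"
    by (simp add: nmul_plus nmul_add ac_simps)
  finally have zero: "nmul (m - 1 + l) e = 0" using core_nmul[OF core_F_in[OF f]] by (simp add: kl)
  have l: "l = 1"
  proof (cases "l = 0")
    case True then show ?thesis using zero core_nmul_e[of "m - 1"] m by simp
  next
    case False
    then have "m - 1 + l = m + (l - 1)" using m by simp
    then have "nmul (l - 1) e = 0" using zero core_nmul[OF core_e_in] by (simp only: nmul_add) simp
    moreover have "k > 0" using f by (simp add: k_def)
    then have "l - 1 < m" using kl by simp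
    ultimately have "l - 1 = 0" using core_nmul_e by blast
    then show ?thesis using False by simp
  qed
  then have "k = m - 1" using kl by simp
  then have "W = replicate_mset (m - 1) e + replicate_mset (m - 1) f + {#e + f#}"
    using F l by (simp add: core_W)
  then show ?thesis unfolding double_core_def by blast
qed

text \<open>The element g - e - e' lies in the cyclic subgroups of both e and e', which meet only in
  0.\<close>

lemma two_cores:
  assumes core': "core m W' e' F'" "e' \<in># F" "e \<in># F'" "g \<in># F" "g \<in># F'"
  shows "g = e + e'"
proof -
  have "g - e' - e \<in> cyc e" using core_cong[of g e'] assms by (auto intro: cyc_diff)
  moreover have "g - e \<in> cyc e'" using assms(3,5) core' unfolding core_def by blast
  then have "g - e - e' \<in> cyc e'" by (rule cyc_diff) simp
  then have "g - e' - e \<in> cyc e'" by (simp add: algebra_simps)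
  ultimately have "g - e' - e = 0" using core_cyc_Int assms(2) by blast
  then show ?thesis by (simp add: algebra_simps)
qed

end

context
  fixes m :: nat and W F W' C :: "'a::ab_group_add multiset" and e \<sigma>\<^sub>1 \<sigma>\<^sub>2 \<tau>\<^sub>1 \<tau>\<^sub>2 :: 'a
  assumes m: "m \<ge> 4" and core: "core m W e F" and cored': "cored m W'"
    and W: "W = add_mset \<sigma>\<^sub>1 (add_mset \<sigma>\<^sub>2 C)" and W': "W' = add_mset \<tau>\<^sub>1 (add_mset \<tau>\<^sub>2 C)"
    and sum: "\<sigma>\<^sub>1 + \<sigma>\<^sub>2 = \<tau>\<^sub>1 + \<tau>\<^sub>2"
begin

lemma m_ge_3: "m \<ge> 3" using m by simp

text \<open>The element e keeps its multiplicity and so is a core of \<open>W'\<close> as well. Some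
  g in \<open>C\<close> lies in both remainders and links the cosets of
  \<open>\<sigma>\<^sub>1\<close> and \<open>\<tau>\<^sub>1\<close>.\<close>

lemma replace_none:
  assumes "\<sigma>\<^sub>1 \<noteq> e" "\<sigma>\<^sub>2 \<noteq> e" shows "\<tau>\<^sub>1 - \<sigma>\<^sub>1 \<in> cyc e"
proof -
  have cC: "count C e = m - 1" using core_count[OF m_ge_3 core] assms by (simp add: W)
  then have "count W' e \<ge> m - 1" by (simp add: W')
  then obtain G where G: "core m W' e G" using cored' by (auto simp: cored_def)
  have "count W' e = m - 1" by (rule core_count[OF m_ge_3 G])
  moreover have "count W' e \<ge> count C e + 1" if "\<tau>\<^sub>1 = e" by (simp add: W' that)
  ultimately have "\<tau>\<^sub>1 \<noteq> e" using cC m by fastforce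
  then have \<tau>: "\<tau>\<^sub>1 \<in># G" using core_in_F_iff[OF m_ge_3 G, of \<tau>\<^sub>1] by (simp add: W')
  have \<sigma>: "\<sigma>\<^sub>1 \<in># F" using core_in_F_iff[OF m_ge_3 core, of \<sigma>\<^sub>1] assms by (simp add: W)
  have "size C = 2 * m - 3" using core_size[OF m_ge_3 core] by (simp add: W)
  then have "count C e < size C" using cC m by simp
  then obtain g where g: "g \<in># C" "g \<noteq> e" using count_eq_size[of C e] by (metis less_irrefl)
  then have "g \<in># F" "g \<in># G" using core_in_F_iff[OF m_ge_3 core, of g] core_in_F_iff[OF m_ge_3 G, of g] by (auto simp: W W')
  then have "\<tau>\<^sub>1 - g \<in> cyc e" "g - \<sigma>\<^sub>1 \<in> cyc e" using core_cong[OF m_ge_3 G \<tau>] core_cong[OF m_ge_3 core _ \<sigma>] by auto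
  from cyc_add[OF this] show ?thesis by simp
qed

text \<open>If \<open>W'\<close> has another core e', then by \<open>two_cores\<close> the elements
  of \<open>F\<close> are e' and e + e' only, which is the excluded form.\<close>

lemma replace_both:
  assumes "\<not> double_core m W" "\<sigma>\<^sub>1 = e" "\<sigma>\<^sub>2 = e" shows "\<tau>\<^sub>1 = e"
proof -
  obtain e' F' where core': "core m W' e' F'" using cored' by (auto simp: cored_def)
  have cC: "count C e = m - 3" using core_count[OF m_ge_3 core] assms by (simp add: W)
  show ?thesis
  proof (cases "e' = e")
    case True
    then show ?thesis using core_count[OF m_ge_3 core'] cC m by (auto simp: W' split: if_splits)
  next
    case False
    have F: "count F g = count C g" if "g \<noteq> e" for g
      using core_count_F[OF m_ge_3 core, of g] that assms by (simp add: W)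
    have "count W' e' = m - 1" by (rule core_count[OF m_ge_3 core'])
    moreover have "count W' e' \<le> count C e' + 2" by (simp add: W')
    ultimately have "count C e' > 0" using m by linarith
    then have e'F: "e' \<in># F" using F[OF False] by (metis count_greater_zero_iff)
    have "e \<in># C" using cC m by (simp flip: count_greater_zero_iff)
    then have eF': "e \<in># F'" using core_in_F_iff[OF m_ge_3 core', of e] False by (simp add: W')
    have "g = e' \<or> g = e + e'" if g: "g \<in># F" for g
    proof (cases "g = e'")
      case ge: False
      have "g \<noteq> e" using g core_e_notin[OF m_ge_3 core] by auto
      then have "g \<in># C" using F g by (metis count_greater_zero_iff)
      then have "g \<in># F'" using core_in_F_iff[OF m_ge_3 core', of g] ge by (simp add: W')
      then show ?thesis using two_cores[OF m_ge_3 core core' e'F eF' g] by simp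
    qed simp
    then have "double_core m W" using double_coreI[OF m_ge_3 core e'F] by blast
    then show ?thesis using assms(1) by simp
  qed
qed

text \<open>As in \<open>replace_both\<close>, a different core e' leaves only e' and e + e' in
  \<open>C\<close> beside e. The removed \<open>\<sigma>\<^sub>2\<close> escapes that argument and
  is determined from the sum of \<open>W\<close>.\<close>

lemma replace_one:
  assumes "\<not> double_core m W" "\<sigma>\<^sub>1 = e" "\<sigma>\<^sub>2 \<noteq> e" shows "\<tau>\<^sub>1 = \<sigma>\<^sub>1 \<or> \<tau>\<^sub>1 = \<sigma>\<^sub>2"
proof -
  obtain e' F' where core': "core m W' e' F'" using cored' by (auto simp: cored_def)
  have cC: "count C e = m - 2" using core_count[OF m_ge_3 core] assms by (simp add: W)
  show ?thesis
  proof (cases "e' = e")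
    case True
    then have "\<tau>\<^sub>1 = e \<or> \<tau>\<^sub>2 = e" using core_count[OF m_ge_3 core'] cC m by (auto simp: W' split: if_splits)
    then show ?thesis using sum assms by auto
  next
    case False
    have F: "count F g = count C g + (if g = \<sigma>\<^sub>2 then 1 else 0)" if "g \<noteq> e" for g
      using core_count_F[OF m_ge_3 core, of g] that assms by (cases "g = \<sigma>\<^sub>2") (simp_all add: W)
    have cW': "count W' e' = m - 1" by (rule core_count[OF m_ge_3 core'])
    moreover have "count W' e' \<le> count C e' + 2" by (simp add: W')
    ultimately have "count C e' > 0" using m by linarith
    then have e'F: "e' \<in># F" using F[OF False] by (metis count_greater_zero_iff add_gr_0)
    have "e \<in># C" using cC m by (simp flip: count_greater_zero_iff)
    then have eF': "e \<in># F'" using core_in_F_iff[OF m_ge_3 core', of e] False by (simp add: W')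
    have \<sigma>F: "\<sigma>\<^sub>2 \<in># F" using core_in_F_iff[OF m_ge_3 core, of \<sigma>\<^sub>2] assms by (simp add: W)
    have C: "g = e' \<or> g = e + e'" if g: "g \<in># C" "g \<noteq> e" for g
    proof (cases "g = e'")
      case ge: False
      have gF: "g \<in># F" using core_in_F_iff[OF m_ge_3 core, of g] g by (simp add: W)
      have "g \<in># F'" using core_in_F_iff[OF m_ge_3 core', of g] ge g by (simp add: W')
      then show ?thesis using two_cores[OF m_ge_3 core core' e'F eF' gF] by simp
    qed simp
    have "e \<noteq> 0" using core_nz[OF m_ge_3 core core_e_in[OF m_ge_3 core]] .
    have "\<sigma>\<^sub>2 = e' \<or> \<sigma>\<^sub>2 = e + e'"
    proof (rule ccontr)
      assume \<sigma>: "\<not> ?thesis"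
      define D where "D = F - {#\<sigma>\<^sub>2#}"
      have FD: "F = add_mset \<sigma>\<^sub>2 D" using \<sigma>F by (simp add: D_def)
      have sD: "size D = m - 1" using core_size_F[OF m_ge_3 core] by (simp add: FD)
      define k where "k = count D e'"
      define l where "l = count D (e + e')"
      have D: "D = replicate_mset k e' + replicate_mset l (e + e')"
        unfolding k_def l_def
      proof (rule replicate_two_values)
        fix g assume "g \<in># D"
        moreover have "g \<noteq> e" using \<open>g \<in># D\<close> core_e_notin[OF m_ge_3 core] by (auto simp: FD)
        moreover have "count D g = count C g" using F[OF \<open>g \<noteq> e\<close>] by (simp add: FD split: if_splits)
        ultimately show "g = e' \<or> g = e + e'" using C by (metis count_greater_zero_iff)
      qed (use \<open>e \<noteq> 0\<close> in simp)
      have kl: "k + l = m - 1" using sD by (subst (asm) D) simp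
      have "nmul (m - 1) e + (\<sigma>\<^sub>2 + (nmul k e' + nmul l (e + e'))) = 0"
        using core_sum[OF m_ge_3 core] by (simp add: FD D)
      then have *: "nmul (m - 1) e + \<sigma>\<^sub>2 + nmul l e + nmul (m - 1) e' = 0"
        by (simp only: nmul_plus nmul_add[of k l e', unfolded kl] ac_simps)
      have me: "nmul (m - 1) x = - x" if "x \<in># W" for x
        using core_nmul[OF m_ge_3 core that] m nmul_add[of "m - 1" 1 x] by (simp add: eq_neg_iff_add_eq_0)
      have **: "\<sigma>\<^sub>2 + nmul l e = e + e'"
        using * me[OF core_e_in[OF m_ge_3 core]] me[OF core_F_in[OF m_ge_3 core e'F]] by (simp add: algebra_simps)
      have kC: "k = count C e'" using F[OF False] \<sigma> by (auto simp: k_def FD)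
      moreover have "count W' e' \<le> count C e' + 2" by (simp add: W')
      ultimately have "k + 2 \<ge> m - 1" using cW' by simp
      \<comment> \<open>Since e' is added to \<open>C\<close> at most twice, l <= 2. For l = 2 both
        new sums are e', which would put e' into the subgroup of e.\<close>
      then consider "l = 0" | "l = 1" | "l = 2" using kl by linarith
      then show False
      proof cases
        case 1 then show False using ** \<sigma> by simp
      next
        case 2 then show False using ** \<sigma> by (simp add: algebra_simps)
      next
        case 3
        then have "k = m - 3" using kl by simp
        then have "\<tau>\<^sub>1 = e'" "\<tau>\<^sub>2 = e'" using cW' kC m by (auto simp: W' split: if_splits)
        then have "\<sigma>\<^sub>2 = e' + e' - e" using sum assms by (simp add: algebra_simps)
        moreover have "\<sigma>\<^sub>2 - e' \<in> cyc e" using core_cong[OF m_ge_3 core \<sigma>F e'F] .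
        ultimately have "(\<sigma>\<^sub>2 - e') + e \<in> cyc e" by (intro cyc_add) auto
        moreover have "(\<sigma>\<^sub>2 - e') + e = e'" using \<open>\<sigma>\<^sub>2 = e' + e' - e\<close> by simp
        ultimately show False using core_not_cyc[OF m_ge_3 core e'F] by simp
      qed
    qed
    moreover have "g = e' \<or> g = e + e'" if g: "g \<in># F" "g \<noteq> \<sigma>\<^sub>2" for g
    proof -
      have "g \<noteq> e" using g core_e_notin[OF m_ge_3 core] by auto
      then show ?thesis using C F[of g] g by (metis add.right_neutral count_greater_zero_iff)
    qed
    ultimately have "double_core m W" using double_coreI[OF m_ge_3 core e'F] by metis
    then show ?thesis using assms(1) by simp
  qed
qed

text \<open>\<open>W'\<close> has at most three different elements, and e, f, e + f all survive in
  \<open>C\<close>. Moreover f already has the maximal multiplicity, so few values are left for the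
  new sums.\<close>

lemma replace_double_both:
  assumes W_double: "W = replicate_mset (m - 1) e + replicate_mset (m - 1) f + {#e + f#}"
    and "double_core m W'" "\<sigma>\<^sub>1 = e" "\<sigma>\<^sub>2 = e"
  shows "\<tau>\<^sub>1 = e"
proof (rule ccontr)
  assume \<tau>: "\<tau>\<^sub>1 \<noteq> e"
  have C: "C + {#e, e#} = replicate_mset (m - 1) e + replicate_mset (m - 1) f + {#e + f#}"
    using W_double W assms by simp
  have "f \<in># W" "e \<in># W" "e + f \<in># W" using m by (simp_all add: W_double)
  then have nz: "e \<noteq> 0" "f \<noteq> 0" "e + f \<noteq> 0" using core_nz[OF m_ge_3 core] by blast+
  have F: "F = replicate_mset (m - 1) f + {#e + f#}" using core_W[OF m_ge_3 core] W_double by simp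
  then have fF: "f \<in># F" "e + f \<in># F" using m by auto
  then have "e \<noteq> f" "f + f \<noteq> 0" using core_e_notin[OF m_ge_3 core] core_double_not_cyc[OF m_ge_3 core, of f] by auto
  have count: "count C g + (if g = e then 2 else 0) = (if g = e then m - 1 else 0) + (if g = f then m - 1 else 0) + (if g = e + f then 1 else 0)" for g
    using arg_cong[OF C, of "\<lambda>M. count M g"] by (auto split: if_splits)
  obtain G h where core': "core m W' h G" using cored' by (auto simp: cored_def)
  have cle: "count W' g \<le> m - 1" if "g \<in># W'" for g using core_count_le[OF m_ge_3 core' that] .
  have "count C f = m - 1" using count[of f] \<open>e \<noteq> f\<close> nz by simp
  then have \<tau>f: "\<tau>\<^sub>1 \<noteq> f" "\<tau>\<^sub>2 \<noteq> f"
    using cle[of f] by (cases "\<tau>\<^sub>1 = f"; cases "\<tau>\<^sub>2 = f"; simp add: W')+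
  obtain a b where ab: "W' = replicate_mset (m - 1) a + replicate_mset (m - 1) b + {#a + b#}"
    using assms(2) by (auto simp: double_core_def)
  have "card (set_mset W') \<le> 3" using m by (simp add: ab card_insert_if)
  moreover have "{e, f, e + f} \<subseteq> set_mset W'"
  proof -
    have "count C e > 0" "count C f > 0" "count C (e + f) > 0"
      using count[of e] count[of f] count[of "e + f"] m \<open>e \<noteq> f\<close> nz by (simp_all del: count_greater_zero_iff)
    then show ?thesis by (simp add: W')
  qed
  moreover have "card {e, f, e + f} = 3" using \<open>e \<noteq> f\<close> nz by auto
  ultimately have "set_mset W' = {e, f, e + f}" by (metis card_seteq finite_set_mset)
  then have "\<tau>\<^sub>1 \<in> {e, f, e + f}" "\<tau>\<^sub>2 \<in> {e, f, e + f}" by (auto simp: W')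
  then have "\<tau>\<^sub>1 = e + f" "\<tau>\<^sub>2 = e \<or> \<tau>\<^sub>2 = e + f" using \<tau> \<tau>f by auto
  then show False using sum assms nz \<open>f + f \<noteq> 0\<close> by (auto simp: algebra_simps)
qed

lemma replace_double_one:
  assumes W_double: "W = replicate_mset (m - 1) e + replicate_mset (m - 1) f + {#e + f#}"
    and "double_core m W'" "\<sigma>\<^sub>1 = e" "\<sigma>\<^sub>2 \<noteq> e"
  shows "\<tau>\<^sub>1 = \<sigma>\<^sub>1 \<or> \<tau>\<^sub>1 = \<sigma>\<^sub>2"
proof -
  have "f \<in># W" "e \<in># W" "e + f \<in># W" using m by (simp_all add: W_double)
  then have nz: "e \<noteq> 0" "f \<noteq> 0" "e + f \<noteq> 0" using core_nz[OF m_ge_3 core] by blast+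
  have F: "F = replicate_mset (m - 1) f + {#e + f#}" using core_W[OF m_ge_3 core] W_double by simp
  then have fF: "f \<in># F" "e + f \<in># F" using m by auto
  then have ef: "e \<noteq> f" "f + f \<notin> cyc e" using core_e_notin[OF m_ge_3 core] core_double_not_cyc[OF m_ge_3 core, of f] by auto
  have C: "add_mset \<sigma>\<^sub>2 (add_mset e C) = replicate_mset (m - 1) e + replicate_mset (m - 1) f + {#e + f#}"
    using W_double W assms by (simp add: add_mset_commute)
  have count: "count C g + (if g = e then 1 else 0) + (if g = \<sigma>\<^sub>2 then 1 else 0)
      = (if g = e then m - 1 else 0) + (if g = f then m - 1 else 0) + (if g = e + f then 1 else 0)" for g
    using arg_cong[OF C, of "\<lambda>M. count M g"] by (auto split: if_splits)
  obtain G h where core': "core m W' h G" using cored' by (auto simp: cored_def)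
  have nz': "g \<noteq> 0" if "g \<in># W'" for g using core_nz[OF m_ge_3 core' that] .
  have cle: "count W' g \<le> m - 1" if "g \<in># W'" for g using core_count_le[OF m_ge_3 core' that] .
  obtain a b where ab: "W' = replicate_mset (m - 1) a + replicate_mset (m - 1) b + {#a + b#}"
    using assms(2) by (auto simp: double_core_def)
  have \<sigma>: "\<sigma>\<^sub>2 = f \<or> \<sigma>\<^sub>2 = e + f"
    using count[of \<sigma>\<^sub>2] assms by (auto split: if_splits)
  then show ?thesis
  proof
    assume \<sigma>f: "\<sigma>\<^sub>2 = f"
    have "card (set_mset W') \<le> 3" using m by (simp add: ab card_insert_if)
    moreover have "{e, f, e + f} \<subseteq> set_mset W'"
    proof -
      have "count C e > 0" "count C f > 0" "count C (e + f) > 0"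
        using count[of e] count[of f] count[of "e + f"] m ef nz \<sigma>f by (simp_all del: count_greater_zero_iff)
      then show ?thesis by (simp add: W')
    qed
    moreover have "card {e, f, e + f} = 3" using ef nz by auto
    ultimately have "set_mset W' = {e, f, e + f}" by (metis card_seteq finite_set_mset)
    then have "\<tau>\<^sub>1 \<in> {e, f, e + f}" by (auto simp: W')
    moreover have "\<tau>\<^sub>1 \<noteq> e + f"
    proof
      assume "\<tau>\<^sub>1 = e + f"
      then have "\<tau>\<^sub>2 = 0" using sum \<sigma>f assms by simp
      then show False using nz'[of \<tau>\<^sub>2] by (simp add: W')
    qed
    ultimately show ?thesis using \<sigma>f assms by auto
  next
    \<comment> \<open>The only copy of e + f has been removed, so the support of \<open>W'\<close>
      is not known beforehand; multiplicities decide instead.\<close>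
    assume \<sigma>ef: "\<sigma>\<^sub>2 = e + f"
    have cf: "count C f = m - 1" using count[of f] ef nz \<sigma>ef by simp
    have ce: "count C e = m - 2" using count[of e] ef nz \<sigma>ef by simp
    have c0: "count C g = 0" if "g \<noteq> e" "g \<noteq> f" for g using count[of g] that \<sigma>ef by (auto split: if_splits)
    have \<tau>f: "\<tau>\<^sub>1 \<noteq> f" "\<tau>\<^sub>2 \<noteq> f" using cf cle[of f] by (cases "\<tau>\<^sub>1 = f"; cases "\<tau>\<^sub>2 = f"; simp add: W')+
    show ?thesis
    proof (rule ccontr)
      assume "\<not> ?thesis"
      then have "\<tau>\<^sub>1 \<noteq> e" "\<tau>\<^sub>2 \<noteq> e" using sum assms by auto
      then have "count W' e = m - 2" using ce by (simp add: W')
      have ge: "count W' a \<ge> m - 1" "count W' b \<ge> m - 1" by (simp_all add: ab)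
      then have "e \<noteq> a" "e \<noteq> b" using \<open>count W' e = m - 2\<close> m by auto
      moreover have "e \<in># W'" using \<open>count W' e = m - 2\<close> m by (simp flip: count_greater_zero_iff)
      ultimately have eab: "e = a + b" by (auto simp: ab split: if_splits)
      have small: "count W' g \<le> 2" if "g \<noteq> e" "g \<noteq> f" for g using c0[OF that] by (simp add: W')
      have "m - 1 > 2" using m by simp
      have "a = f" using small[of a] ge(1) \<open>e \<noteq> a\<close> \<open>m - 1 > 2\<close> by fastforce
      moreover have "b = f" using small[of b] ge(2) \<open>e \<noteq> b\<close> \<open>m - 1 > 2\<close> by fastforce
      ultimately show False using ef eab by auto
    qed
  qed
qed

end

text \<open>What \<open>\<tau>\<^sub>1\<close> can be when two blocks with sums \<open>\<sigma>\<^sub>1\<close> and \<open>\<sigma>\<^sub>2\<close> are rearranged into two blocks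
  with sums \<open>\<tau>\<^sub>1\<close> and \<open>\<tau>\<^sub>2\<close>.\<close>

definition replacement_ok :: "'a::ab_group_add \<Rightarrow> 'a \<Rightarrow> 'a \<Rightarrow> 'a \<Rightarrow> bool" where
  "replacement_ok e \<sigma>\<^sub>1 \<sigma>\<^sub>2 \<tau>\<^sub>1 \<longleftrightarrow>
     (\<sigma>\<^sub>1 = e \<longrightarrow> \<sigma>\<^sub>2 = e \<longrightarrow> \<tau>\<^sub>1 = e) \<and>
     (\<sigma>\<^sub>1 = e \<longrightarrow> \<sigma>\<^sub>2 \<noteq> e \<longrightarrow> \<tau>\<^sub>1 = \<sigma>\<^sub>1 \<or> \<tau>\<^sub>1 = \<sigma>\<^sub>2) \<and>
     (\<sigma>\<^sub>1 \<noteq> e \<longrightarrow> \<sigma>\<^sub>2 \<noteq> e \<longrightarrow> \<tau>\<^sub>1 - \<sigma>\<^sub>1 \<in> cyc e)"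

text \<open>The family \<open>\<W>\<close> consists of the multisets of block sums of all decompositions. If one of them is
  not of the symmetric form \<open>double_core\<close>, then that one is chosen.\<close>

lemma ex_good_member:
  fixes \<W> :: "'a::ab_group_add multiset set"
  assumes m: "m \<ge> 4" and ne: "\<W> \<noteq> {}" and cored: "\<And>W. W \<in> \<W> \<Longrightarrow> cored m W"
  shows "\<exists>W\<in>\<W>. \<exists>e F. core m W e F \<and>
    (\<forall>\<sigma>\<^sub>1 \<sigma>\<^sub>2 \<tau>\<^sub>1 \<tau>\<^sub>2 C. W = add_mset \<sigma>\<^sub>1 (add_mset \<sigma>\<^sub>2 C) \<longrightarrow> add_mset \<tau>\<^sub>1 (add_mset \<tau>\<^sub>2 C) \<in> \<W> \<longrightarrow>
       \<sigma>\<^sub>1 + \<sigma>\<^sub>2 = \<tau>\<^sub>1 + \<tau>\<^sub>2 \<longrightarrow> replacement_ok e \<sigma>\<^sub>1 \<sigma>\<^sub>2 \<tau>\<^sub>1)"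
proof (cases "\<exists>W\<in>\<W>. \<not> double_core m W")
  case True
  then obtain W where W: "W \<in> \<W>" "\<not> double_core m W" by blast
  then obtain e F where core: "core m W e F" using cored[OF W(1)] unfolding cored_def by blast
  have "replacement_ok e \<sigma>\<^sub>1 \<sigma>\<^sub>2 \<tau>\<^sub>1"
    if "W = add_mset \<sigma>\<^sub>1 (add_mset \<sigma>\<^sub>2 C)" "add_mset \<tau>\<^sub>1 (add_mset \<tau>\<^sub>2 C) \<in> \<W>" "\<sigma>\<^sub>1 + \<sigma>\<^sub>2 = \<tau>\<^sub>1 + \<tau>\<^sub>2" for \<sigma>\<^sub>1 \<sigma>\<^sub>2 \<tau>\<^sub>1 \<tau>\<^sub>2 C
    using replace_none[OF m core cored[OF that(2)] that(1) refl that(3)]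
      replace_both[OF m core cored[OF that(2)] that(1) refl that(3) W(2)]
      replace_one[OF m core cored[OF that(2)] that(1) refl that(3) W(2)]
    unfolding replacement_ok_def by blast
  then show ?thesis using W(1) core by blast
next
  case False
  obtain W where W: "W \<in> \<W>" using ne by blast
  then obtain e f where ef: "W = replicate_mset (m - 1) e + replicate_mset (m - 1) f + {#e + f#}"
    using False by (auto simp: double_core_def)
  then have "count W e \<ge> m - 1" by simp
  then obtain F where core: "core m W e F" using cored[OF W] unfolding cored_def by blast
  have "replacement_ok e \<sigma>\<^sub>1 \<sigma>\<^sub>2 \<tau>\<^sub>1"
    if "W = add_mset \<sigma>\<^sub>1 (add_mset \<sigma>\<^sub>2 C)" "add_mset \<tau>\<^sub>1 (add_mset \<tau>\<^sub>2 C) \<in> \<W>" "\<sigma>\<^sub>1 + \<sigma>\<^sub>2 = \<tau>\<^sub>1 + \<tau>\<^sub>2" for \<sigma>\<^sub>1 \<sigma>\<^sub>2 \<tau>\<^sub>1 \<tau>\<^sub>2 C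
  proof -
    have "double_core m (add_mset \<tau>\<^sub>1 (add_mset \<tau>\<^sub>2 C))" using False that(2) by blast
    then show ?thesis
      using replace_none[OF m core cored[OF that(2)] that(1) refl that(3)]
        replace_double_both[OF m core cored[OF that(2)] that(1) refl that(3) ef]
        replace_double_one[OF m core cored[OF that(2)] that(1) refl that(3) ef]
      unfolding replacement_ok_def by blast
  qed
  then show ?thesis using W core by blast
qed

section \<open>Decompositions into pairs and one triple\<close>

definition pairs :: "('a \<times> 'a) multiset \<Rightarrow> 'a multiset" where
  "pairs P = image_mset fst P + image_mset snd P"

definition pair_sums :: "('a::ab_group_add \<times> 'a) multiset \<Rightarrow> 'a multiset" where
  "pair_sums P = image_mset (\<lambda>(a, b). a + b) P"

lemma pairs_simps [simp]: "pairs {#} = {#}" "pairs (add_mset p P) = add_mset (fst p) (add_mset (snd p) (pairs P))"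
  by (simp_all add: pairs_def)

lemma pair_sums_simps [simp]: "pair_sums {#} = {#}" "pair_sums (add_mset p P) = add_mset (fst p + snd p) (pair_sums P)"
  by (simp_all add: pair_sums_def split: prod.split)

lemma size_pairs [simp]: "size (pairs P) = 2 * size P" by (simp add: pairs_def)
lemma size_pair_sums [simp]: "size (pair_sums P) = size P" by (simp add: pair_sums_def)

lemma pairs_const: "(\<And>a b. (a, b) \<in># P \<Longrightarrow> a = u \<and> b = u) \<Longrightarrow> pairs P = replicate_mset (2 * size P) u"
proof (induction P)
  case (add p P)
  have "a = u \<and> b = u" if "(a, b) \<in># P" for a b using add.prems[of a b] that by simp
  then have "pairs P = replicate_mset (2 * size P) u" by (rule add.IH)
  moreover have "fst p = u" "snd p = u" using add.prems[of "fst p" "snd p"] by simp_all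
  ultimately show ?case by simp
qed simp

lemma pair_sums_const: "(\<And>a b. (a, b) \<in># P \<Longrightarrow> a + b = u) \<Longrightarrow> pair_sums P = replicate_mset (size P) u"
  by (induction P) auto

lemma pair_sums_avoid: "(\<And>a b. (a, b) \<in># P \<Longrightarrow> a + b \<noteq> u) \<Longrightarrow> count (pair_sums P) u = 0"
  by (induction P) auto

text \<open>\<open>W\<close> consists of the block sums of a decomposition of \<open>X + Y + Z\<close> into the triple \<open>{x, y, z}\<close>
  and pairs inside \<open>X\<close>, \<open>Y\<close> and \<open>Z\<close>.\<close>

definition dec :: "'a::ab_group_add multiset \<Rightarrow> 'a multiset \<Rightarrow> 'a multiset \<Rightarrow> 'a multiset \<Rightarrow>
    'a \<Rightarrow> ('a \<times> 'a) multiset \<Rightarrow> 'a \<Rightarrow> ('a \<times> 'a) multiset \<Rightarrow> 'a \<Rightarrow> ('a \<times> 'a) multiset \<Rightarrow> bool" where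
  "dec X Y Z W x P y Q z R \<longleftrightarrow> X = add_mset x (pairs P) \<and> Y = add_mset y (pairs Q) \<and> Z = add_mset z (pairs R) \<and>
     W = add_mset (x + y + z) (pair_sums P + pair_sums Q + pair_sums R)"

lemma dec_perm: "dec X Y Z W x P y Q z R \<Longrightarrow> dec Y X Z W y Q x P z R" "dec X Y Z W x P y Q z R \<Longrightarrow> dec X Z Y W x P z R y Q"
  by (simp_all add: dec_def ac_simps)

lemma dec_flip: "dec X Y Z W x (add_mset (a, b) P) y Q z R \<Longrightarrow> dec X Y Z W x (add_mset (b, a) P) y Q z R"
  by (simp add: dec_def add_mset_commute add.commute)

text \<open>The three classes enter symmetrically (\<open>perm\<close>), so results about the pairs
  in \<open>X\<close> serve for all classes. \<open>replacement\<close> is what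
  \<open>ex_good_member\<close> provides for every other decomposition.\<close>

locale class_triple =
  fixes m :: nat and W :: "'a::ab_group_add multiset" and e F X Y Z
  assumes m_ge_4: "m \<ge> 4" and core: "core m W e F"
    and replacement: "\<And>W' x P y Q z R \<sigma>\<^sub>1 \<sigma>\<^sub>2 \<tau>\<^sub>1 \<tau>\<^sub>2 C. dec X Y Z W' x P y Q z R \<Longrightarrow>
      W = add_mset \<sigma>\<^sub>1 (add_mset \<sigma>\<^sub>2 C) \<Longrightarrow> W' = add_mset \<tau>\<^sub>1 (add_mset \<tau>\<^sub>2 C) \<Longrightarrow>
      \<sigma>\<^sub>1 + \<sigma>\<^sub>2 = \<tau>\<^sub>1 + \<tau>\<^sub>2 \<Longrightarrow> replacement_ok e \<sigma>\<^sub>1 \<sigma>\<^sub>2 \<tau>\<^sub>1"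
begin

lemma m_ge_3: "m \<ge> 3" using m_ge_4 by simp

lemma perm: "class_triple m W e F Y X Z" "class_triple m W e F X Z Y"
proof -
  show "class_triple m W e F Y X Z"
  proof
    fix W' x P y Q z R \<sigma>\<^sub>1 \<sigma>\<^sub>2 \<tau>\<^sub>1 \<tau>\<^sub>2 C
    assume "dec Y X Z W' x P y Q z R" and *: "W = add_mset \<sigma>\<^sub>1 (add_mset \<sigma>\<^sub>2 C)" "W' = add_mset \<tau>\<^sub>1 (add_mset \<tau>\<^sub>2 C)"
      "\<sigma>\<^sub>1 + \<sigma>\<^sub>2 = \<tau>\<^sub>1 + \<tau>\<^sub>2"
    show "replacement_ok e \<sigma>\<^sub>1 \<sigma>\<^sub>2 \<tau>\<^sub>1"
      using replacement[OF dec_perm(1)[OF \<open>dec Y X Z W' x P y Q z R\<close>] *] .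
  qed (fact m_ge_4, fact core)
  show "class_triple m W e F X Z Y"
  proof
    fix W' x P y Q z R \<sigma>\<^sub>1 \<sigma>\<^sub>2 \<tau>\<^sub>1 \<tau>\<^sub>2 C
    assume "dec X Z Y W' x P y Q z R" and *: "W = add_mset \<sigma>\<^sub>1 (add_mset \<sigma>\<^sub>2 C)" "W' = add_mset \<tau>\<^sub>1 (add_mset \<tau>\<^sub>2 C)"
      "\<sigma>\<^sub>1 + \<sigma>\<^sub>2 = \<tau>\<^sub>1 + \<tau>\<^sub>2"
    show "replacement_ok e \<sigma>\<^sub>1 \<sigma>\<^sub>2 \<tau>\<^sub>1"
      using replacement[OF dec_perm(2)[OF \<open>dec X Z Y W' x P y Q z R\<close>] *] .
  qed (fact m_ge_4, fact core)
qed

lemma in_F: assumes "dec X Y Z W x P y Q z R" shows "x + y + z \<noteq> e \<Longrightarrow> x + y + z \<in># F"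
  "(a, b) \<in># P \<Longrightarrow> a + b \<noteq> e \<Longrightarrow> a + b \<in># F"
proof -
  show "x + y + z \<in># F" if "x + y + z \<noteq> e"
    using core_in_F_iff[OF m_ge_3 core _ that] assms by (simp add: dec_def)
  show "a + b \<in># F" if "(a, b) \<in># P" "a + b \<noteq> e"
    using core_in_F_iff[OF m_ge_3 core _ that(2)] assms that(1) by (force simp: dec_def pair_sums_def)
qed

text \<open>The elements x and a change places. The third claim covers the case that the block sums
  stay the same, so that the new decomposition again belongs to \<open>W\<close>.\<close>

lemma exchange_triple:
  assumes d: "dec X Y Z W x P y Q z R" and ab: "(a, b) \<in># P"
  shows "replacement_ok e (x + y + z) (a + b) (a + y + z)" "replacement_ok e (a + b) (x + y + z) (x + b)"
    "{#x + y + z, a + b#} = {#a + y + z, x + b#} \<Longrightarrow> dec X Y Z W a (add_mset (x, b) (P - {#(a, b)#})) y Q z R"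
proof -
  define P' where "P' = P - {#(a, b)#}"
  have P: "P = add_mset (a, b) P'" using ab by (simp add: P'_def)
  let ?C = "pair_sums P' + pair_sums Q + pair_sums R"
  have d': "dec X Y Z (add_mset (a + y + z) (add_mset (x + b) ?C)) a (add_mset (x, b) P') y Q z R"
    using d by (simp add: dec_def P add_mset_commute)
  have W: "W = add_mset (x + y + z) (add_mset (a + b) ?C)" using d by (simp add: dec_def P)
  show "replacement_ok e (x + y + z) (a + b) (a + y + z)"
    by (rule replacement[OF d' W refl]) (simp add: ac_simps)
  show "replacement_ok e (a + b) (x + y + z) (x + b)"
    by (rule replacement[OF d', where C = ?C and \<tau>\<^sub>2 = "a + y + z"]) (simp_all add: W add_mset_commute ac_simps)
  show "dec X Y Z W a (add_mset (x, b) (P - {#(a, b)#})) y Q z R" if "{#x + y + z, a + b#} = {#a + y + z, x + b#}"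
  proof -
    have "W = {#x + y + z, a + b#} + ?C" using W by simp
    also have "\<dots> = add_mset (a + y + z) (add_mset (x + b) ?C)" unfolding that by simp
    finally show ?thesis using d' unfolding P'_def by simp
  qed
qed

lemma exchange_pairs:
  assumes d: "dec X Y Z W x (add_mset (a, b) (add_mset (c, d) P)) y Q z R"
  shows "replacement_ok e (a + b) (c + d) (a + c)"
proof -
  let ?C = "add_mset (x + y + z) (pair_sums P + pair_sums Q + pair_sums R)"
  have "dec X Y Z (add_mset (a + c) (add_mset (b + d) ?C)) x (add_mset (a, c) (add_mset (b, d) P)) y Q z R"
    using d by (simp add: dec_def add_mset_commute)
  moreover have "W = add_mset (a + b) (add_mset (c + d) ?C)" using d by (simp add: dec_def add_mset_commute)
  ultimately show ?thesis by (rule replacement[OF _ _ refl]) (simp add: ac_simps)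
qed

lemma pair_flip:
  assumes "dec X Y Z W x P y Q z R" "(a, b) \<in># P"
  shows "dec X Y Z W x (add_mset (b, a) (P - {#(a, b)#})) y Q z R"
  using dec_flip[of X Y Z W x a b "P - {#(a, b)#}" y Q z R] assms by simp

section \<open>Decompositions whose triple has sum \<open>e\<close>\<close>

lemma core_triple_pair:
  assumes d: "dec X Y Z W x P y Q z R" and T: "x + y + z = e" and ab: "(a, b) \<in># P"
  shows "a + b = e \<Longrightarrow> a = x \<and> b = x" "a + b \<noteq> e \<Longrightarrow> (a = x \<or> x + b = e) \<and> (b = x \<or> x + a = e)"
proof -
  have ab': "(b, a) \<in># add_mset (b, a) (P - {#(a, b)#})" by simp
  have 1: "replacement_ok e e (a + b) (a + y + z)" using exchange_triple(1)[OF d ab] T by simp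
  have 2: "replacement_ok e e (a + b) (b + y + z)"
    using exchange_triple(1)[OF pair_flip[OF d ab] ab'] T by (simp add: add.commute)
  have yz: "y + z = e - x" using T by (simp add: algebra_simps)
  have r: "c + y + z = e \<longleftrightarrow> c = x" for c using T by (metis add.assoc add_right_cancel)
  have r': "c + y + z = c + d \<longleftrightarrow> x + d = e" for c d
    using yz by (simp add: add.assoc) (metis add.commute diff_add_cancel diff_add_eq eq_diff_eq)
  have r'': "d + y + z = c + d \<longleftrightarrow> x + c = e" for c d using r'[of d c] by (simp add: add.commute)
  show "a + b = e \<Longrightarrow> a = x \<and> b = x" using 1 2 by (simp add: replacement_ok_def r)
  show "a + b \<noteq> e \<Longrightarrow> (a = x \<or> x + b = e) \<and> (b = x \<or> x + a = e)"
    using 1 2 by (simp add: replacement_ok_def r r' r'')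
qed

lemma cross_cong:
  assumes d: "dec X Y Z W x P y Q z R" and sub: "{#(a, b), (c, d)#} \<subseteq># P" and F: "a + b \<noteq> e" "c + d \<noteq> e"
  shows "c - b \<in> cyc e" "d - b \<in> cyc e" "c - a \<in> cyc e" "d - a \<in> cyc e"
proof -
  obtain P' where P: "P = add_mset (a, b) (add_mset (c, d) P')" using sub by (auto simp: mset_subset_eq_exists_conv)
  have d1: "dec X Y Z W x (add_mset (a, b) (add_mset (c, d) P')) y Q z R" using d P by simp
  have d2: "dec X Y Z W x (add_mset (b, a) (add_mset (c, d) P')) y Q z R" by (rule dec_flip[OF d1])
  have d3: "dec X Y Z W x (add_mset (a, b) (add_mset (d, c) P')) y Q z R"
    using dec_flip[of X Y Z W x c d "add_mset (a, b) P'"] d1 by (simp add: add_mset_commute)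
  have d4: "dec X Y Z W x (add_mset (b, a) (add_mset (d, c) P')) y Q z R" by (rule dec_flip[OF d3])
  have F': "b + a \<noteq> e" "d + c \<noteq> e" using F by (simp_all add: add.commute)
  show "c - b \<in> cyc e" using exchange_pairs[OF d1] F by (simp add: replacement_ok_def)
  show "d - b \<in> cyc e" using exchange_pairs[OF d3] F F' by (simp add: replacement_ok_def)
  show "c - a \<in> cyc e" using exchange_pairs[OF d2] F F' by (simp add: replacement_ok_def)
  show "d - a \<in> cyc e" using exchange_pairs[OF d4] F F' by (simp add: replacement_ok_def)
qed

lemma F_not_cyc: "u \<in># F \<Longrightarrow> u \<notin> cyc e" "u \<in># F \<Longrightarrow> u + u \<notin> cyc e"
  using core_not_cyc[OF m_ge_3 core] core_double_not_cyc[OF m_ge_3 core] by blast+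

lemma F_cong: "u \<in># F \<Longrightarrow> v \<in># F \<Longrightarrow> u - v \<in> cyc e"
  by (rule core_cong[OF m_ge_3 core])

lemma dec_count:
  assumes d: "dec X Y Z W x P y Q z R"
  shows "size P + size Q + size R = 2 * m - 2"
    "count (pair_sums P) e + count (pair_sums Q) e + count (pair_sums R) e + (if x + y + z = e then 1 else 0) = m - 1"
proof -
  have "size W = 2 * m - 1" by (rule core_size[OF m_ge_3 core])
  then show "size P + size Q + size R = 2 * m - 2" using d by (simp add: dec_def)
  have "count W e = m - 1" by (rule core_count[OF m_ge_3 core])
  then show "count (pair_sums P) e + count (pair_sums Q) e + count (pair_sums R) e + (if x + y + z = e then 1 else 0) = m - 1"
    using d by (auto simp: dec_def)
qed

text \<open>With x + x = e every pair contains x. Two pairs with sums other than e would put x - c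
  into the subgroup of e, hence also x + c = e - (x - c), which is impossible in
  \<open>F\<close>.\<close>

lemma core_triple_class_double:
  assumes d: "dec X Y Z W x P y Q z R" and T: "x + y + z = e" and xx: "x + x = e"
  shows "(\<forall>a b. (a, b) \<in># P \<longrightarrow> a = x \<and> b = x) \<or>
    (\<exists>c P'. x + c \<noteq> e \<and> dec X Y Z W x (add_mset (x, c) P') y Q z R \<and> size P = size P' + 1 \<and> (\<forall>a b. (a, b) \<in># P' \<longrightarrow> a = x \<and> b = x))"
proof -
  have xe: "x + c = e \<longleftrightarrow> c = x" for c using xx by (metis add_left_cancel)
  have pair: "a + b = e \<Longrightarrow> a = x \<and> b = x" "a + b \<noteq> e \<Longrightarrow> a = x \<or> b = x" if "(a, b) \<in># P" for a b
    using core_triple_pair[OF d T that] by (auto simp: xe)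
  have two: False if sub: "{#(a, b), (c, d)#} \<subseteq># P" and F: "a + b \<noteq> e" "c + d \<noteq> e" for a b c d
  proof -
    have in_P: "(a, b) \<in># P" "(c, d) \<in># P" using sub by (auto dest: mset_subset_eqD)
    have key: False if "x - b' \<in> cyc e" "x + b' \<in># F" for b'
    proof -
      have "e - (x - b') \<in> cyc e" by (rule cyc_diff[OF cyc_self that(1)])
      moreover have "e - (x - b') = x + b'" using xx by (auto simp: algebra_simps)
      ultimately show False using F_not_cyc(1) that(2) by simp
    qed
    have "a = x \<or> b = x" "c = x \<or> d = x" using pair in_P F by blast+
    moreover have "a + b \<in># F" using in_F(2)[OF d] in_P F by blast
    ultimately show False
      using key[of a] key[of b] cross_cong[OF d sub F] by (auto simp: add.commute)
  qed
  show ?thesis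
  proof (cases "\<forall>a b. (a, b) \<in># P \<longrightarrow> a + b = e")
    case True
    then have "\<forall>a b. (a, b) \<in># P \<longrightarrow> a = x \<and> b = x" using pair(1) by blast
    then show ?thesis by (rule disjI1)
  next
    case False
    then obtain a b where ab: "(a, b) \<in># P" "a + b \<noteq> e" by blast
    define P' where "P' = P - {#(a, b)#}"
    have P: "P = add_mset (a, b) P'" using ab by (simp add: P'_def)
    have rest: "\<forall>c d. (c, d) \<in># P' \<longrightarrow> c = x \<and> d = x"
    proof (intro allI impI, rule ccontr)
      fix c d assume cd: "(c, d) \<in># P'" "\<not> (c = x \<and> d = x)"
      then have "(c, d) \<in># P" by (simp add: P)
      then have "c + d \<noteq> e" using pair(1)[of c d] cd(2) by blast
      moreover have "{#(a, b), (c, d)#} \<subseteq># P" using cd(1) by (simp add: P)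
      ultimately show False using two ab(2) by blast
    qed
    have "\<exists>c. x + c \<noteq> e \<and> dec X Y Z W x (add_mset (x, c) P') y Q z R"
      using pair(2)[OF ab]
    proof
      assume "a = x" then show ?thesis using d ab P by blast
    next
      assume "b = x"
      then have "dec X Y Z W x (add_mset (x, a) P') y Q z R" using pair_flip[OF d ab(1)] by (simp add: P'_def)
      then show ?thesis using ab \<open>b = x\<close> by (auto simp: add.commute)
    qed
    then show ?thesis using rest P by auto
  qed
qed

text \<open>Every pair is (x, x) or (e - x, e - x). If both kinds occurred, e - 2x and hence 2x
  would lie in the subgroup of e, although 2x belongs to \<open>F\<close>.\<close>

lemma core_triple_class_other:
  assumes d: "dec X Y Z W x P y Q z R" and T: "x + y + z = e" and xx: "x + x \<noteq> e"
  shows "\<exists>u. (u = x \<or> u = e - x) \<and> (\<forall>a b. (a, b) \<in># P \<longrightarrow> a = u \<and> b = u \<and> a + b \<noteq> e)"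
proof -
  have pair: "a + b \<noteq> e \<and> (a = x \<and> b = x \<or> a = e - x \<and> b = e - x)" if ab: "(a, b) \<in># P" for a b
  proof -
    have ne: "a + b \<noteq> e" using core_triple_pair(1)[OF d T ab] xx by auto
    have "x + c = e \<longleftrightarrow> c = e - x" for c by (auto simp: algebra_simps)
    moreover have "x \<noteq> e - x" using xx by (auto simp: algebra_simps)
    moreover have "a = x \<or> x + b = e" "b = x \<or> x + a = e" using core_triple_pair(2)[OF d T ab ne] by simp_all
    ultimately show ?thesis using ne by metis
  qed
  have mixed: False if "(x, x) \<in># P" "(e - x, e - x) \<in># P"
  proof -
    have "x \<noteq> e - x" using xx by (auto simp: algebra_simps)
    then have sub: "{#(x, x), (e - x, e - x)#} \<subseteq># P" using that by (simp add: insert_subset_eq_iff in_diff_count)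
    have "e - x - x \<in> cyc e" by (rule cross_cong(1)[OF d sub]) (use pair that in blast)+
    then have "e - (e - x - x) \<in> cyc e" by (rule cyc_diff[OF cyc_self])
    then have "x + x \<in> cyc e" by (simp add: algebra_simps)
    moreover have "x + x \<in># F" by (rule in_F(2)[OF d]) (use pair that in blast)+
    ultimately show False using F_not_cyc(1) by blast
  qed
  show ?thesis
  proof (cases "(x, x) \<in># P")
    case True
    then show ?thesis using pair mixed by (intro exI[of _ x]) blast
  next
    case False
    then show ?thesis using pair by (intro exI[of _ "e - x"]) blast
  qed
qed

lemma core_triple_class_count:
  assumes d: "dec X Y Z W x P y Q z R" and T: "x + y + z = e"
  shows "x + x = e \<Longrightarrow> size P \<le> count (pair_sums P) e + 1" "x + x \<noteq> e \<Longrightarrow> count (pair_sums P) e = 0"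
proof -
  assume xx: "x + x = e"
  have const: "count (pair_sums P') e = size P'" if "\<forall>a b. (a, b) \<in># P' \<longrightarrow> a = x \<and> b = x" for P'
  proof -
    have "pair_sums P' = replicate_mset (size P') e" using that xx by (intro pair_sums_const) auto
    then show ?thesis by simp
  qed
  from core_triple_class_double[OF d T xx] show "size P \<le> count (pair_sums P) e + 1"
  proof
    assume all: "\<forall>a b. (a, b) \<in># P \<longrightarrow> a = x \<and> b = x"
    from const[OF all] show ?thesis by simp
  next
    assume "\<exists>c P'. x + c \<noteq> e \<and> dec X Y Z W x (add_mset (x, c) P') y Q z R \<and> size P = size P' + 1 \<and> (\<forall>a b. (a, b) \<in># P' \<longrightarrow> a = x \<and> b = x)"
    then obtain c P' where c: "dec X Y Z W x (add_mset (x, c) P') y Q z R" "size P = size P' + 1" "\<forall>a b. (a, b) \<in># P' \<longrightarrow> a = x \<and> b = x"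
      by blast
    have "pair_sums P = add_mset (x + c) (pair_sums P')" using c(1) d by (simp add: dec_def)
    then show ?thesis using const[OF c(3)] c(2) by simp
  qed
next
  assume "x + x \<noteq> e"
  then show "count (pair_sums P) e = 0"
    using core_triple_class_other[OF d T] by (intro pair_sums_avoid) blast
qed

text \<open>Doubling x + y + z = e gives z + z = 0, so the pairs in the third class have sum 0 or
  2e; but their sums belong to \<open>F\<close>. Counting shows that such pairs exist.\<close>

lemma core_triple_two_doubles:
  assumes d: "dec X Y Z W x P y Q z R" and T: "x + y + z = e"
    and xx: "x + x = e" and yy: "y + y = e" and zz: "z + z \<noteq> e"
  shows False
proof -
  interpret Y: class_triple m W e F Y X Z by (rule perm(1))
  interpret XZ: class_triple m W e F X Z Y by (rule perm(2))
  interpret Z: class_triple m W e F Z X Y by (rule XZ.perm(1))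
  have dY: "dec Y X Z W y Q x P z R" by (rule dec_perm(1)[OF d])
  have dZ: "dec Z X Y W z R x P y Q" by (rule dec_perm(1)[OF dec_perm(2)[OF d]])
  have T': "y + x + z = e" "z + x + y = e" using T by (simp_all add: ac_simps)
  have "R \<noteq> {#}"
    using dec_count[OF d] T core_triple_class_count(1)[OF d T xx] Y.core_triple_class_count(1)[OF dY T'(1) yy] Z.core_triple_class_count(2)[OF dZ T'(2) zz] m_ge_4
    by auto
  then obtain a b where ab: "(a, b) \<in># R" by (metis multiset_nonemptyE surj_pair)
  obtain u where u: "u = z \<or> u = e - z" "\<forall>a b. (a, b) \<in># R \<longrightarrow> a = u \<and> b = u \<and> a + b \<noteq> e"
    using Z.core_triple_class_other[OF dZ T'(2) zz] by blast
  then have "u + u \<in># F" using Z.in_F(2)[OF dZ ab] ab by auto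
  have "(x + x) + (y + y) + (z + z) = e + e" using T by (simp flip: T add: ac_simps)
  then have z0: "z + z = 0" unfolding xx yy by simp
  have "u + u \<in> cyc e"
  proof (cases "u = z")
    case False
    then have "u + u = e + e - (z + z)" using u by (simp add: algebra_simps)
    then show ?thesis using z0 by (simp add: cyc_add)
  qed (simp add: z0)
  then show False using F_not_cyc(1) \<open>u + u \<in># F\<close> by blast
qed

text \<open>Swapping y with s = e - y keeps the block sums, but the triple sum becomes 2s, which is
  not e. Exchanging x and c then gives c - x in the subgroup of e, hence also x + c = e + (c -
  x).\<close>

lemma core_triple_exclude:
  assumes d: "dec X Y Z W x (add_mset (x, c) P) y Q z R" and T: "x + y + z = e"
    and xx: "x + x = e" and xc: "x + c \<noteq> e" and s: "(e - y, e - y) \<in># Q" "(e - y) + (e - y) \<noteq> e"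
  shows False
proof -
  interpret Y: class_triple m W e F Y X Z by (rule perm(1))
  define s where "s = e - y"
  have dY: "dec Y X Z W y Q x (add_mset (x, c) P) z R" by (rule dec_perm(1)[OF d])
  have sxz: "s + x + z = s + s" "y + s = e" "y + x + z = e" using T by (auto simp: s_def algebra_simps)
  have "{#y + x + z, s + s#} = {#s + x + z, y + s#}" unfolding sxz by (simp add: add_mset_commute)
  from Y.exchange_triple(3)[OF dY s(1)[folded s_def] this]
  have dY': "dec Y X Z W s (add_mset (y, s) (Q - {#(s, s)#})) x (add_mset (x, c) P) z R" .
  have d': "dec X Y Z W x (add_mset (c, x) P) s (add_mset (y, s) (Q - {#(s, s)#})) z R"
    by (rule dec_flip[OF dec_perm(1)[OF dY']])
  have "replacement_ok e (x + s + z) (c + x) (c + s + z)"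
    using exchange_triple(1)[OF d', of c x] by simp
  moreover have "x + s + z = s + s" unfolding sxz(1)[symmetric] by (simp add: ac_simps)
  then have "x + s + z \<noteq> e" using s(2) unfolding s_def[symmetric] by (rule ssubst)
  moreover have "c + x \<noteq> e" using xc by (simp add: add.commute)
  ultimately have "c + s + z - (x + s + z) \<in> cyc e" by (simp add: replacement_ok_def)
  then have "e + (c - x) \<in> cyc e" by (intro cyc_add) (simp_all add: algebra_simps)
  moreover have "e + (c - x) = x + c" by (simp add: algebra_simps flip: xx)
  moreover have "x + c \<in># F" using in_F(2)[OF d, of x c] xc by simp
  ultimately show False using F_not_cyc(1) by simp
qed

lemma count_class:
  assumes d: "dec X Y Z W x P y Q z R" and const: "\<forall>a b. (a, b) \<in># P \<longrightarrow> a = u \<and> b = u"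
  shows "count (X + Y + Z) u \<ge> 2 * size P + (if x = u then 1 else 0)"
proof -
  have "pairs P = replicate_mset (2 * size P) u" by (rule pairs_const) (use const in blast)
  then show ?thesis using d by (simp add: dec_def)
qed

text \<open>From e - z = x + y follows 2(e - z) = e + 2y, so \<open>F\<close> consists of copies of
  2y and e + 2y. The sum of \<open>W\<close> allows only one copy of the latter; thus m - 1 pairs
  are (y, y), and the triple contains one more y.\<close>

lemma core_triple_mixed:
  assumes d: "dec X Y Z W x P y Q z R" and T: "x + y + z = e"
    and xx: "x + x = e" and zz: "z + z \<noteq> e" and ne: "Q \<noteq> {#}" "R \<noteq> {#}"
    and Q: "\<forall>a b. (a, b) \<in># Q \<longrightarrow> a = y \<and> b = y \<and> a + b \<noteq> e"
    and R: "\<forall>a b. (a, b) \<in># R \<longrightarrow> a = e - z \<and> b = e - z \<and> a + b \<noteq> e"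
  shows "count (X + Y + Z) y \<ge> 2 * m - 1"
proof -
  obtain a b where ab: "(a, b) \<in># R" using ne(2) by (metis multiset_nonemptyE surj_pair)
  then have "a = e - z \<and> b = e - z \<and> a + b \<noteq> e" using R by blast
  then have s: "(e - z, e - z) \<in># R" "(e - z) + (e - z) \<noteq> e" using ab by metis+
  have T': "x + z + y = e" using T by (simp add: ac_simps)
  have P: "\<forall>a b. (a, b) \<in># P \<longrightarrow> a = x \<and> b = x"
    using core_triple_class_double[OF d T xx]
  proof
    assume "\<exists>c P'. x + c \<noteq> e \<and> dec X Y Z W x (add_mset (x, c) P') y Q z R \<and> size P = size P' + 1 \<and> (\<forall>a b. (a, b) \<in># P' \<longrightarrow> a = x \<and> b = x)"
    then obtain c P' where c: "x + c \<noteq> e" "dec X Y Z W x (add_mset (x, c) P') y Q z R" by blast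
    interpret XZ: class_triple m W e F X Z Y by (rule perm(2))
    show ?thesis using XZ.core_triple_exclude[OF dec_perm(2)[OF c(2)] T' xx c(1) s] by blast
  qed
  define k where "k = size Q"
  define l where "l = size R"
  have sums: "pair_sums P = replicate_mset (size P) e" "pair_sums Q = replicate_mset k (y + y)"
    "pair_sums R = replicate_mset l ((e - z) + (e - z))"
    unfolding k_def l_def using P Q R xx by (intro pair_sums_const; blast)+
  obtain a b where "(a, b) \<in># Q" using ne(1) by (metis multiset_nonemptyE surj_pair)
  then have yy: "y + y \<noteq> e" using Q by auto
  have counts: "size P + k + l = 2 * m - 2" "size P + 1 = m - 1"
    using dec_count[OF d] T yy s(2) by (simp_all add: sums k_def l_def)
  then have kl: "k + l = m" using m_ge_4 by simp
  have "k > 0" "l > 0" using ne by (simp_all add: k_def l_def nonempty_has_size)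
  have v: "(e - z) + (e - z) = e + (y + y)"
  proof -
    have "e - z = x + y" by (simp flip: T)
    then show ?thesis using xx by (simp add: ac_simps)
  qed
  have W_eq: "W = replicate_mset (m - 1) e + (replicate_mset k (y + y) + replicate_mset l ((e - z) + (e - z)))"
    using d T sums counts(2)[symmetric] by (simp add: dec_def)
  then have F: "F = replicate_mset k (y + y) + replicate_mset l (e + (y + y))"
    using core_W[OF m_ge_3 core] unfolding v by simp
  have yW: "y + y \<in># W" using \<open>k > 0\<close> by (simp add: W_eq)
  have "nmul (m - 1) e + (nmul k (y + y) + nmul l (e + (y + y))) = 0"
    using core_sum[OF m_ge_3 core] by (simp only: F sum_mset.union)
  then have "nmul (m - 1 + l) e + nmul (k + l) (y + y) = 0"
    by (simp only: nmul_plus nmul_add ac_simps)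
  then have zero: "nmul (m - 1 + l) e = 0" using core_nmul[OF m_ge_3 core yW] by (simp only: kl) simp
  have "m - 1 + l = m + (l - 1)" using \<open>l > 0\<close> m_ge_4 by simp
  then have "nmul (l - 1) e = 0" using zero core_nmul[OF m_ge_3 core core_e_in[OF m_ge_3 core]] by (simp only: nmul_add) simp
  moreover have "l - 1 < m" using kl \<open>k > 0\<close> by simp
  ultimately have "l - 1 = 0" using core_nmul_e[OF m_ge_3 core] by blast
  then have "k = m - 1" using kl \<open>l > 0\<close> by simp
  interpret Y: class_triple m W e F Y X Z by (rule perm(1))
  have "count (Y + X + Z) y \<ge> 2 * size Q + (if y = y then 1 else 0)"
    by (rule Y.count_class[OF dec_perm(1)[OF d]]) (use Q in blast)
  then show ?thesis using \<open>k = m - 1\<close> m_ge_4 by (simp add: k_def)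
qed

text \<open>If all pairs in \<open>P\<close> are (x, x), there are m - 2 of them and m pairs of
  equal elements remain in \<open>Q\<close>. Otherwise \<open>Q\<close> has at least m - 1 pairs,
  and \<open>core_triple_exclude\<close> shows that they repeat y, so the triple supplies the
  missing copy.\<close>

lemma core_triple_one_double_empty:
  assumes d: "dec X Y Z W x P y Q z R" and T: "x + y + z = e"
    and xx: "x + x = e" and yy: "y + y \<noteq> e" and R: "R = {#}"
  shows "\<exists>g. count (X + Y + Z) g \<ge> 2 * m - 1"
proof -
  interpret Y: class_triple m W e F Y X Z by (rule perm(1))
  have dY: "dec Y X Z W y Q x P z R" by (rule dec_perm(1)[OF d])
  have T': "y + x + z = e" using T by (simp add: ac_simps)
  obtain u where u: "u = y \<or> u = e - y" and Q: "\<forall>a b. (a, b) \<in># Q \<longrightarrow> a = u \<and> b = u \<and> a + b \<noteq> e"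
    using Y.core_triple_class_other[OF dY T' yy] by blast
  have Q': "\<forall>a b. (a, b) \<in># Q \<longrightarrow> a = u \<and> b = u" using Q by blast
  have cY: "count (X + Y + Z) u \<ge> 2 * size Q + (if y = u then 1 else 0)"
    using Y.count_class[OF dY Q'] by (simp add: add.commute[of Y X])
  have cQ: "count (pair_sums Q) e = 0" using Y.core_triple_class_count(2)[OF dY T' yy] .
  have cP: "count (pair_sums P) e + 1 = m - 1" using dec_count(2)[OF d] T cQ R by simp
  have sz: "size P + size Q = 2 * m - 2" using dec_count(1)[OF d] R by simp
  from core_triple_class_double[OF d T xx] show ?thesis
  proof
    assume P: "\<forall>a b. (a, b) \<in># P \<longrightarrow> a = x \<and> b = x"
    then have "pair_sums P = replicate_mset (size P) e" using xx by (intro pair_sums_const) auto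
    then have "size P + 1 = m - 1" using cP by simp
    then have "2 * size Q \<ge> 2 * m - 1" using sz m_ge_4 by linarith
    then show ?thesis using cY by (intro exI[of _ u]) linarith
  next
    assume "\<exists>c P'. x + c \<noteq> e \<and> dec X Y Z W x (add_mset (x, c) P') y Q z R \<and> size P = size P' + 1 \<and> (\<forall>a b. (a, b) \<in># P' \<longrightarrow> a = x \<and> b = x)"
    then obtain c P' where c: "x + c \<noteq> e" "dec X Y Z W x (add_mset (x, c) P') y Q z R" "size P = size P' + 1"
      "\<forall>a b. (a, b) \<in># P' \<longrightarrow> a = x \<and> b = x" by blast
    have "size P \<le> count (pair_sums P) e + 1" by (rule core_triple_class_count(1)[OF d T xx])
    then have sQ: "size Q + 1 \<ge> m" using cP sz m_ge_4 by linarith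
    then have "Q \<noteq> {#}" using m_ge_4 by auto
    then obtain a b where ab: "(a, b) \<in># Q" by (metis multiset_nonemptyE surj_pair)
    have "u \<noteq> e - y"
    proof
      assume "u = e - y"
      moreover have "a = u \<and> b = u \<and> a + b \<noteq> e" using ab Q by blast
      ultimately have "(e - y, e - y) \<in># Q" "(e - y) + (e - y) \<noteq> e" using ab by metis+
      then show False using core_triple_exclude[OF c(2) T xx c(1)] by blast
    qed
    then have "u = y" using u by blast
    then have "count (X + Y + Z) u \<ge> 2 * size Q + 1" using cY by simp
    then show ?thesis using sQ by (intro exI[of _ u]) linarith
  qed
qed

text \<open>Here 2y + 2z = e. If the pairs of both classes repeat the triple elements, or both their
  complements, then 2u + 2v lies in the subgroup of e; so does 2u - 2v, hence also 4u, which is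
  excluded. The mixed cases are \<open>core_triple_mixed\<close>.\<close>

lemma core_triple_one_double:
  assumes d: "dec X Y Z W x P y Q z R" and T: "x + y + z = e"
    and xx: "x + x = e" and yy: "y + y \<noteq> e" and zz: "z + z \<noteq> e"
  shows "\<exists>g. count (X + Y + Z) g \<ge> 2 * m - 1"
proof -
  interpret Y: class_triple m W e F Y X Z by (rule perm(1))
  interpret XZ: class_triple m W e F X Z Y by (rule perm(2))
  interpret Z: class_triple m W e F Z X Y by (rule XZ.perm(1))
  have dY: "dec Y X Z W y Q x P z R" by (rule dec_perm(1)[OF d])
  have dXZ: "dec X Z Y W x P z R y Q" by (rule dec_perm(2)[OF d])
  have dZ: "dec Z X Y W z R x P y Q" by (rule dec_perm(1)[OF dXZ])
  have T': "y + x + z = e" "x + z + y = e" "z + x + y = e" using T by (simp_all add: ac_simps)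
  have XZY: "X + Z + Y = X + Y + Z" by (simp add: ac_simps)
  show ?thesis
  proof (cases "Q = {#} \<or> R = {#}")
    case True
    then show ?thesis
      using core_triple_one_double_empty[OF d T xx yy] XZ.core_triple_one_double_empty[OF dXZ T'(2) xx zz] unfolding XZY by blast
  next
    case False
    then have ne: "Q \<noteq> {#}" "R \<noteq> {#}" by auto
    obtain u where u: "u = y \<or> u = e - y" and Q: "\<forall>a b. (a, b) \<in># Q \<longrightarrow> a = u \<and> b = u \<and> a + b \<noteq> e"
      using Y.core_triple_class_other[OF dY T'(1) yy] by blast
    obtain v where v: "v = z \<or> v = e - z" and R: "\<forall>a b. (a, b) \<in># R \<longrightarrow> a = v \<and> b = v \<and> a + b \<noteq> e"
      using Z.core_triple_class_other[OF dZ T'(3) zz] by blast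
    obtain a b where ab: "(a, b) \<in># Q" using ne(1) by (metis multiset_nonemptyE surj_pair)
    have uF: "u + u \<in># F" using Y.in_F(2)[OF dY ab] Q ab by auto
    obtain c d where cd: "(c, d) \<in># R" using ne(2) by (metis multiset_nonemptyE surj_pair)
    have vF: "v + v \<in># F" using Z.in_F(2)[OF dZ cd] R cd by auto
    have yz: "(y + y) + (z + z) = e"
    proof -
      have "(x + x) + ((y + y) + (z + z)) = e + e" by (simp flip: T add: ac_simps)
      then show ?thesis unfolding xx by simp
    qed
    have same: False if "(u + u) + (v + v) \<in> cyc e"
    proof -
      have "((u + u) + (v + v)) + ((u + u) - (v + v)) \<in> cyc e" using that F_cong[OF uF vF] by (rule cyc_add)
      then have "(u + u) + (u + u) \<in> cyc e" by (simp add: algebra_simps)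
      then show False using F_not_cyc(2)[OF uF] by blast
    qed
    show ?thesis
    proof (cases "u = y"; cases "v = z")
      assume "u = y" "v = z" then show ?thesis using same yz by simp
    next
      assume "u = y" "v \<noteq> z"
      then have "v = e - z" using v by blast
      then show ?thesis using core_triple_mixed[OF d T xx zz ne] Q R \<open>u = y\<close> by blast
    next
      assume "u \<noteq> y" "v = z"
      then have "u = e - y" using u by blast
      then show ?thesis using XZ.core_triple_mixed[OF dXZ T'(2) xx yy ne(2,1)] Q R \<open>v = z\<close> unfolding XZY by blast
    next
      assume "u \<noteq> y" "v \<noteq> z"
      then have "u = e - y" "v = e - z" using u v by auto
      then have "(u + u) + (v + v) = e + e + (e + e) - ((y + y) + (z + z))" by (simp add: algebra_simps)
      also have "\<dots> \<in> cyc e" unfolding yz by (intro cyc_add cyc_diff cyc_self)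
      finally show ?thesis using same by blast
    qed
  qed
qed

text \<open>Exactly m - 2 of the 2m - 2 pairs have sum e. If all of 2x, 2y, 2z are e, at most three
  pairs have another sum; if none is, no pair has sum e. Both contradict m >= 4.\<close>

lemma core_triple:
  assumes d: "dec X Y Z W x P y Q z R" and T: "x + y + z = e"
  shows "\<exists>g. count (X + Y + Z) g \<ge> 2 * m - 1"
proof -
  interpret Y: class_triple m W e F Y X Z by (rule perm(1))
  interpret XZ: class_triple m W e F X Z Y by (rule perm(2))
  interpret Z: class_triple m W e F Z X Y by (rule XZ.perm(1))
  interpret YZ: class_triple m W e F Y Z X by (rule Y.perm(2))
  have dY: "dec Y X Z W y Q x P z R" by (rule dec_perm(1)[OF d])
  have dXZ: "dec X Z Y W x P z R y Q" by (rule dec_perm(2)[OF d])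
  have dZ: "dec Z X Y W z R x P y Q" by (rule dec_perm(1)[OF dXZ])
  have dYZ: "dec Y Z X W y Q z R x P" by (rule dec_perm(2)[OF dY])
  have T': "y + x + z = e" "x + z + y = e" "z + x + y = e" "y + z + x = e" using T by (simp_all add: ac_simps)
  have perms: "Y + X + Z = X + Y + Z" "X + Z + Y = X + Y + Z" "Z + X + Y = X + Y + Z" by (simp_all add: ac_simps)
  note count = dec_count[OF d] core_triple_class_count[OF d T] Y.core_triple_class_count[OF dY T'(1)] Z.core_triple_class_count[OF dZ T'(3)]
  consider "x + x = e" "y + y = e" "z + z = e" | "x + x = e" "y + y = e" "z + z \<noteq> e"
    | "x + x = e" "y + y \<noteq> e" "z + z = e" | "x + x \<noteq> e" "y + y = e" "z + z = e"
    | "x + x = e" "y + y \<noteq> e" "z + z \<noteq> e" | "x + x \<noteq> e" "y + y = e" "z + z \<noteq> e"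
    | "x + x \<noteq> e" "y + y \<noteq> e" "z + z = e" | "x + x \<noteq> e" "y + y \<noteq> e" "z + z \<noteq> e" by blast
  then show ?thesis
  proof cases
    case 1 then show ?thesis using count T m_ge_4 by simp
  next
    case 2 then show ?thesis using core_triple_two_doubles[OF d T] by blast
  next
    case 3 then show ?thesis using XZ.core_triple_two_doubles[OF dXZ T'(2)] by blast
  next
    case 4 then show ?thesis using YZ.core_triple_two_doubles[OF dYZ T'(4)] by blast
  next
    case 5 then show ?thesis using core_triple_one_double[OF d T] by blast
  next
    case 6 then show ?thesis using Y.core_triple_one_double[OF dY T'(1)] unfolding perms by blast
  next
    case 7 then show ?thesis using Z.core_triple_one_double[OF dZ T'(3)] unfolding perms by blast
  next
    case 8 then show ?thesis using count T m_ge_4 by simp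
  qed
qed

section \<open>Block sums all of whose decompositions have triple sum different from
  \<open>e\<close>\<close>

lemma no_core_triple_pair:
  assumes no: "\<forall>x P y Q z R. dec X Y Z W x P y Q z R \<longrightarrow> x + y + z \<noteq> e"
    and d: "dec X Y Z W x P y Q z R" and ab: "(a, b) \<in># P"
  shows "a + b = e \<Longrightarrow> a = x \<and> b = x" "a + b \<noteq> e \<Longrightarrow> a - x \<in> cyc e \<and> b - x \<in> cyc e"
proof -
  have T: "x + y + z \<noteq> e" by (rule no[rule_format, OF d])
  have eq1: "a' = x" if ab': "(a', b') \<in># P'" and d': "dec X Y Z W x P' y Q z R" and e: "a' + b' = e" for a' b' P'
  proof -
    have "x + b' = e \<or> x + b' = x + y + z"
      using exchange_triple(2)[OF d' ab'] T e by (simp add: replacement_ok_def)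
    then show ?thesis
    proof
      assume "x + b' = e" then show ?thesis using e by (metis add_right_cancel)
    next
      \<comment> \<open>In this case the swap would keep the block sums and produce a triple with
        sum e.\<close>
      assume b': "x + b' = x + y + z"
      then have "b' = y + z" by (simp add: add.assoc)
      then have e': "a' + y + z = e" using e by (simp add: add.assoc)
      have "dec X Y Z W a' (add_mset (x, b') (P' - {#(a', b')#})) y Q z R"
        by (rule exchange_triple(3)[OF d' ab']) (simp add: b' e e' add_mset_commute)
      then show ?thesis using no e' by blast
    qed
  qed
  have eq2: "a' - x \<in> cyc e" if ab': "(a', b') \<in># P'" and d': "dec X Y Z W x P' y Q z R" and e: "a' + b' \<noteq> e" for a' b' P'
  proof -
    have "a' + y + z - (x + y + z) \<in> cyc e"
      using exchange_triple(1)[OF d' ab'] T e by (simp add: replacement_ok_def)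
    then show ?thesis by simp
  qed
  have fl: "(b, a) \<in># add_mset (b, a) (P - {#(a, b)#})" by simp
  show "a = x \<and> b = x" if "a + b = e"
    using eq1[OF ab d that] eq1[OF fl pair_flip[OF d ab]] that by (simp add: add.commute)
  show "a - x \<in> cyc e \<and> b - x \<in> cyc e" if "a + b \<noteq> e"
    using eq2[OF ab d that] eq2[OF fl pair_flip[OF d ab]] that by (simp add: add.commute)
qed

text \<open>Exchanging between (x, x) and a pair (c, d) with another sum forces c = x or d = x. Then
  c + d is e plus an element of the subgroup of e, although it belongs to \<open>F\<close>.\<close>

lemma no_core_triple_unmixed:
  assumes no: "\<forall>x P y Q z R. dec X Y Z W x P y Q z R \<longrightarrow> x + y + z \<noteq> e"
    and d: "dec X Y Z W x P y Q z R" and ee: "(a, b) \<in># P" "a + b = e" and cd: "(c, d) \<in># P"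
  shows "c = x \<and> d = x"
proof (rule ccontr)
  assume "\<not> ?thesis"
  then have ne: "c + d \<noteq> e" using no_core_triple_pair(1)[OF no d cd] by blast
  have ab: "a = x" "b = x" using no_core_triple_pair(1)[OF no d ee(1)] ee(2) by blast+
  have "(a, b) \<noteq> (c, d)" using ne ee(2) by auto
  then have "{#(a, b), (c, d)#} \<subseteq># P" using ee(1) cd
    by (simp only: insert_subset_eq_iff in_diff_count) (auto simp: in_diff_count)
  then obtain P' where "P = add_mset (x, x) (add_mset (c, d) P')" by (auto simp: mset_subset_eq_exists_conv ab)
  then have "replacement_ok e (x + x) (c + d) (x + c)" using exchange_pairs d by blast
  then have "c = x \<or> x = d" using ee(2) ab ne by (auto simp: replacement_ok_def add.commute[of _ c])
  moreover have F: "c + d \<in># F" using in_F(2)[OF d cd ne] .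
  moreover have cyc: "c - x \<in> cyc e" "d - x \<in> cyc e" using no_core_triple_pair(2)[OF no d cd] ne by blast+
  ultimately have "c + d \<in> cyc e"
  proof (elim disjE)
    assume "c = x"
    then have eq: "c + d = e + (d - x)" using ee(2) ab by (simp add: algebra_simps)
    show ?thesis unfolding eq by (rule cyc_add[OF cyc_self cyc(2)])
  next
    assume "x = d"
    then have eq: "c + d = e + (c - x)" using ee(2) ab by (simp add: algebra_simps)
    show ?thesis unfolding eq by (rule cyc_add[OF cyc_self cyc(1)])
  qed
  then show False using F F_not_cyc(1) by blast
qed

lemma no_core_triple_count:
  assumes no: "\<forall>x P y Q z R. dec X Y Z W x P y Q z R \<longrightarrow> x + y + z \<noteq> e"
    and d: "dec X Y Z W x P y Q z R"
  shows "count (pair_sums P) e = 0 \<or>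
    x + x = e \<and> count (pair_sums P) e = size P \<and> (\<forall>a b. (a, b) \<in># P \<longrightarrow> a = x \<and> b = x)"
proof (cases "\<exists>a b. (a, b) \<in># P \<and> a + b = e")
  case True
  then obtain a b where ab: "(a, b) \<in># P" "a + b = e" by blast
  then have const: "\<forall>a b. (a, b) \<in># P \<longrightarrow> a = x \<and> b = x" using no_core_triple_unmixed[OF no d ab] by blast
  moreover have xx: "x + x = e" using const ab by auto
  moreover have "pair_sums P = replicate_mset (size P) e" using const xx by (intro pair_sums_const) blast
  then have "count (pair_sums P) e = size P" by simp
  ultimately show ?thesis by blast
next
  case False
  then show ?thesis by (intro disjI1 pair_sums_avoid) blast
qed

text \<open>Modulo the subgroup of e, a pair in the third class has the sum 2z, and so has the
  triple. But doubling the triple sum gives 2z again, so 2z vanishes there, which is impossible for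
  an element of \<open>F\<close>.\<close>

lemma no_core_triple_two:
  assumes no: "\<forall>x P y Q z R. dec X Y Z W x P y Q z R \<longrightarrow> x + y + z \<noteq> e"
    and d: "dec X Y Z W x P y Q z R" and xx: "x + x = e" and yy: "y + y = e"
    and R: "R \<noteq> {#}" "count (pair_sums R) e = 0"
  shows False
proof -
  interpret XZ: class_triple m W e F X Z Y by (rule perm(2))
  interpret Z: class_triple m W e F Z X Y by (rule XZ.perm(1))
  have dZ: "dec Z X Y W z R x P y Q" by (rule dec_perm(1)[OF dec_perm(2)[OF d]])
  have noZ: "\<forall>z R x P y Q. dec Z X Y W z R x P y Q \<longrightarrow> z + x + y \<noteq> e"
    using no[rule_format, OF dec_perm(2)[OF dec_perm(1)]] by (auto simp: ac_simps)
  obtain a b where ab: "(a, b) \<in># R" using R(1) by (metis multiset_nonemptyE surj_pair)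
  have ne: "a + b \<noteq> e"
  proof
    assume "a + b = e"
    then have "e \<in># pair_sums R" using ab by (force simp: pair_sums_def)
    then show False using R(2) by (metis count_eq_zero_iff)
  qed
  have cyc: "a - z \<in> cyc e" "b - z \<in> cyc e" using Z.no_core_triple_pair(2)[OF noZ dZ ab ne] by blast+
  have F: "a + b \<in># F" "x + y + z \<in># F" using Z.in_F(2)[OF dZ ab ne] in_F(1)[OF d no[rule_format, OF d]] .
  define T where "T = x + y + z"
  have TT: "T + T = e + e + (z + z)" by (simp add: T_def ac_simps flip: xx) (simp add: yy[unfolded xx[symmetric]] add.assoc[symmetric])
  have 1: "T - (a + b) \<in> cyc e" using F_cong[OF F(2,1)] by (simp add: T_def)
  have "(T - (a + b)) + (T - (a + b)) + ((a - z) + (b - z)) - e - e \<in> cyc e"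
    by (rule cyc_diff[OF cyc_diff[OF cyc_add[OF cyc_add[OF 1 1] cyc_add[OF cyc]] cyc_self] cyc_self])
  also have "(T - (a + b)) + (T - (a + b)) + ((a - z) + (b - z)) - e - e
     = (T + T) - (e + e + (z + z)) - (a + b)" by (simp add: algebra_simps)
  also have "\<dots> = - (a + b)" unfolding TT by simp
  finally have "- (- (a + b)) \<in> cyc e" by (rule cyc_minus)
  then have "a + b \<in> cyc e" by (simp only: minus_minus)
  then show False using F(1) F_not_cyc(1) by blast
qed

text \<open>The m - 1 pairs with sum e fill exactly one class, all of them being (x, x) for the
  triple element x of that class; this makes 2(m - 1) + 1 copies.\<close>

lemma no_core_triple:
  assumes no: "\<forall>x P y Q z R. dec X Y Z W x P y Q z R \<longrightarrow> x + y + z \<noteq> e"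
    and d: "dec X Y Z W x P y Q z R"
  shows "\<exists>g. count (X + Y + Z) g \<ge> 2 * m - 1"
proof -
  interpret Y: class_triple m W e F Y X Z by (rule perm(1))
  interpret XZ: class_triple m W e F X Z Y by (rule perm(2))
  interpret Z: class_triple m W e F Z X Y by (rule XZ.perm(1))
  interpret YZ: class_triple m W e F Y Z X by (rule Y.perm(2))
  have dY: "dec Y X Z W y Q x P z R" by (rule dec_perm(1)[OF d])
  have dXZ: "dec X Z Y W x P z R y Q" by (rule dec_perm(2)[OF d])
  have dZ: "dec Z X Y W z R x P y Q" by (rule dec_perm(1)[OF dXZ])
  have dYZ: "dec Y Z X W y Q z R x P" by (rule dec_perm(2)[OF dY])
  have noY: "\<forall>y Q x P z R. dec Y X Z W y Q x P z R \<longrightarrow> y + x + z \<noteq> e"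
    using no[rule_format, OF dec_perm(1)] by (auto simp: ac_simps)
  have noXZ: "\<forall>x P z R y Q. dec X Z Y W x P z R y Q \<longrightarrow> x + z + y \<noteq> e"
    using no[rule_format, OF dec_perm(2)] by (auto simp: ac_simps)
  have noZ: "\<forall>z R x P y Q. dec Z X Y W z R x P y Q \<longrightarrow> z + x + y \<noteq> e"
    using no[rule_format, OF dec_perm(2)[OF dec_perm(1)]] by (auto simp: ac_simps)
  have noYZ: "\<forall>y Q z R x P. dec Y Z X W y Q z R x P \<longrightarrow> y + z + x \<noteq> e"
    using no[rule_format, OF dec_perm(1)[OF dec_perm(2)]] by (auto simp: ac_simps)
  have perms: "Y + X + Z = X + Y + Z" "Z + X + Y = X + Y + Z" by (simp_all add: ac_simps)
  define p q r where "p = count (pair_sums P) e" and "q = count (pair_sums Q) e" and "r = count (pair_sums R) e"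
  have sz: "size P + size Q + size R = 2 * m - 2" and ct: "p + q + r = m - 1"
    using dec_count[OF d] no[rule_format, OF d] by (simp_all add: p_def q_def r_def)
  have P: "p = 0 \<or> x + x = e \<and> p = size P \<and> (\<forall>a b. (a, b) \<in># P \<longrightarrow> a = x \<and> b = x)"
    unfolding p_def by (rule no_core_triple_count[OF no d])
  have Q: "q = 0 \<or> y + y = e \<and> q = size Q \<and> (\<forall>a b. (a, b) \<in># Q \<longrightarrow> a = y \<and> b = y)"
    unfolding q_def by (rule Y.no_core_triple_count[OF noY dY])
  have R: "r = 0 \<or> z + z = e \<and> r = size R \<and> (\<forall>a b. (a, b) \<in># R \<longrightarrow> a = z \<and> b = z)"
    unfolding r_def by (rule Z.no_core_triple_count[OF noZ dZ])
  consider "p > 0" "q > 0" | "p > 0" "r > 0" | "q > 0" "r > 0" | "p = m - 1" "p > 0" | "q = m - 1" "q > 0" | "r = m - 1" "r > 0"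
    using ct m_ge_4 by linarith
  then show ?thesis
  proof cases
    case 1
    then have "x + x = e" "y + y = e" "p = size P" "q = size Q" using P Q by auto
    moreover from this have "size R > 0" "r \<noteq> size R" using sz ct m_ge_4 by auto
    ultimately show ?thesis using no_core_triple_two[OF no d] R by (auto simp: r_def)
  next
    case 2
    then have "x + x = e" "z + z = e" "p = size P" "r = size R" using P R by auto
    moreover from this have "size Q > 0" "q \<noteq> size Q" using sz ct m_ge_4 by auto
    ultimately show ?thesis using XZ.no_core_triple_two[OF noXZ dXZ] Q by (auto simp: q_def)
  next
    case 3
    then have "y + y = e" "z + z = e" "q = size Q" "r = size R" using Q R by auto
    moreover from this have "size P > 0" "p \<noteq> size P" using sz ct m_ge_4 by auto
    ultimately show ?thesis using YZ.no_core_triple_two[OF noYZ dYZ] P by (auto simp: p_def)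
  next
    case 4
    then have "size P = m - 1" "\<forall>a b. (a, b) \<in># P \<longrightarrow> a = x \<and> b = x" using P by auto
    from count_class[OF d this(2)] this(1) have "count (X + Y + Z) x \<ge> 2 * (m - 1) + 1" by simp
    then show ?thesis using m_ge_4 by (intro exI[of _ x]) linarith
  next
    case 5
    then have "size Q = m - 1" "\<forall>a b. (a, b) \<in># Q \<longrightarrow> a = y \<and> b = y" using Q by auto
    from Y.count_class[OF dY this(2)] this(1) have "count (X + Y + Z) y \<ge> 2 * (m - 1) + 1" unfolding perms by simp
    then show ?thesis using m_ge_4 by (intro exI[of _ y]) linarith
  next
    case 6
    then have "size R = m - 1" "\<forall>a b. (a, b) \<in># R \<longrightarrow> a = z \<and> b = z" using R by auto
    from Z.count_class[OF dZ this(2)] this(1) have "count (X + Y + Z) z \<ge> 2 * (m - 1) + 1" unfolding perms by simp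
    then show ?thesis using m_ge_4 by (intro exI[of _ z]) linarith
  qed
qed

theorem large_multiplicity: "dec X Y Z W x P y Q z R \<Longrightarrow> \<exists>g. count (X + Y + Z) g \<ge> 2 * m - 1"
  using core_triple no_core_triple by blast

end

section \<open>Classes modulo \<open>H\<close> and the doubling theorem\<close>

definition blocks :: "('a \<times> 'a) multiset \<Rightarrow> 'a multiset multiset" where
  "blocks P = image_mset (\<lambda>(a, b). {#a, b#}) P"

lemma sum_blocks: "\<Sum>\<^sub># (blocks P) = pairs P"
  by (induction P) (auto simp: blocks_def)

lemma sums_blocks: "image_mset sum_mset (blocks P) = pair_sums P"
  by (induction P) (auto simp: blocks_def)

lemma empty_not_in_blocks: "{#} \<notin># blocks P"
  by (auto simp: blocks_def)

lemma size_Suc_exists: "size V = Suc k \<Longrightarrow> \<exists>v V'. V = add_mset v V' \<and> size V' = k"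
  by (metis size_eq_Suc_imp_eq_union size_add_mset nat.inject)

lemma ex_pairs: "size X = 2 * n \<Longrightarrow> \<exists>P. pairs P = X"
proof (induction n arbitrary: X)
  case 0 then show ?case by (intro exI[of _ "{#}"]) simp
next
  case (Suc n)
  then obtain a X' where a: "X = add_mset a X'" "size X' = Suc (2 * n)"
    using size_Suc_exists[of X "Suc (2 * n)"] by auto
  then obtain b X'' where b: "X' = add_mset b X''" "size X'' = 2 * n"
    using size_Suc_exists[of X' "2 * n"] by auto
  then obtain P where "pairs P = X''" using Suc.IH by blast
  then show ?case using a b by (intro exI[of _ "add_mset (a, b) P"]) simp
qed

lemma ex_dec:
  assumes "odd (size X)" "odd (size Y)" "odd (size Z)"
  shows "\<exists>W x P y Q z R. dec X Y Z W x P y Q z R"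
proof -
  have ex: "\<exists>v P. V = add_mset v (pairs P)" if "odd (size V)" for V :: "'a multiset"
  proof -
    obtain n where n: "size V = Suc (2 * n)" using \<open>odd (size V)\<close> by (auto elim!: oddE)
    then obtain v V' where "V = add_mset v V'" "size V' = 2 * n" using size_Suc_exists[of V] by blast
    then show ?thesis using ex_pairs[of V' n] by blast
  qed
  show ?thesis using ex[OF assms(1)] ex[OF assms(2)] ex[OF assms(3)] unfolding dec_def by blast
qed

context double_modulus
begin

definition rep :: "'a \<Rightarrow> int \<times> int" where "rep x = (SOME v. \<phi> v = x)"

lemma \<phi>_rep [simp]: "\<phi> (rep x) = x"
  unfolding rep_def using \<phi>_surj[of x] by (rule someI_ex)

definition odd1 :: "'a \<Rightarrow> bool" where "odd1 x \<longleftrightarrow> odd (fst (rep x))"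
definition odd2 :: "'a \<Rightarrow> bool" where "odd2 x \<longleftrightarrow> odd (snd (rep x))"

lemma parity_\<phi>: "odd1 (\<phi> v) \<longleftrightarrow> odd (fst v)" "odd2 (\<phi> v) \<longleftrightarrow> odd (snd v)"
proof -
  have "\<phi> (rep (\<phi> v) - v) = 0" by (simp add: \<phi>_diff)
  then have d: "int (2 * m) dvd fst (rep (\<phi> v) - v)" "int (2 * m) dvd snd (rep (\<phi> v) - v)"
    unfolding \<phi>_eq_0 null_mod_def by simp_all
  have two: "2 dvd int (2 * m)" by simp
  have "2 dvd fst (rep (\<phi> v)) - fst v" "2 dvd snd (rep (\<phi> v)) - snd v"
    using dvd_trans[OF two d(1)] dvd_trans[OF two d(2)] by (simp_all only: fst_diff snd_diff)
  then obtain i j where "fst (rep (\<phi> v)) - fst v = 2 * i" "snd (rep (\<phi> v)) - snd v = 2 * j" by (elim dvdE)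
  then have "fst (rep (\<phi> v)) = fst v + 2 * i" "snd (rep (\<phi> v)) = snd v + 2 * j" by simp_all
  then show "odd1 (\<phi> v) \<longleftrightarrow> odd (fst v)" "odd2 (\<phi> v) \<longleftrightarrow> odd (snd v)" by (simp_all add: odd1_def odd2_def)
qed

lemma parity_add: "odd1 (x + y) \<longleftrightarrow> odd1 x \<noteq> odd1 y" "odd2 (x + y) \<longleftrightarrow> odd2 x \<noteq> odd2 y"
proof -
  have eq: "x + y = \<phi> (rep x + rep y)" by (simp add: \<phi>_add)
  show "odd1 (x + y) \<longleftrightarrow> odd1 x \<noteq> odd1 y" "odd2 (x + y) \<longleftrightarrow> odd2 x \<noteq> odd2 y"
    unfolding eq parity_\<phi> odd1_def[of x] odd1_def[of y] odd2_def[of x] odd2_def[of y] by auto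
qed

lemma parity_0: "\<not> odd1 0" "\<not> odd2 0"
  using parity_\<phi>[of 0] by simp_all

lemma H_iff: "x \<in> H \<longleftrightarrow> \<not> odd1 x \<and> \<not> odd2 x"
proof
  assume "x \<in> H" then show "\<not> odd1 x \<and> \<not> odd2 x" by (auto simp: H_def parity_add)
next
  assume "\<not> odd1 x \<and> \<not> odd2 x"
  then obtain a b where ab: "fst (rep x) = 2 * a" "snd (rep x) = 2 * b" unfolding odd1_def odd2_def by (auto elim!: evenE)
  have "rep x = (a, b) + (a, b)" using ab by (simp add: prod_eq_iff)
  then have "x = \<phi> (a, b) + \<phi> (a, b)" by (metis \<phi>_add \<phi>_rep)
  then show "x \<in> H" by (auto simp: H_def)
qed

lemma parity_sum: "odd1 (\<Sum>\<^sub># M) \<longleftrightarrow> odd (size (filter_mset odd1 M))" "odd2 (\<Sum>\<^sub># M) \<longleftrightarrow> odd (size (filter_mset odd2 M))"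
  by (induction M) (auto simp: parity_0 parity_add)

lemma pair_sums_H: "(\<And>a b. a \<in># pairs P \<Longrightarrow> b \<in># pairs P \<Longrightarrow> a + b \<in> H) \<Longrightarrow> set_mset (pair_sums P) \<subseteq> H"
  by (force simp: pair_sums_def pairs_def)

text \<open>Elements of \<open>H\<close>, pairs from one class modulo \<open>H\<close> and triples from the three nonzero classes are
  blocks with sum in \<open>H\<close>; the maximal number of blocks is \<open>2 m - 1\<close>.\<close>

lemma classes:
  assumes S: "min_zero_sum S" and size: "size S = 4 * m - 1"
  obtains X Y Z where "S = X + Y + Z" "odd (size X)" "odd (size Y)" "odd (size Z)"
    "\<And>W x P y Q z R. dec X Y Z W x P y Q z R \<Longrightarrow> min_zero_sum W \<and> set_mset W \<subseteq> H \<and> size W = 2 * m - 1"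
proof -
  define A where "A = filter_mset (\<lambda>x. \<not> odd1 x \<and> \<not> odd2 x) S"
  define X where "X = filter_mset (\<lambda>x. odd1 x \<and> \<not> odd2 x) S"
  define Y where "Y = filter_mset (\<lambda>x. \<not> odd1 x \<and> odd2 x) S"
  define Z where "Z = filter_mset (\<lambda>x. odd1 x \<and> odd2 x) S"
  have S_eq: "S = A + (X + Y + Z)" by (rule multiset_eqI) (auto simp: A_def X_def Y_def Z_def)
  have "filter_mset odd1 S = X + Z" "filter_mset odd2 S = Y + Z"
    by (rule multiset_eqI; auto simp: X_def Y_def Z_def)+
  then have par: "even (size X + size Z)" "even (size Y + size Z)"
    using parity_sum[of S] S parity_0 by (auto simp: min_zero_sum_def)
  have H: "set_mset A \<subseteq> H" "a \<in># X \<Longrightarrow> b \<in># X \<Longrightarrow> a + b \<in> H" "a \<in># Y \<Longrightarrow> b \<in># Y \<Longrightarrow> a + b \<in> H"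
    "a \<in># Z \<Longrightarrow> b \<in># Z \<Longrightarrow> a + b \<in> H" "a \<in># X \<Longrightarrow> b \<in># Y \<Longrightarrow> c \<in># Z \<Longrightarrow> a + b + c \<in> H" for a b c
    by (auto simp: A_def X_def Y_def Z_def H_iff parity_add)
  have min: "min_zero_sum (A + W)" if d: "dec X Y Z W x P y Q z R" for W x P y Q z R
  proof -
    define \<B> where "\<B> = image_mset (\<lambda>a. {#a#}) A + add_mset {#x, y, z#} (blocks P + blocks Q + blocks R)"
    have "\<Sum>\<^sub># (image_mset (\<lambda>a. {#a#}) A) = A" "image_mset sum_mset (image_mset (\<lambda>a. {#a#}) A) = A"
      by (induction A) auto
    then have "\<Sum>\<^sub># \<B> = S" "image_mset sum_mset \<B> = A + W"
      using d unfolding \<B>_def S_eq dec_def by (simp_all add: sum_blocks sums_blocks ac_simps)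
    moreover have "{#} \<notin># \<B>" by (auto simp: \<B>_def empty_not_in_blocks)
    ultimately show ?thesis using min_zero_sum_blocks[of \<B>] S by simp
  qed
  have WH: "set_mset W \<subseteq> H" if d: "dec X Y Z W x P y Q z R" for W x P y Q z R
  proof -
    have "set_mset (pair_sums P) \<subseteq> H" "set_mset (pair_sums Q) \<subseteq> H" "set_mset (pair_sums R) \<subseteq> H"
      using d by (intro pair_sums_H H; simp add: dec_def)+
    moreover have "x + y + z \<in> H" using d by (intro H(5)) (auto simp: dec_def)
    ultimately show ?thesis using d by (auto simp: dec_def)
  qed
  \<comment> \<open>If all classes had even size, the size of \<open>A\<close> would be odd because
    4m - 1 is; singletons from \<open>A\<close> and pairs would then give at least 2m
    blocks.\<close>
  have oddX: "odd (size X)"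
  proof
    assume "even (size X)"
    then have "even (size Y)" "even (size Z)" using par by simp_all
    then obtain P Q R where PQR: "pairs P = X" "pairs Q = Y" "pairs R = Z"
      using ex_pairs[of X "size X div 2"] ex_pairs[of Y "size Y div 2"] ex_pairs[of Z "size Z div 2"] \<open>even (size X)\<close> by auto
    define \<B> where "\<B> = image_mset (\<lambda>a. {#a#}) A + (blocks P + blocks Q + blocks R)"
    have "\<Sum>\<^sub># (image_mset (\<lambda>a. {#a#}) A) = A" "image_mset sum_mset (image_mset (\<lambda>a. {#a#}) A) = A"
      by (induction A) auto
    then have "\<Sum>\<^sub># \<B> = S" and sums: "image_mset sum_mset \<B> = A + (pair_sums P + pair_sums Q + pair_sums R)"
      unfolding \<B>_def S_eq by (simp_all add: sum_blocks sums_blocks PQR)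
    moreover have "{#} \<notin># \<B>" by (auto simp: \<B>_def empty_not_in_blocks)
    ultimately have 1: "min_zero_sum (A + (pair_sums P + pair_sums Q + pair_sums R))"
      using min_zero_sum_blocks[of \<B>] S by simp
    have "set_mset (pair_sums P) \<subseteq> H" "set_mset (pair_sums Q) \<subseteq> H" "set_mset (pair_sums R) \<subseteq> H"
      by (intro pair_sums_H H; simp add: PQR)+
    then have "size (A + (pair_sums P + pair_sums Q + pair_sums R)) \<le> 2 * m - 1"
      using H(1) by (intro size_le_H 1) auto
    moreover have "size A + 2 * size P + 2 * size Q + 2 * size R = 4 * m - 1"
      using size unfolding S_eq PQR[symmetric] by simp
    ultimately show False using m_ge_2 by simp
  qed
  then have odd: "odd (size Y)" "odd (size Z)" using par by simp_all
  have ex: "\<exists>W x P y Q z R. dec X Y Z W x P y Q z R" by (rule ex_dec[OF oddX odd])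
  \<comment> \<open>The number of blocks is 2m - 1 plus half the size of \<open>A\<close>, and it is
    at most 2m - 1.\<close>
  have "A = {#}"
  proof -
    obtain W x P y Q z R where d: "dec X Y Z W x P y Q z R" using ex by blast
    have "size (A + W) \<le> 2 * m - 1" using min[OF d] WH[OF d] H(1) by (intro size_le_H) auto
    moreover have "size A + 3 + 2 * size P + 2 * size Q + 2 * size R = 4 * m - 1"
      using size d unfolding S_eq dec_def by simp
    moreover have "size (A + W) = size A + 1 + size P + size Q + size R" using d by (simp add: dec_def)
    ultimately have "size A = 0" using m_ge_2 by linarith
    then show ?thesis by simp
  qed
  have "min_zero_sum W \<and> set_mset W \<subseteq> H \<and> size W = 2 * m - 1" if d: "dec X Y Z W x P y Q z R" for W x P y Q z R
  proof -
    have "3 + 2 * size P + 2 * size Q + 2 * size R = 4 * m - 1"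
      using size d \<open>A = {#}\<close> unfolding S_eq dec_def by simp
    then have "size W = 2 * m - 1" using d unfolding dec_def by simp
    then show ?thesis using min[OF d] WH[OF d] \<open>A = {#}\<close> by simp
  qed
  then show ?thesis using that[of X Y Z] S_eq \<open>A = {#}\<close> oddX odd by simp
qed

theorem ex_count_ge:
  fixes S :: "'a multiset"
  assumes S: "min_zero_sum S" and size: "size S = 4 * m - 1" and m: "m \<ge> 4"
  shows "\<exists>g. count S g \<ge> 2 * m - 1"
proof -
  obtain X Y Z where S_eq: "S = X + Y + Z" and odd: "odd (size X)" "odd (size Y)" "odd (size Z)"
    and dec: "\<And>W x P y Q z R. dec X Y Z W x P y Q z R \<Longrightarrow> min_zero_sum W \<and> set_mset W \<subseteq> H \<and> size W = 2 * m - 1"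
    using classes[OF S size] by metis
  define \<W> where "\<W> = {W. \<exists>x P y Q z R. dec X Y Z W x P y Q z R}"
  have "cored m W" if W: "W \<in> \<W>" for W
  proof -
    obtain x P y Q z R where "dec X Y Z W x P y Q z R" using W unfolding \<W>_def by blast
    from dec[OF this] show ?thesis using core_exists[of W] core_exists'[of W] by (simp add: cored_def)
  qed
  moreover have "\<W> \<noteq> {}" using ex_dec[OF odd] by (auto simp: \<W>_def)
  ultimately obtain W e F where W: "W \<in> \<W>" "core m W e F"
    and repl: "\<And>\<sigma>\<^sub>1 \<sigma>\<^sub>2 \<tau>\<^sub>1 \<tau>\<^sub>2 C. W = add_mset \<sigma>\<^sub>1 (add_mset \<sigma>\<^sub>2 C) \<Longrightarrow> add_mset \<tau>\<^sub>1 (add_mset \<tau>\<^sub>2 C) \<in> \<W> \<Longrightarrow>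
       \<sigma>\<^sub>1 + \<sigma>\<^sub>2 = \<tau>\<^sub>1 + \<tau>\<^sub>2 \<Longrightarrow> replacement_ok e \<sigma>\<^sub>1 \<sigma>\<^sub>2 \<tau>\<^sub>1"
    using ex_good_member[OF m, of \<W>] by blast
  interpret class_triple m W e F X Y Z
  proof
    fix W' x P y Q z R \<sigma>\<^sub>1 \<sigma>\<^sub>2 \<tau>\<^sub>1 \<tau>\<^sub>2 C
    assume "dec X Y Z W' x P y Q z R" and *: "W = add_mset \<sigma>\<^sub>1 (add_mset \<sigma>\<^sub>2 C)" "W' = add_mset \<tau>\<^sub>1 (add_mset \<tau>\<^sub>2 C)"
      "\<sigma>\<^sub>1 + \<sigma>\<^sub>2 = \<tau>\<^sub>1 + \<tau>\<^sub>2"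
    then have "W' \<in> \<W>" unfolding \<W>_def by blast
    then show "replacement_ok e \<sigma>\<^sub>1 \<sigma>\<^sub>2 \<tau>\<^sub>1" using repl * by blast
  qed (fact m, fact W(2))
  show ?thesis using W(1) large_multiplicity unfolding \<W>_def S_eq by blast
qed

end

text \<open>For \<open>m = 2\<close> the three block sums are always the three nonzero elements of \<open>H\<close>, so every
  exchange permutes them.\<close>

context double_modulus
begin

definition admissible :: "'a multiset \<Rightarrow> 'a multiset \<Rightarrow> 'a multiset \<Rightarrow> bool" where
  "admissible X Y Z \<longleftrightarrow> (\<forall>W x P y Q z R. dec X Y Z W x P y Q z R \<longrightarrow> min_zero_sum W \<and> set_mset W \<subseteq> H \<and> size W = 3)"

lemma admissibleD:
  "admissible X Y Z \<Longrightarrow> dec X Y Z W x P y Q z R \<Longrightarrow> min_zero_sum W \<and> set_mset W \<subseteq> H \<and> size W = 3"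
  unfolding admissible_def by blast

lemma admissible_perm: "admissible X Y Z \<Longrightarrow> admissible Y X Z" "admissible X Y Z \<Longrightarrow> admissible X Z Y"
proof -
  assume adm: "admissible X Y Z"
  show "admissible Y X Z"
    unfolding admissible_def using admissibleD[OF adm dec_perm(1)] by (intro allI impI)
  show "admissible X Z Y"
    unfolding admissible_def using admissibleD[OF adm dec_perm(2)] by (intro allI impI)
qed

context
  assumes m2: "m = 2"
begin

lemma card_H: "finite H" "card H \<le> 4"
proof -
  have "H \<subseteq> \<phi> ` set [(0, 0), (2, 0), (0, 2), (2, 2)]"
  proof
    fix h assume h: "h \<in> H"
    define v where "v = half h"
    define w where "w = (2 * (fst v mod 2), 2 * (snd v mod 2))"
    have "\<phi> (v + v) = h" unfolding v_def by (rule \<phi>_half[OF h])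
    moreover have "fst (v + v - w) = 4 * (fst v div 2)" by (simp add: w_def) presburger
    moreover have "snd (v + v - w) = 4 * (snd v div 2)" by (simp add: w_def) presburger
    ultimately have "\<phi> (v + v) = h" "\<phi> (v + v - w) = 0" unfolding \<phi>_eq_0 null_mod_def m2 by simp_all
    then have "h = \<phi> w" by (simp add: \<phi>_diff)
    moreover have "w \<in> set [(0, 0), (2, 0), (0, 2), (2, 2)]"
      unfolding w_def by (cases "even (fst v)"; cases "even (snd v)") (simp_all add: even_iff_mod_2_eq_zero odd_iff_mod_2_eq_one)
    ultimately show "h \<in> \<phi> ` set [(0, 0), (2, 0), (0, 2), (2, 2)]" by blast
  qed
  then have "finite H" "card H \<le> card (\<phi> ` set [(0, 0), (2, 0), (0, 2), (2::int, 2::int)])"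
    using finite_subset card_mono by blast+
  moreover have "card (\<phi> ` set [(0, 0), (2, 0), (0, 2), (2::int, 2::int)]) \<le> 4"
    by (rule order.trans[OF card_image_le]) simp_all
  ultimately show "finite H" "card H \<le> 4" by simp_all
qed

lemma H_double: "h \<in> H \<Longrightarrow> h + h = 0"
  using nmul_m[of h] by (simp add: m2 numeral_2_eq_2)

lemma three_distinct:
  assumes "min_zero_sum {#a, b, c#}" "{a, b, c} \<subseteq> H"
  shows "a \<noteq> 0" "a \<noteq> b" "c = a + b"
proof -
  show "a \<noteq> 0" using min_zero_sum_subset[OF assms(1), of "{#a#}"] by auto
  show "a \<noteq> b" using min_zero_sum_subset[OF assms(1), of "{#a, b#}"] assms(2) H_double[of a] by auto
  have "a + b + c = 0" using assms(1) by (simp add: min_zero_sum_def add.assoc)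
  moreover have "c + c = 0" using assms(2) H_double by simp
  ultimately show "c = a + b" by (metis add_right_cancel)
qed

text \<open>\<open>H\<close> has only three nonzero elements, so the unchanged sum c determines the
  other two as a set.\<close>

lemma replace_2:
  assumes W: "min_zero_sum {#a, b, c#}" "{a, b, c} \<subseteq> H" and W': "min_zero_sum {#a', b', c#}" "{a', b', c} \<subseteq> H"
  shows "a' = a \<or> a' = b"
proof (rule ccontr)
  assume neg: "\<not> ?thesis"
  have perm: "{#b, c, a#} = {#a, b, c#}" "{#c, a, b#} = {#a, b, c#}" "{#c, a', b'#} = {#a', b', c#}" by (simp_all add: add_mset_commute)
  have 1: "a \<noteq> 0" "b \<noteq> 0" "c \<noteq> 0" "a \<noteq> b" "b \<noteq> c" "c \<noteq> a" "a' \<noteq> 0" "c \<noteq> a'"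
    using three_distinct[of a b c] three_distinct[of b c a] three_distinct[of c a b]
      three_distinct[of a' b' c] three_distinct[of c a' b'] W W' by (simp_all add: perm insert_commute)
  have "0 \<in> H" by (auto simp: H_iff parity_0)
  then have "{0, a, b, c, a'} \<subseteq> H" using W W' by auto
  then have "card {0, a, b, c, a'} \<le> 4" using card_H card_mono order.trans by metis
  then show False using 1 neg by (simp add: card_insert_if eq_commute[of _ a'])
qed

context
  fixes X Y Z :: "'a multiset"
  assumes adm: "admissible X Y Z"
begin

lemma exchange_triple_2:
  assumes d: "dec X Y Z W x P y Q z R" and ab: "(a, b) \<in># P"
  shows "a = x \<or> b = y + z" "x + y + z \<noteq> a + b"
proof -
  obtain P' where P: "P = add_mset (a, b) P'" using ab by (meson mset_add)
  let ?C = "pair_sums P' + pair_sums Q + pair_sums R"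
  have W: "W = add_mset (x + y + z) (add_mset (a + b) ?C)" using d by (simp add: dec_def P)
  have d': "dec X Y Z (add_mset (a + y + z) (add_mset (x + b) ?C)) a (add_mset (x, b) P') y Q z R"
    using d by (simp add: dec_def P add_mset_commute)
  have sz: "size ?C = 1" using admissibleD[OF adm d] by (simp add: W)
  obtain c where c: "?C = {#c#}" using size_1_singleton_mset[OF sz] by blast
  have W1: "min_zero_sum {#x + y + z, a + b, c#}" "{x + y + z, a + b, c} \<subseteq> H" using admissibleD[OF adm d] by (simp_all add: W c)
  have W2: "min_zero_sum {#a + y + z, x + b, c#}" "{a + y + z, x + b, c} \<subseteq> H" using admissibleD[OF adm d'] by (simp_all add: c)
  show "a = x \<or> b = y + z" using replace_2[OF W1 W2] by (auto simp: add.assoc)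
  show "x + y + z \<noteq> a + b" using three_distinct(2)[OF W1] .
qed

lemma exchange_pairs_2:
  assumes d: "dec X Y Z W x (add_mset (a, b) (add_mset (c, d) P)) y Q z R"
  shows "c = b \<or> a = d" "a + b \<noteq> c + d"
proof -
  let ?C = "add_mset (x + y + z) (pair_sums P + pair_sums Q + pair_sums R)"
  have d': "dec X Y Z (add_mset (a + c) (add_mset (b + d) ?C)) x (add_mset (a, c) (add_mset (b, d) P)) y Q z R"
    using d by (simp add: dec_def add_mset_commute)
  have W: "W = add_mset (a + b) (add_mset (c + d) ?C)" using d by (simp add: dec_def add_mset_commute)
  have sz: "size ?C = 1" using admissibleD[OF adm d] by (simp add: W)
  obtain t where c: "?C = {#t#}" using size_1_singleton_mset[OF sz] by blast
  have W1: "min_zero_sum {#a + b, c + d, t#}" "{a + b, c + d, t} \<subseteq> H" using admissibleD[OF adm d] by (simp_all add: W c)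
  have W2: "min_zero_sum {#a + c, b + d, t#}" "{a + c, b + d, t} \<subseteq> H" using admissibleD[OF adm d'] by (simp_all add: c)
  show "c = b \<or> a = d" using replace_2[OF W1 W2] by (auto simp: add.commute[of a c])
  show "a + b \<noteq> c + d" using three_distinct(2)[OF W1] .
qed

lemma two_pairs_one_class:
  assumes d: "dec X Y Z W x P y Q z R" shows "size P \<noteq> 2"
proof
  assume "size P = 2"
  then obtain p q where "P = {#p, q#}" by (metis size_mset_SucE numeral_2_eq_2 size_Suc_exists size_eq_0_iff_empty)
  then obtain a b c e where P: "P = {#(a, b), (c, e)#}" by (cases p; cases q; simp)
  have d1: "dec X Y Z W x {#(a, b), (c, e)#} y Q z R" using d P by simp
  have d2: "dec X Y Z W x {#(a, b), (e, c)#} y Q z R"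
    using dec_flip[of X Y Z W x c e "{#(a, b)#}"] d1 by (simp add: add_mset_commute)
  have d3: "dec X Y Z W x {#(b, a), (c, e)#} y Q z R" by (rule dec_flip[OF d1])
  have 1: "c = b \<or> a = e" "e = b \<or> a = c" "a + b \<noteq> c + e"
    using exchange_pairs_2[OF d1] exchange_pairs_2[OF d2] by blast+
  have 2: "a = x \<or> b = y + z" "x + (y + z) \<noteq> a + b" "c = x \<or> e = y + z" "x + (y + z) \<noteq> c + e"
    using exchange_triple_2[OF d1, of a b] exchange_triple_2[OF d1, of c e] by (simp_all add: add.assoc)
  have 3: "b = x \<or> a = y + z" "e = x \<or> c = y + z"
    using exchange_triple_2(1)[OF d3, of b a] exchange_triple_2(1)[OF d2, of e c] by simp_all
  show False using 1 2 3 by (elim disjE; simp add: add.commute)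
qed

lemma double_pattern:
  assumes d: "dec X Y Z W x {#(a, b)#} y Q z R"
  shows "(\<exists>g. X = {#g, g, g#}) \<or> (\<exists>u v. X = {#u, u, v#} \<and> u \<noteq> v)"
proof -
  have X: "X = {#x, a, b#}" using d by (simp add: dec_def)
  have "a = x \<or> b = y + z" using exchange_triple_2(1)[OF d, of a b] by simp
  moreover have "b = x \<or> a = y + z" using exchange_triple_2(1)[OF dec_flip[OF d], of b a] by simp
  ultimately consider "a = x" "b = x" | "a = x" "b \<noteq> x" | "b = x" "a \<noteq> x" | "a = b" "a \<noteq> x" by blast
  then show ?thesis
  proof cases
    case 1
    then have "X = {#x, x, x#}" using X by simp
    then show ?thesis by blast
  next
    case 2
    then have "X = {#x, x, b#}" "x \<noteq> b" using X by auto
    then show ?thesis by blast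
  next
    case 3
    then have "X = {#x, x, a#}" "x \<noteq> a" using X by auto
    then show ?thesis by blast
  next
    case 4
    then have "X = {#a, a, x#}" "a \<noteq> x" using X by (auto simp: add_mset_commute)
    then show ?thesis by blast
  qed
qed

end

text \<open>If neither class is constant, put u or v into the triple: the exchange in the other
  class then requires u' = u + z and also u' = v + z.\<close>

lemma two_pairs_two_classes:
  fixes X Y Z :: "'a multiset"
  assumes adm: "admissible X Y Z"
    and d: "dec X Y Z W x P y Q z R" and sz: "size P = 1" "size Q = 1" "size R = 0"
  shows "\<exists>g. count (X + Y + Z) g \<ge> 3"
proof -
  have admY: "admissible Y X Z" using admissible_perm(1)[OF adm] .
  obtain p q where "P = {#p#}" "Q = {#q#}" using size_1_singleton_mset[OF sz(1)] size_1_singleton_mset[OF sz(2)] by blast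
  then obtain a b c e where PQ: "P = {#(a, b)#}" "Q = {#(c, e)#}" by (cases p; cases q; simp)
  have Z: "Z = {#z#}" using d sz(3) by (simp add: dec_def)
  have "(\<exists>g. X = {#g, g, g#}) \<or> (\<exists>u v. X = {#u, u, v#} \<and> u \<noteq> v)"
    using double_pattern[OF adm d[unfolded PQ]] by blast
  moreover have "(\<exists>g. Y = {#g, g, g#}) \<or> (\<exists>u v. Y = {#u, u, v#} \<and> u \<noteq> v)"
    using double_pattern[OF admY dec_perm(1)[OF d[unfolded PQ]]] by blast
  moreover have False if X: "X = {#u, u, v#}" "u \<noteq> v" and Y: "Y = {#u', u', v'#}" "u' \<noteq> v'" for u v u' v'
  proof -
    define W1 where "W1 = {#u + u' + z, u + v, u' + v'#}"
    define W2 where "W2 = {#v + u' + z, u + u, u' + v'#}"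
    have "dec X Y Z W1 u {#(v, u)#} u' {#(v', u')#} z {#}" "dec X Y Z W2 v {#(u, u)#} u' {#(v', u')#} z {#}"
      by (simp_all add: dec_def X Y Z W1_def W2_def add_mset_commute add.commute)
    then have d: "dec X Y Z W1 u {#(v, u)#} u' {#(v', u')#} z {#}"
       "dec Y X Z W1 u' {#(v', u')#} u {#(v, u)#} z {#}" "dec Y X Z W2 u' {#(v', u')#} v {#(u, u)#} z {#}"
      by (simp_all add: dec_perm(1))
    have "u' = u + z" using exchange_triple_2(1)[OF admY d(2), of v' u'] Y by auto
    moreover have "u' = v + z" using exchange_triple_2(1)[OF admY d(3), of v' u'] Y by auto
    ultimately show False using X by simp
  qed
  ultimately obtain g where "X = {#g, g, g#} \<or> Y = {#g, g, g#}" by metis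
  then have "count (X + Y + Z) g \<ge> 3" by auto
  then show ?thesis ..
qed

theorem ex_count_ge_3:
  fixes S :: "'a multiset"
  assumes S: "min_zero_sum S" and size: "size S = 7"
  shows "\<exists>g. count S g \<ge> 3"
proof -
  have "size S = 4 * m - 1" using size m2 by simp
  then obtain X Y Z where S_eq: "S = X + Y + Z" and odd: "odd (size X)" "odd (size Y)" "odd (size Z)"
    and dec: "\<And>W x P y Q z R. dec X Y Z W x P y Q z R \<Longrightarrow> min_zero_sum W \<and> set_mset W \<subseteq> H \<and> size W = 2 * m - 1"
    using classes[OF S] by metis
  have adm: "admissible X Y Z" using dec m2 by (fastforce simp: admissible_def)
  obtain W x P y Q z R where d: "dec X Y Z W x P y Q z R" using ex_dec[OF odd] by blast
  have admY: "admissible Y X Z" and admXZ: "admissible X Z Y" using admissible_perm[OF adm] .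
  have admZ: "admissible Z X Y" and admYZ: "admissible Y Z X"
    using admissible_perm(1)[OF admXZ] admissible_perm(2)[OF admY] .
  have dY: "dec Y X Z W y Q x P z R" by (rule dec_perm(1)[OF d])
  have dXZ: "dec X Z Y W x P z R y Q" by (rule dec_perm(2)[OF d])
  have dZ: "dec Z X Y W z R x P y Q" by (rule dec_perm(1)[OF dXZ])
  have dYZ: "dec Y Z X W y Q z R x P" by (rule dec_perm(2)[OF dY])
  have "size P + size Q + size R = 2" using admissibleD[OF adm d] d by (auto simp: dec_def)
  then consider "size P = 2" | "size Q = 2" | "size R = 2" | "size P = 1" "size Q = 1" "size R = 0"
    | "size P = 1" "size Q = 0" "size R = 1" | "size P = 0" "size Q = 1" "size R = 1" by linarith
  then show ?thesis
  proof cases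
    case 1 then show ?thesis using two_pairs_one_class[OF adm d] by blast
  next
    case 2 then show ?thesis using two_pairs_one_class[OF admY dY] by blast
  next
    case 3 then show ?thesis using two_pairs_one_class[OF admZ dZ] by blast
  next
    case 4 then show ?thesis using two_pairs_two_classes[OF adm d] S_eq by blast
  next
    case 5
    have "X + Z + Y = S" by (simp add: S_eq)
    then show ?thesis using two_pairs_two_classes[OF admXZ dXZ] 5 by auto
  next
    case 6
    have "Y + Z + X = S" by (simp add: S_eq)
    then show ?thesis using two_pairs_two_classes[OF admYZ dYZ] 6 by auto
  qed
qed

end

end

section \<open>The moduli 2, 4, 8 and 5, 10\<close>

definition inverse_property :: "nat \<Rightarrow> bool" where
  "inverse_property n \<longleftrightarrow>
     (\<forall>S. mzs n S \<longrightarrow> size S = 2 * n - 1 \<longrightarrow> reduced n S \<longrightarrow> (\<exists>g\<in>#S. count S g \<ge> n - 1))"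

context double_modulus
begin

lemma \<phi>_sum: "\<phi> (\<Sum>\<^sub># M) = \<Sum>\<^sub># (image_mset \<phi> M)"
  by (induction M) (auto simp: \<phi>_add)

lemma min_zero_sum_image:
  assumes "mzs (2 * m) S" shows "min_zero_sum (image_mset \<phi> S)"
  unfolding min_zero_sum_def
proof (intro conjI allI impI)
  show "\<Sum>\<^sub># (image_mset \<phi> S) = 0" using assms by (simp add: \<phi>_sum[symmetric] \<phi>_eq_0 mzs_def)
  fix B assume B: "B \<subset># image_mset \<phi> S" "B \<noteq> {#}"
  then obtain N where N: "N \<subseteq># S" "image_mset \<phi> N = B"
    using subset_image_mset_exists[of B \<phi> S] by (auto simp: subset_mset.less_le)
  then have "N \<subset># S" "N \<noteq> {#}" using B by (auto simp: subset_mset.less_le)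
  then have "\<not> null_mod (2 * m) (\<Sum>\<^sub># N)" using assms by (simp add: mzs_def)
  then have "\<phi> (\<Sum>\<^sub># N) \<noteq> 0" unfolding \<phi>_eq_0 .
  then show "\<Sum>\<^sub># B \<noteq> 0" unfolding \<phi>_sum N(2) .
qed

lemma large_count_image:
  assumes red: "reduced (2 * m) S" and g: "count (image_mset \<phi> S) g \<ge> k" "k > 0"
  shows "\<exists>x\<in>#S. count S x \<ge> k"
proof -
  have "g \<in># image_mset \<phi> S" using g by (metis count_greater_zero_iff less_le_trans)
  then obtain x where x: "x \<in># S" "g = \<phi> x" by auto
  have "y = x" if "y \<in># S" "\<phi> y = \<phi> x" for y
  proof -
    have "\<phi> (y - x) = 0" using that by (simp add: \<phi>_diff)
    then show ?thesis using red that(1) x(1) by (auto simp: \<phi>_eq_0 reduced_def)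
  qed
  then have "\<phi> -` {g} \<inter> set_mset S = {x}" using x by auto
  then have "count (image_mset \<phi> S) g = count S x" by (simp add: count_image_mset)
  then show ?thesis using g x by auto
qed

lemma inverse_property_double: "m \<ge> 4 \<Longrightarrow> inverse_property (2 * m)"
  unfolding inverse_property_def
proof (intro allI impI)
  fix S assume m: "m \<ge> 4" and S: "mzs (2 * m) S" "size S = 2 * (2 * m) - 1" "reduced (2 * m) S"
  obtain g where "count (image_mset \<phi> S) g \<ge> 2 * m - 1"
    using ex_count_ge[OF min_zero_sum_image[OF S(1)] _ m] S(2) by auto
  then show "\<exists>g\<in>#S. count S g \<ge> 2 * m - 1" using large_count_image[OF S(3)] m by simp
qed

lemma inverse_property_double_2: "m = 2 \<Longrightarrow> inverse_property 4"
  unfolding inverse_property_def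
proof (intro allI impI)
  fix S assume m: "m = 2" and S: "mzs 4 S" "size S = 2 * 4 - 1" "reduced 4 S"
  have S': "mzs (2 * m) S" "reduced (2 * m) S" using S m by simp_all
  obtain g where "count (image_mset \<phi> S) g \<ge> 3"
    using ex_count_ge_3[OF m min_zero_sum_image[OF S'(1)]] S(2) by auto
  then show "\<exists>g\<in>#S. count S g \<ge> 4 - 1" using large_count_image[OF S'(2), of 3 g] by simp
qed

end

lemma inverse_property_prime: "prime p \<Longrightarrow> p \<ge> 5 \<Longrightarrow> inverse_property p"
  unfolding inverse_property_def
  using prime_ge_5.ex_count_ge_pred_prime prime_ge_5.intro by blast

lemma inverse_property_2: "inverse_property 2"
  unfolding inverse_property_def
proof (intro allI impI)
  fix S :: "(int \<times> int) multiset" assume "size S = 2 * 2 - 1"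
  then have "S \<noteq> {#}" by auto
  then obtain g where "g \<in># S" by (meson multiset_nonemptyE)
  moreover from this have "count S g \<ge> 2 - 1" by (simp add: Suc_le_eq)
  ultimately show "\<exists>g\<in>#S. count S g \<ge> 2 - 1" by blast
qed

lemma residue_pair_surj:
  fixes x :: "'a::finite bit0 \<times> 'a bit0"
  shows "\<exists>v. (of_int (fst v), of_int (snd v)) = x"
proof (cases x)
  case (Pair a b)
  obtain i j where "a = of_int i" "b = of_int j" by (metis bit0_cases)
  then show ?thesis using Pair by (intro exI[of _ "(i, j)"]) simp
qed

text \<open>That m is a prime power is what yields the assumption \<open>davenport\<close>, by
  \<open>zsf_size_le\<close>.\<close>

lemma double_modulus_numeral:
  assumes "CARD('a::finite bit0) = 2 * m" "m \<ge> 2" "inverse_property m" "prime p" "m = p ^ k" "k > 0"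
  shows "double_modulus (\<lambda>v. (of_int (fst v), of_int (snd v)) :: 'a bit0 \<times> 'a bit0) m"
proof
  interpret prime_power p k m by unfold_locales (use assms in auto)
  show "m \<ge> 2" by fact
  show "((of_int (fst (u + v)), of_int (snd (u + v))) :: 'a bit0 \<times> 'a bit0)
    = (of_int (fst u), of_int (snd u)) + (of_int (fst v), of_int (snd v))" for u v by simp
  show "((of_int (fst v), of_int (snd v)) :: 'a bit0 \<times> 'a bit0) = 0 \<longleftrightarrow> null_mod (2 * m) v" for v
    using assms(1) by (simp add: null_mod_def zero_prod_def of_int_eq_0_iff_char_dvd)
  show "\<exists>v. ((of_int (fst v), of_int (snd v)) :: 'a bit0 \<times> 'a bit0) = x" for x by (rule residue_pair_surj)
  show "zsf m M \<Longrightarrow> size M \<le> 2 * m - 2" for M by (rule zsf_size_le)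
  show "mzs m W \<Longrightarrow> size W = 2 * m - 1 \<Longrightarrow> reduced m W \<Longrightarrow> \<exists>e\<in>#W. count W e \<ge> m - 1" for W
    using assms(3) by (simp add: inverse_property_def)
qed

lemma inverse_property_4: "inverse_property 4"
proof -
  interpret double_modulus "\<lambda>v. (of_int (fst v), of_int (snd v)) :: 4 \<times> 4" 2
    by (rule double_modulus_numeral[where p = 2 and k = 1]) (simp_all add: inverse_property_2)
  show ?thesis by (rule inverse_property_double_2) simp
qed

lemma inverse_property_8: "inverse_property 8"
proof -
  interpret double_modulus "\<lambda>v. (of_int (fst v), of_int (snd v)) :: 8 \<times> 8" 4
    by (rule double_modulus_numeral[where p = 2 and k = 2]) (simp_all add: inverse_property_4)
  show ?thesis using inverse_property_double by simp
qed

lemma inverse_property_10: "inverse_property 10"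
proof -
  have p5: "prime (5::nat)" by simp
  interpret double_modulus "\<lambda>v. (of_int (fst v), of_int (snd v)) :: 10 \<times> 10" 5
    by (rule double_modulus_numeral[where p = 5 and k = 1]) (simp_all add: inverse_property_prime)
  show ?thesis using inverse_property_double by simp
qed

section \<open>From residues to the group\<close>

lemma sum_mset_eq_sum: "(\<Sum>x\<in>#M. f x :: int) = (\<Sum>x\<in>set_mset M. int (count M x) * f x)"
proof (induction M)
  case (add x M)
  show ?case
  proof (cases "x \<in># M")
    case True
    then have "(\<Sum>y\<in>set_mset (add_mset x M). int (count (add_mset x M) y) * f y)
       = (\<Sum>y\<in>set_mset M. int (count M y) * f y + (if y = x then f x else 0))"
      by (intro sum.cong) (auto simp: algebra_simps)
    also have "\<dots> = (\<Sum>y\<in>set_mset M. int (count M y) * f y) + f x"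
      using True by (simp add: sum.distrib)
    finally show ?thesis using add by simp
  next
    case False
    then have "(\<Sum>y\<in>set_mset M. int (count (add_mset x M) y) * f y) = (\<Sum>y\<in>set_mset M. int (count M y) * f y)"
      by (intro sum.cong) auto
    then show ?thesis using add False by (simp add: not_in_iff)
  qed
qed simp

lemma carrier_Z_squared: "n > 0 \<Longrightarrow> carrier (Z_squared n) = {0..<int n} \<times> {0..<int n}"
  by (simp add: Z_squared_def carrier_integer_mod_group)

lemma one_Z_squared: "\<one>\<^bsub>Z_squared n\<^esub> = 0"
  by (simp add: Z_squared_def zero_prod_def)

lemma mult_Z_squared: "x \<otimes>\<^bsub>Z_squared n\<^esub> y = ((fst x + fst y) mod int n, (snd x + snd y) mod int n)"
  by (simp add: Z_squared_def mult_DirProd')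

lemma comm_group_Z_squared: "comm_group (Z_squared n)"
proof -
  interpret group "Z_squared n" unfolding Z_squared_def by (intro DirProd_group) simp_all
  show ?thesis by (rule group_comm_groupI) (simp add: mult_Z_squared add.commute)
qed

context
  fixes n :: nat
  assumes n: "n > 0"
begin

interpretation Z: comm_group "Z_squared n" by (rule comm_group_Z_squared)

lemma pow_Z_squared:
  "x \<in> carrier (Z_squared n) \<Longrightarrow> x [^]\<^bsub>Z_squared n\<^esub> (k::nat) = ((int k * fst x) mod int n, (int k * snd x) mod int n)"
proof (induction k)
  case (Suc k)
  then show ?case by (simp add: mult_Z_squared algebra_simps mod_simps)
qed (simp add: one_Z_squared zero_prod_def)

lemma finprod_Z_squared:
  assumes "finite A" "A \<subseteq> carrier (Z_squared n)"
  shows "finprod (Z_squared n) (\<lambda>x. x [^]\<^bsub>Z_squared n\<^esub> (c x::nat)) A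
    = ((\<Sum>x\<in>A. int (c x) * fst x) mod int n, (\<Sum>x\<in>A. int (c x) * snd x) mod int n)"
  using assms
proof (induction A)
  case (insert x A)
  then have "finprod (Z_squared n) (\<lambda>x. x [^]\<^bsub>Z_squared n\<^esub> c x) (insert x A)
    = x [^]\<^bsub>Z_squared n\<^esub> c x \<otimes>\<^bsub>Z_squared n\<^esub> finprod (Z_squared n) (\<lambda>x. x [^]\<^bsub>Z_squared n\<^esub> c x) A"
    by (intro Z.finprod_insert) auto
  then show ?case using insert by (simp add: mult_Z_squared pow_Z_squared mod_simps)
qed (simp add: one_Z_squared zero_prod_def)

lemma multiset_sum_Z_squared:
  assumes "set_mset B \<subseteq> carrier (Z_squared n)"
  shows "multiset_sum (Z_squared n) B = \<one>\<^bsub>Z_squared n\<^esub> \<longleftrightarrow> null_mod n (\<Sum>\<^sub># B)"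
  unfolding multiset_sum_def finprod_Z_squared[OF finite_set_mset assms] one_Z_squared null_mod_def
  using fst_sum_mset[of id B] snd_sum_mset[of id B]
  by (simp add: sum_mset_eq_sum prod_eq_iff dvd_eq_mod_eq_0)

lemma zero_sum_free_iff_zsf:
  assumes "set_mset A \<subseteq> carrier (Z_squared n)"
  shows "zero_sum_free (Z_squared n) A \<longleftrightarrow> zsf n A"
proof -
  have "multiset_sum (Z_squared n) B = \<one>\<^bsub>Z_squared n\<^esub> \<longleftrightarrow> null_mod n (\<Sum>\<^sub># B)" if "B \<subseteq># A" for B
    using multiset_sum_Z_squared assms set_mset_mono[OF that] by blast
  then show ?thesis unfolding zero_sum_free_def contains_zero_sum_def zsf_def by blast
qed

end

text \<open>A proper zero-sum containing c has a complement inside \<open>A\<close>, which is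
  nonempty and again has sum zero.\<close>

lemma zsf_extend:
  assumes zsf: "zsf n A" and c: "null_mod n (c + \<Sum>\<^sub># A)" and ne: "A \<noteq> {#}"
  shows "mzs n (add_mset c A)"
  unfolding mzs_def
proof (intro conjI allI impI)
  show "null_mod n (\<Sum>\<^sub># (add_mset c A))" using c by simp
  fix B assume B: "B \<subset># add_mset c A" "B \<noteq> {#}"
  show "\<not> null_mod n (\<Sum>\<^sub># B)"
  proof (cases "c \<in># B")
    case True
    then obtain B' where B': "B = add_mset c B'" by (meson mset_add)
    then have "B' \<subset># A" using B(1) by simp
    then obtain D where D: "A = B' + D" "D \<noteq> {#}"
      by (metis add.right_neutral subset_mset.less_imp_le mset_subset_eq_exists_conv subset_mset.less_irrefl)
    then have "\<not> null_mod n (\<Sum>\<^sub># D)" using zsf by (auto simp: zsf_def)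
    moreover have "\<Sum>\<^sub># D = (c + \<Sum>\<^sub># A) - \<Sum>\<^sub># B" by (simp add: D B')
    ultimately show ?thesis using null_mod_diff[OF c, of "\<Sum>\<^sub># B"] by auto
  next
    case False
    then have "B \<subseteq># A" using B(1) by (metis subset_mset.less_imp_le diff_add_mset_swap diff_single_trivial insert_DiffM2 mset_subset_eq_insertD subset_eq_diff_conv add_mset_add_single diff_union_swap2 add_mset_remove_trivial)
    then show ?thesis using zsf B(2) by (simp add: zsf_def)
  qed
qed

text \<open>The representatives between 0 and n - 1 make the closed-up multiset
  \<open>reduced\<close>; removing the added element c lowers a multiplicity by at most one.\<close>

lemma property_B_of_inverse:
  assumes inv: "inverse_property n" and n: "n \<ge> 3"
    and A: "set_mset A \<subseteq> carrier (Z_squared n)" "size A = 2 * n - 2" "zero_sum_free (Z_squared n) A"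
  shows "\<exists>x\<in>#A. count A x \<ge> n - 2"
proof -
  have n0: "n > 0" using n by simp
  have zsf: "zsf n A" using A zero_sum_free_iff_zsf[OF n0] by blast
  define c where "c = ((- fst (\<Sum>\<^sub># A)) mod int n, (- snd (\<Sum>\<^sub># A)) mod int n)"
  have range: "0 \<le> fst x \<and> fst x < int n \<and> 0 \<le> snd x \<and> snd x < int n" if "x \<in># add_mset c A" for x
    using that A(1) n0 by (auto simp: c_def carrier_Z_squared)
  have "null_mod n (c + \<Sum>\<^sub># A)"
    by (simp add: null_mod_def c_def dvd_eq_mod_eq_0 mod_simps)
  moreover have "A \<noteq> {#}" using A(2) n by auto
  ultimately have "mzs n (add_mset c A)" using zsf_extend[OF zsf] by blast
  moreover have "reduced n (add_mset c A)"
    unfolding reduced_def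
  proof (intro ballI impI)
    fix x y assume xy: "x \<in># add_mset c A" "y \<in># add_mset c A" "null_mod n (x - y)"
    then have "fst x mod int n = fst y mod int n" "snd x mod int n = snd y mod int n"
      by (simp_all add: null_mod_def mod_eq_dvd_iff)
    then show "x = y" using range[OF xy(1)] range[OF xy(2)] by (simp add: prod_eq_iff)
  qed
  moreover have "size (add_mset c A) = 2 * n - 1" using A(2) n by simp
  ultimately obtain g where g: "count (add_mset c A) g \<ge> n - 1"
    using inv unfolding inverse_property_def by blast
  then have "count A g \<ge> n - 2" by (simp split: if_splits)
  moreover from this have "g \<in># A" using n by (simp flip: count_greater_zero_iff)
  ultimately show ?thesis by blast
qed

lemma count_le_largest_multiplicity:
  assumes "x \<in># A" shows "count A x \<le> largest_multiplicity 1 A"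
proof -
  define l where "l = sorted_list_of_multiset (image_mset (count A) (mset_set (set_mset A)))"
  have "count A x \<in> set l" using assms by (simp add: l_def)
  then obtain i where i: "i < length l" "l ! i = count A x" by (auto simp: in_set_conv_nth)
  have "sorted l" by (simp add: l_def)
  then have "l ! i \<le> l ! (length l - 1)" using i by (intro sorted_nth_mono) auto
  also have "\<dots> = largest_multiplicity 1 A"
    using i by (cases "l = []") (simp_all add: largest_multiplicity_def multiplicities_def l_def[symmetric] nth_default_def rev_nth)
  finally show ?thesis using i by simp
qed

section \<open>The modulus 9\<close>

interpretation nine: prime_power 3 2 9
  by unfold_locales simp_all

abbreviation eq3 (infix "\<equiv>\<^sub>3" 50) where "a \<equiv>\<^sub>3 b \<equiv> [a = b] (mod 3)"

text \<open>Residues modulo 3 as constructors, so that the finite checks evaluate by pattern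
  matching.\<close>

datatype trit = Z | P | N

fun tval :: "trit \<Rightarrow> int" where "tval Z = 0" | "tval P = 1" | "tval N = - 1"

fun tadd where "tadd Z y = y" | "tadd P Z = P" | "tadd P P = N" | "tadd P N = Z" | "tadd N Z = N" | "tadd N P = Z" | "tadd N N = P"

fun tneg where "tneg Z = Z" | "tneg P = N" | "tneg N = P"

fun tmul where "tmul Z y = Z" | "tmul P y = y" | "tmul N y = tneg y"

lemma tval_tadd: "tval (tadd x y) \<equiv>\<^sub>3 tval x + tval y"
  by (cases x; cases y) (simp_all add: cong_iff_dvd_diff)

lemma tval_tneg: "tval (tneg x) = - tval x"
  by (cases x) simp_all

lemma tval_tmul: "tval (tmul x y) = tval x * tval y"
  by (cases x; cases y) simp_all

lemma tval_eq_iff: "tval x = tval y \<longleftrightarrow> x = y"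
  by (cases x; cases y) simp_all

fun adjacent :: "('a \<Rightarrow> 'a \<Rightarrow> 'b) \<Rightarrow> 'a list \<Rightarrow> 'b list" where
  "adjacent f (x # y # xs) = f x y # adjacent f (y # xs)" | "adjacent f [x] = []" | "adjacent f [] = []"

lemma length_adjacent [simp]: "length (adjacent f xs) = length xs - 1"
  by (induction f xs rule: adjacent.induct) auto

lemma nth_adjacent: "Suc i < length xs \<Longrightarrow> adjacent f xs ! i = f (xs ! i) (xs ! Suc i)"
proof (induction f xs arbitrary: i rule: adjacent.induct)
  case (1 f x y xs) then show ?case by (cases i) auto
qed auto

primrec iterate :: "nat \<Rightarrow> ('a \<Rightarrow> 'a) \<Rightarrow> 'a \<Rightarrow> 'a" where
  "iterate 0 f x = x" | "iterate (Suc n) f x = f (iterate n f x)"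

text \<open>The entry \<open>i\<close> of \<open>row k l\<close> is the signed count, modulo 3, of the multiset consisting of \<open>i\<close>, \<open>j\<close>,
  \<open>k\<close>, \<open>l\<close> copies of \<open>(1, 0)\<close>, \<open>(0, 1)\<close>, \<open>(1, 1)\<close>, \<open>(1, -1)\<close>, where \<open>i + j + k + l = 16\<close>.\<close>

definition row :: "nat \<Rightarrow> nat \<Rightarrow> trit list" where
  "row k l = iterate l (adjacent (\<lambda>x y. tadd y (tneg x))) (iterate k (adjacent tadd)
     [Z, Z, Z, Z, Z, Z, Z, Z, P, Z, Z, Z, Z, Z, Z, Z, Z])"

definition direction_mset :: "nat \<Rightarrow> nat \<Rightarrow> nat \<Rightarrow> nat \<Rightarrow> (int \<times> int) multiset" where
  "direction_mset i j k l = replicate_mset i (1, 0) + replicate_mset j (0, 1) + replicate_mset k (1, 1) + replicate_mset l (1, - 1)"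

lemma length_row: "length (row k l) = 17 - k - l"
proof -
  have "length (iterate k (adjacent tadd) xs) = length xs - k" for k xs by (induction k) auto
  moreover have "length (iterate l (adjacent (\<lambda>x y. tadd y (tneg x))) xs) = length xs - l" for l xs by (induction l) auto
  ultimately show ?thesis by (simp add: row_def)
qed

lemma row_Suc_left: "Suc i < length (row k 0) \<Longrightarrow> row (Suc k) 0 ! i = tadd (row k 0 ! i) (row k 0 ! Suc i)"
  by (simp add: row_def nth_adjacent)

lemma row_Suc_right: "Suc i < length (row k l) \<Longrightarrow> row k (Suc l) ! i = tadd (row k l ! Suc i) (tneg (row k l ! i))"
  by (simp add: row_def nth_adjacent)

lemma direction_mset_Suc: "direction_mset i j (Suc k) l = add_mset ((1, 0) + (0, 1)) (direction_mset i j k l)"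
  "direction_mset i j k (Suc l) = add_mset ((1, 0) + - (0, 1)) (direction_mset i j k l)"
  "add_mset (1, 0) (direction_mset i j k l) = direction_mset (Suc i) j k l"
  "add_mset (0, 1) (direction_mset i j k l) = direction_mset i (Suc j) k l"
  by (simp_all add: direction_mset_def)

lemma size_direction_mset [simp]: "size (direction_mset i j k l) = i + j + k + l"
  by (simp add: direction_mset_def)

text \<open>As (1, 1) and (1, -1) are the sum and the difference of the basis vectors, additivity
  gives recursions of Pascal type. They start from the row in which only i = j = 8
  contributes.\<close>

lemma signed_count_row: "i + j + k + l = 16 \<Longrightarrow> signed_count 9 (direction_mset i j k l) 0 \<equiv>\<^sub>3 tval (row k l ! i)"
proof (induction l arbitrary: i j)
  case 0
  then show ?case
  proof (induction k arbitrary: i j)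
    case 0
    have "signed_count 9 (direction_mset i j 0 0) 0 \<equiv>\<^sub>3 of_bool (i = 8)"
    proof (cases "i = 8")
      case True
      then show ?thesis using 0 nine.sc_basis_eq_1[of 8 8] by (simp add: direction_mset_def)
    next
      case False
      then have "i \<ge> 9 \<or> j \<ge> 9" using 0 by auto
      then show ?thesis using False nine.sc_replicate_q[of i "(1,0)" "replicate_mset j (0, 1)" 0]
        nine.sc_replicate_q[of j "(0,1)" "replicate_mset i (1, 0)" 0] by (auto simp: direction_mset_def add.commute)
    qed
    moreover have "tval (row 0 0 ! i) = of_bool (i = 8)"
    proof -
      have "i < 17" using 0 by simp
      then have "i \<in> set [0..<17]" by simp
      moreover have "list_all (\<lambda>i. tval (row 0 0 ! i) = of_bool (i = 8)) [0..<17]" by code_simp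
      ultimately show ?thesis unfolding list_all_iff by blast
    qed
    ultimately show ?case by simp
  next
    case (Suc k)
    have "signed_count 9 (direction_mset i j (Suc k) 0) 0
      \<equiv>\<^sub>3 signed_count 9 (direction_mset (Suc i) j k 0) 0 + signed_count 9 (direction_mset i (Suc j) k 0) 0"
      unfolding direction_mset_Suc(1) using nine.sc_top_add[of "direction_mset i j k 0" "(1, 0)" "(0, 1)"] Suc.prems
      by (simp only: direction_mset_Suc(3,4)) simp
    moreover have "signed_count 9 (direction_mset (Suc i) j k 0) 0 + signed_count 9 (direction_mset i (Suc j) k 0) 0
      \<equiv>\<^sub>3 tval (row k 0 ! Suc i) + tval (row k 0 ! i)"
      using Suc.prems by (intro cong_add Suc.IH) simp_all
    moreover have "tval (row k 0 ! Suc i) + tval (row k 0 ! i) \<equiv>\<^sub>3 tval (row (Suc k) 0 ! i)"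
      using row_Suc_left[of i k] tval_tadd[of "row k 0 ! i" "row k 0 ! Suc i"] Suc.prems
      by (simp add: length_row cong_sym_eq add.commute)
    ultimately show ?case by (metis cong_trans)
  qed
next
  case (Suc l)
  have "signed_count 9 (direction_mset i j k (Suc l)) 0
    \<equiv>\<^sub>3 signed_count 9 (direction_mset (Suc i) j k l) 0 + signed_count 9 (add_mset (- (0, 1)) (direction_mset i j k l)) 0"
    unfolding direction_mset_Suc(2) using nine.sc_top_add[of "direction_mset i j k l" "(1, 0)" "- (0, 1)"] Suc.prems
    by (simp only: direction_mset_Suc(3)) simp
  moreover have "signed_count 9 (direction_mset (Suc i) j k l) 0 + signed_count 9 (add_mset (- (0, 1)) (direction_mset i j k l)) 0
    \<equiv>\<^sub>3 tval (row k l ! Suc i) + - tval (row k l ! i)"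
  proof (rule cong_add)
    show "signed_count 9 (direction_mset (Suc i) j k l) 0 \<equiv>\<^sub>3 tval (row k l ! Suc i)" using Suc.prems by (intro Suc.IH) simp
    have "signed_count 9 (add_mset (- (0, 1)) (direction_mset i j k l)) 0 \<equiv>\<^sub>3 - signed_count 9 (direction_mset i (Suc j) k l) 0"
      using nine.sc_top_minus[of "direction_mset i j k l" "(0, 1)"] Suc.prems by (simp only: direction_mset_Suc(4)) simp
    moreover have "- signed_count 9 (direction_mset i (Suc j) k l) 0 \<equiv>\<^sub>3 - tval (row k l ! i)"
      unfolding cong_minus_minus_iff using Suc.prems by (intro Suc.IH) simp
    ultimately show "signed_count 9 (add_mset (- (0, 1)) (direction_mset i j k l)) 0 \<equiv>\<^sub>3 - tval (row k l ! i)" by (rule cong_trans)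
  qed
  moreover have "tval (row k l ! Suc i) + - tval (row k l ! i) \<equiv>\<^sub>3 tval (row k (Suc l) ! i)"
    using row_Suc_right[of i k l] tval_tadd[of "row k l ! Suc i" "tneg (row k l ! i)"] Suc.prems
    by (simp add: length_row cong_sym_eq tval_tneg)
  ultimately show ?case by (metis cong_trans)
qed

section \<open>The four lines modulo 3 and the distribution of a multiset over them\<close>

definition direction :: "nat \<Rightarrow> int \<times> int" where
  "direction d = [(1, 0), (0, 1), (1, 1), (1, - 1)] ! d"

definition line :: "int \<times> int \<Rightarrow> nat" where
  "line x = (if 3 dvd snd x then 0 else if 3 dvd fst x then 1 else if 3 dvd fst x - snd x then 2 else 3)"

definition orientation :: "int \<times> int \<Rightarrow> int" where
  "orientation x = (if (if line x = 1 then snd x else fst x) mod 3 = 1 then 1 else - 1)"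

lemma line_less: "line x < 4" by (simp add: line_def)

lemma orientation_square: "orientation x * orientation x = 1" by (simp add: orientation_def)

lemma orientation_cases: "orientation x = 1 \<or> orientation x = - 1" by (simp add: orientation_def)

lemma direction_cong:
  assumes "\<not> null_mod 3 x"
  shows "fst x \<equiv>\<^sub>3 orientation x * fst (direction (line x))" "snd x \<equiv>\<^sub>3 orientation x * snd (direction (line x))"
proof -
  obtain a b where x: "x = (a, b)" by (cases x)
  have ab: "\<not> (3 dvd a \<and> 3 dvd b)" using assms by (simp add: null_mod_def x)
  have a: "a mod 3 = 0 \<or> a mod 3 = 1 \<or> a mod 3 = 2" and b: "b mod 3 = 0 \<or> b mod 3 = 1 \<or> b mod 3 = 2" by presburger+
  have ab': "3 dvd a - b \<longleftrightarrow> a mod 3 = b mod 3" by (simp add: mod_eq_dvd_iff)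
  have dir: "direction 0 = (1, 0)" "direction 1 = (0, 1)" "direction 2 = (1, 1)" "direction 3 = (1, - 1)"
    by (simp_all add: direction_def)
  have "a \<equiv>\<^sub>3 orientation (a, b) * fst (direction (line (a, b))) \<and> b \<equiv>\<^sub>3 orientation (a, b) * snd (direction (line (a, b)))"
  proof (cases "3 dvd b")
    case True
    then have l: "line (a, b) = 0" by (simp add: line_def)
    have "a mod 3 = 1 \<or> a mod 3 = 2" using a ab True by presburger
    then show ?thesis using True by (auto simp: l dir orientation_def cong_0_iff) (simp_all add: cong_def)
  next
    case b3: False
    then have b: "b mod 3 = 1 \<or> b mod 3 = 2" using b by presburger
    show ?thesis
    proof (cases "3 dvd a")
      case True
      then have l: "line (a, b) = 1" using b3 by (simp add: line_def)
      show ?thesis using True b by (auto simp: l dir(2)[unfolded One_nat_def] orientation_def cong_0_iff) (simp_all add: cong_def)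
    next
      case False
      then have a: "a mod 3 = 1 \<or> a mod 3 = 2" using a by presburger
      show ?thesis
      proof (cases "a mod 3 = b mod 3")
        case True
        then have l: "line (a, b) = 2" using b3 False ab' by (simp add: line_def)
        show ?thesis using True a by (auto simp: l dir orientation_def cong_def)
      next
        case ne: False
        then have l: "line (a, b) = 3" using b3 False ab' by (simp add: line_def)
        show ?thesis using ne a b by (auto simp: l dir orientation_def cong_def)
      qed
    qed
  qed
  then show "fst x \<equiv>\<^sub>3 orientation x * fst (direction (line x))" "snd x \<equiv>\<^sub>3 orientation x * snd (direction (line x))" by (simp_all add: x)
qed

lemma signed_count_direction:
  assumes "size M = 15" "\<not> null_mod 3 x"
  shows "signed_count 9 (add_mset x M) 0 \<equiv>\<^sub>3 orientation x * signed_count 9 (add_mset (direction (line x)) M) 0"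
proof -
  define A B where "A = signed_count 9 (add_mset (1, 0) M) 0" and "B = signed_count 9 (add_mset (0, 1) M) 0"
  have lin: "signed_count 9 (add_mset y M) 0 \<equiv>\<^sub>3 fst y * A + snd y * B" for y
    using nine.sc_top_linear[of M y] assms(1) by (simp add: A_def B_def)
  have "fst x * A + snd x * B \<equiv>\<^sub>3 (orientation x * fst (direction (line x))) * A + (orientation x * snd (direction (line x))) * B"
    by (rule cong_add[OF cong_mult[OF direction_cong(1)[OF assms(2)] cong_refl] cong_mult[OF direction_cong(2)[OF assms(2)] cong_refl]])
  then have "fst x * A + snd x * B \<equiv>\<^sub>3 orientation x * (fst (direction (line x)) * A + snd (direction (line x)) * B)"
    by (simp add: algebra_simps)
  moreover have "orientation x * (fst (direction (line x)) * A + snd (direction (line x)) * B)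
    \<equiv>\<^sub>3 orientation x * signed_count 9 (add_mset (direction (line x)) M) 0"
    by (rule cong_mult[OF cong_refl cong_sym[OF lin]])
  ultimately show ?thesis using lin[of x] by (metis cong_trans)
qed

definition line_count :: "(int \<times> int) multiset \<Rightarrow> nat \<Rightarrow> nat" where
  "line_count M d = size (filter_mset (\<lambda>x. line x = d) M)"

text \<open>The entry \<open>n ! 1\<close> is implied, since the table concerns profiles with total
  16.\<close>

definition lookup :: "nat list \<Rightarrow> trit" where
  "lookup n = row (n ! 2) (n ! 3) ! (n ! 0)"

definition profile :: "(int \<times> int) multiset \<Rightarrow> nat list" where
  "profile M = map (line_count M) [0, 1, 2, 3]"

text \<open>By linearity modulo 3 each element can be replaced by the direction of its line at the
  cost of its orientation; the directions already substituted are carried along in the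
  induction.\<close>

lemma signed_count_profile_aux:
  assumes "\<forall>x\<in>#M. \<not> null_mod 3 x" "size M + i + j + k + l = 16"
  shows "signed_count 9 (M + direction_mset i j k l) 0 \<equiv>\<^sub>3 (\<Prod>x\<in>#M. orientation x) *
    signed_count 9 (direction_mset (i + line_count M 0) (j + line_count M 1) (k + line_count M 2) (l + line_count M 3)) 0"
  using assms
proof (induction M arbitrary: i j k l)
  case empty then show ?case by (simp add: line_count_def)
next
  case (add x M)
  let ?D = "direction_mset i j k l"
  have 1: "signed_count 9 (add_mset x (M + ?D)) 0 \<equiv>\<^sub>3 orientation x * signed_count 9 (add_mset (direction (line x)) (M + ?D)) 0"
    using add.prems by (intro signed_count_direction) auto
  obtain i' j' k' l' where D: "add_mset (direction (line x)) ?D = direction_mset i' j' k' l'"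
    and n: "i' + j' + k' + l' = Suc (i + j + k + l)"
      "i' + line_count M 0 = i + line_count (add_mset x M) 0" "j' + line_count M 1 = j + line_count (add_mset x M) 1"
      "k' + line_count M 2 = k + line_count (add_mset x M) 2" "l' + line_count M 3 = l + line_count (add_mset x M) 3"
  proof -
    consider "line x = 0" | "line x = 1" | "line x = 2" | "line x = 3" using line_less[of x] by linarith
    then show ?thesis
    proof cases
      case 1 then show ?thesis using that[of "Suc i" j k l] by (simp add: direction_mset_def direction_def line_count_def)
    next
      case 2 then show ?thesis using that[of i "Suc j" k l] by (simp add: direction_mset_def direction_def line_count_def)
    next
      case 3 then show ?thesis using that[of i j "Suc k" l] by (simp add: direction_mset_def direction_def line_count_def)
    next
      case 4 then show ?thesis using that[of i j k "Suc l"] by (simp add: direction_mset_def direction_def line_count_def)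
    qed
  qed
  have "signed_count 9 (M + direction_mset i' j' k' l') 0 \<equiv>\<^sub>3 (\<Prod>x\<in>#M. orientation x) *
    signed_count 9 (direction_mset (i' + line_count M 0) (j' + line_count M 1) (k' + line_count M 2) (l' + line_count M 3)) 0"
    using add.prems n(1) by (intro add.IH) auto
  from cong_mult[OF cong_refl[of "orientation x"] this] have "orientation x * signed_count 9 (add_mset (direction (line x)) (M + ?D)) 0 \<equiv>\<^sub>3
    (\<Prod>x\<in>#add_mset x M. orientation x) *
    signed_count 9 (direction_mset (i' + line_count M 0) (j' + line_count M 1) (k' + line_count M 2) (l' + line_count M 3)) 0"
    by (simp flip: D add: mult.assoc)
  from cong_trans[OF 1 this] show ?case unfolding n by simp
qed

lemma sum_line_count: "line_count M 0 + line_count M 1 + line_count M 2 + line_count M 3 = size M"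
proof (induction M)
  case (add x M)
  consider "line x = 0" | "line x = 1" | "line x = 2" | "line x = 3" using line_less[of x] by linarith
  then show ?case using add by cases (simp_all add: line_count_def)
qed (simp add: line_count_def)

lemma signed_count_profile:
  assumes "\<forall>x\<in>#M. \<not> null_mod 3 x" "size M = 16"
  shows "signed_count 9 M 0 \<equiv>\<^sub>3 (\<Prod>x\<in>#M. orientation x) * tval (lookup (profile M))"
proof -
  have "signed_count 9 (M + direction_mset 0 0 0 0) 0 \<equiv>\<^sub>3 (\<Prod>x\<in>#M. orientation x) *
    signed_count 9 (direction_mset (0 + line_count M 0) (0 + line_count M 1) (0 + line_count M 2) (0 + line_count M 3)) 0"
    using assms by (intro signed_count_profile_aux) auto
  moreover have "signed_count 9 (direction_mset (line_count M 0) (line_count M 1) (line_count M 2) (line_count M 3)) 0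
    \<equiv>\<^sub>3 tval (row (line_count M 2) (line_count M 3) ! line_count M 0)"
    using sum_line_count[of M] assms(2) by (intro signed_count_row) simp
  ultimately show ?thesis
    using cong_trans[OF _ cong_mult[OF cong_refl]] by (simp add: direction_mset_def lookup_def profile_def) blast
qed

definition decr :: "nat \<Rightarrow> nat list \<Rightarrow> nat list" where "decr d n = n[d := n ! d - 1]"

fun tpow :: "nat \<Rightarrow> trit \<Rightarrow> trit" where
  "tpow k Z = (if k = 0 then P else Z)" | "tpow k P = P" | "tpow k N = (if even k then P else N)"

lemma tval_tpow: "tval (tpow k x) = tval x ^ k"
  by (cases x) (auto simp: power_0_left)

text \<open>Necessary conditions on the numbers \<open>n\<close> of elements on the four lines modulo 3 of a minimal zero-sum
  multiset of size 17; the second one applies if it contains \<open>k\<close> and \<open>k + 3 v\<close> with \<open>k\<close> on the line \<open>d\<close>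
  and \<open>v\<close> on the line \<open>u\<close>.\<close>

definition admissible_profile :: "nat list \<Rightarrow> bool" where
  "admissible_profile n \<longleftrightarrow> foldr (\<lambda>d. tmul (if n ! d = 0 then P else tpow (n ! d) (lookup (decr d n)))) [0, 1, 2, 3] P = P"

definition exchangeable :: "nat list \<Rightarrow> nat \<Rightarrow> nat \<Rightarrow> bool" where
  "exchangeable n d u \<longleftrightarrow> list_all (\<lambda>a. list_all (\<lambda>b.
     if decr d (decr d n) ! a = 0 then True
     else if decr a (decr d (decr d n)) ! b = 0 then True
     else lookup ((decr b (decr a (decr d (decr d n))))[u := decr b (decr a (decr d (decr d n))) ! u + 3]) = Z)
     [0, 1, 2, 3]) [0, 1, 2, 3]"

text \<open>The second clause is used when a line with eight elements is not constant: the
  difference of two of its elements points to a second line with eight elements.\<close>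

definition profile_check :: "nat list \<Rightarrow> bool" where
  "profile_check n \<longleftrightarrow> (if admissible_profile n then list_ex (\<lambda>d. n ! d = 8) [0, 1, 2, 3] \<and>
     list_all (\<lambda>d. if n ! d = 8 then list_all (\<lambda>u. if exchangeable n d u then u \<noteq> d \<and> n ! u = 8 else True) [0, 1, 2, 3]
        else True) [0, 1, 2, 3] else True)"

lemma profile_check_all:
  "list_all (\<lambda>k. list_all (\<lambda>l. list_all (\<lambda>i. profile_check [i, 17 - k - l - i, k, l]) [0..<18 - k - l]) [0..<18 - k]) [0..<18]"
  by code_simp

lemma profile_check:
  assumes "i + j + k + l = 17" shows "profile_check [i, j, k, l]"
proof -
  have "k \<in> set [0..<18]" "l \<in> set [0..<18 - k]" "i \<in> set [0..<18 - k - l]" using assms by auto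
  then have "profile_check [i, 17 - k - l - i, k, l]" using profile_check_all unfolding list_all_iff by blast
  moreover have "17 - k - l - i = j" using assms by simp
  ultimately show ?thesis by simp
qed

lemma mem_lines: "d \<in> set [0, 1, 2, 3 :: nat] \<longleftrightarrow> d < 4" by auto

lemma profile_checkD:
  assumes "profile_check n" "admissible_profile n"
  shows "\<exists>d<4. n ! d = 8"
    "d < 4 \<Longrightarrow> n ! d = 8 \<Longrightarrow> u < 4 \<Longrightarrow> exchangeable n d u \<Longrightarrow> u \<noteq> d \<and> n ! u = 8"
proof -
  have *: "list_ex (\<lambda>d. n ! d = 8) [0, 1, 2, 3] \<and>
     list_all (\<lambda>d. if n ! d = 8 then list_all (\<lambda>u. if exchangeable n d u then u \<noteq> d \<and> n ! u = 8 else True) [0, 1, 2, 3]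
        else True) [0, 1, 2, 3]"
    using assms(1) unfolding profile_check_def if_P[OF assms(2)] .
  show "\<exists>d<4. n ! d = 8" using conjunct1[OF *] unfolding list_ex_iff Bex_def mem_lines by blast
  show "d < 4 \<Longrightarrow> n ! d = 8 \<Longrightarrow> u < 4 \<Longrightarrow> exchangeable n d u \<Longrightarrow> u \<noteq> d \<and> n ! u = 8"
    using conjunct2[OF *] unfolding list_all_iff Ball_def mem_lines by presburger
qed

lemma profile_nth: "d < 4 \<Longrightarrow> profile M ! d = line_count M d"
proof -
  assume "d < 4"
  then consider "d = 0" | "d = 1" | "d = 2" | "d = 3" by linarith
  then show ?thesis by cases (simp_all add: profile_def)
qed

lemma length_profile [simp]: "length (profile M) = 4" by (simp add: profile_def)

lemma line_count_add: "line_count (add_mset x M) d = (if line x = d then Suc (line_count M d) else line_count M d)"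
  by (simp add: line_count_def)

lemma profile_remove: "x \<in># M \<Longrightarrow> profile (M - {#x#}) = decr (line x) (profile M)"
proof -
  assume "x \<in># M"
  then obtain M' where M: "M = add_mset x M'" by (meson mset_add)
  show ?thesis
  proof (rule nth_equalityI)
    fix d assume "d < length (profile (M - {#x#}))"
    then show "profile (M - {#x#}) ! d = decr (line x) (profile M) ! d"
      using line_less[of x] by (simp add: decr_def profile_nth nth_list_update line_count_add M)
  qed (simp add: decr_def)
qed

lemma profile_add_3: "profile (replicate_mset 3 x + M) = (profile M)[line x := profile M ! line x + 3]"
proof (rule nth_equalityI)
  fix d assume "d < length (profile (replicate_mset 3 x + M))"
  then show "profile (replicate_mset 3 x + M) ! d = (profile M)[line x := profile M ! line x + 3] ! d"
    using line_less[of x] by (simp add: profile_nth nth_list_update line_count_add eval_nat_numeral)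
qed simp

lemma line_count_pos: "line_count M d \<noteq> 0 \<Longrightarrow> \<exists>x\<in>#M. line x = d"
  by (auto simp: line_count_def dest!: multiset_nonemptyE)

lemma prod_line_count:
  "(\<Prod>x\<in>#M. g (line x) :: int) = g 0 ^ line_count M 0 * g 1 ^ line_count M 1 * g 2 ^ line_count M 2 * g 3 ^ line_count M 3"
proof (induction M)
  case (add x M)
  consider "line x = 0" | "line x = 1" | "line x = 2" | "line x = 3" using line_less[of x] by linarith
  then show ?case using add by cases (simp_all add: line_count_add)
qed (simp add: line_count_def)

lemma prod_orientation_cases: "(\<Prod>x\<in>#M. orientation x) = 1 \<or> (\<Prod>x\<in>#M. orientation x) = - 1"
proof (induction M)
  case (add x M) then show ?case using orientation_cases[of x] by auto
qed simp

lemma eq_1_of_cong: "y = 1 \<or> y = - 1 \<Longrightarrow> 1 \<equiv>\<^sub>3 y * tval t \<Longrightarrow> y * tval t = 1"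
  by (cases t) (auto simp: cong_def)

text \<open>\<open>a\<close>, \<open>b\<close> and \<open>c\<close> count the values 0, 1 and -1 in a nonconstant family of eight residues modulo 3;
  \<open>t\<close> is the common sum of a subfamily of size 3 and one of size 6.\<close>

lemma subset_sums_check:
  "list_all (\<lambda>a. list_all (\<lambda>b. let c = 8 - a - b in
     if a = 8 \<or> b = 8 \<or> c = 8 then True else
     list_ex (\<lambda>t. list_all (\<lambda>s. list_ex (\<lambda>a'. list_ex (\<lambda>b'. a' + b' \<le> s \<and> s - a' - b' \<le> c \<and>
        (int b' - int (s - a' - b') - t) mod 3 = 0) [0..<Suc b]) [0..<Suc a]) [3, 6 :: nat]) [1, - 1 :: int]) [0..<9 - a]) [0..<9 :: nat]"
  by code_simp

lemma subset_sums:
  fixes b :: "'b \<Rightarrow> int"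
  assumes size: "size D = 8" and b: "\<And>x. x \<in># D \<Longrightarrow> b x \<in> {- 1, 0, 1}" and ne: "x \<in># D" "y \<in># D" "b x \<noteq> b y"
  shows "\<exists>t\<in>{1, - 1}. \<forall>s\<in>{3, 6}. \<exists>I. I \<subseteq># D \<and> size I = s \<and> 3 dvd (\<Sum>x\<in>#I. b x) - t"
proof -
  define D0 D1 D2 where "D0 = filter_mset (\<lambda>x. b x = 0) D" and "D1 = filter_mset (\<lambda>x. b x = 1) D"
    and "D2 = filter_mset (\<lambda>x. b x = - 1) D"
  have D: "D = D0 + D1 + D2" using b by (intro multiset_eqI) (fastforce simp: D0_def D1_def D2_def not_in_iff)
  have sz: "size D0 + size D1 + size D2 = 8" using size unfolding D by simp
  have not8: "size D0 \<noteq> 8" "size D1 \<noteq> 8" "size D2 \<noteq> 8"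
  proof -
    have eq: "b x = b y" if "x \<in># filter_mset (\<lambda>x. b x = c) D" "y \<in># filter_mset (\<lambda>x. b x = c) D" for c
      using that by simp
    have xy: "x \<in># D0 + D1 + D2" "y \<in># D0 + D1 + D2" using ne D by simp_all
    show "size D0 \<noteq> 8"
    proof
      assume "size D0 = 8"
      then have "D1 = {#}" "D2 = {#}" using sz by auto
      then show False using eq[of 0] xy ne(3) by (simp add: D0_def)
    qed
    show "size D1 \<noteq> 8"
    proof
      assume "size D1 = 8"
      then have "D0 = {#}" "D2 = {#}" using sz by auto
      then show False using eq[of 1] xy ne(3) by (simp add: D1_def)
    qed
    show "size D2 \<noteq> 8"
    proof
      assume "size D2 = 8"
      then have "D0 = {#}" "D1 = {#}" using sz by auto
      then show False using eq[of "- 1"] xy ne(3) by (simp add: D2_def)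
    qed
  qed
  have c: "8 - size D0 - size D1 = size D2" using sz by simp
  have "size D0 \<in> set [0..<9]" "size D1 \<in> set [0..<9 - size D0]" using sz by auto
  then obtain t where t: "t \<in> {1, - 1}" and
    ex: "\<And>s. s \<in> {3, 6} \<Longrightarrow> \<exists>a'\<in>set [0..<Suc (size D0)]. \<exists>b'\<in>set [0..<Suc (size D1)]. a' + b' \<le> s \<and> s - a' - b' \<le> size D2 \<and>
        (int b' - int (s - a' - b') - t) mod 3 = 0"
  proof -
    assume that: "\<And>t. t \<in> {1, - 1} \<Longrightarrow> (\<And>s. s \<in> {3, 6} \<Longrightarrow> \<exists>a'\<in>set [0..<Suc (size D0)]. \<exists>b'\<in>set [0..<Suc (size D1)].
      a' + b' \<le> s \<and> s - a' - b' \<le> size D2 \<and> (int b' - int (s - a' - b') - t) mod 3 = 0) \<Longrightarrow> thesis"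
    assume "size D0 \<in> set [0..<9]" "size D1 \<in> set [0..<9 - size D0]"
    from bspec[OF bspec[OF subset_sums_check[unfolded list_all_iff] this(1), unfolded list_all_iff] this(2)]
    have "\<exists>t\<in>set [1, - 1]. \<forall>s\<in>set [3, 6]. \<exists>a'\<in>set [0..<Suc (size D0)]. \<exists>b'\<in>set [0..<Suc (size D1)].
      a' + b' \<le> s \<and> s - a' - b' \<le> size D2 \<and> (int b' - int (s - a' - b') - t) mod 3 = 0"
      unfolding Let_def c using not8 by (simp only: simp_thms if_False list_ex_iff list_all_iff)
    then show thesis using that by (simp only: list.set) blast
  qed
  have "\<exists>I. I \<subseteq># D \<and> size I = s \<and> 3 dvd (\<Sum>x\<in>#I. b x) - t" if s: "s \<in> {3, 6}" for s
  proof -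
    obtain a' b' where ab: "a' \<le> size D0" "b' \<le> size D1" "a' + b' \<le> s" "s - a' - b' \<le> size D2"
      "(int b' - int (s - a' - b') - t) mod 3 = 0" using ex[OF s] by (auto simp: less_Suc_eq_le simp del: upt_Suc)
    obtain I0 I1 I2 where I: "I0 \<subseteq># D0" "size I0 = a'" "I1 \<subseteq># D1" "size I1 = b'" "I2 \<subseteq># D2" "size I2 = s - a' - b'"
      using ex_submset_size[OF ab(1)] ex_submset_size[OF ab(2)] ex_submset_size[OF ab(4)] by blast
    have const: "(\<Sum>x\<in>#J. b x) = int (size J) * c" if "J \<subseteq># filter_mset (\<lambda>x. b x = c) D" for J c
    proof -
      have "\<And>x. x \<in># J \<Longrightarrow> b x = c" using mset_subset_eqD[OF that] by auto
      then show ?thesis by (induction J) (auto simp: algebra_simps)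
    qed
    have "(\<Sum>x\<in>#I0 + I1 + I2. b x) = int b' - int (s - a' - b')"
      using const[of I0 0] const[of I1 1] const[of I2 "- 1"] I by (simp add: D0_def D1_def D2_def)
    moreover have "I0 + I1 + I2 \<subseteq># D" unfolding D using I by (intro subset_mset.add_mono)
    moreover have "size (I0 + I1 + I2) = s" using I ab(3) by simp
    moreover have "3 dvd int b' - int (s - a' - b') - t" by (rule mod_0_imp_dvd[OF ab(5)])
    ultimately show ?thesis by metis
  qed
  then show ?thesis using t by blast
qed

context
  fixes S
  assumes mzs: "mzs 9 S" and size_S: "size S = 17" and reduced: "reduced 9 S"
begin

lemma zsf_9: "x \<in># S \<Longrightarrow> signed_count 9 (S - {#x#}) 0 = 1"
  by (intro signed_count_zsf mzs_remove mzs)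

text \<open>A linear form modulo 3 vanishes at multiples of 3, but removing another element y from
  \<open>S\<close> requires the value 1 at x.\<close>

lemma not_null_3: assumes "x \<in># S" shows "\<not> null_mod 3 x"
proof
  assume null: "null_mod 3 x"
  obtain S' where S': "S = add_mset x S'" using assms by (meson mset_add)
  then have "S' \<noteq> {#}" using size_S by auto
  then obtain y where "y \<in># S'" by (meson multiset_nonemptyE)
  then obtain M where M: "S' = add_mset y M" by (meson mset_add)
  have "size M = 15" using size_S by (simp add: S' M)
  then have "signed_count 9 (add_mset x M) 0 \<equiv>\<^sub>3 fst x * signed_count 9 (add_mset (1, 0) M) 0 + snd x * signed_count 9 (add_mset (0, 1) M) 0"
    using nine.sc_top_linear[of M x] by simp
  moreover have "3 dvd fst x * signed_count 9 (add_mset (1, 0) M) 0 + snd x * signed_count 9 (add_mset (0, 1) M) 0"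
    using null by (simp add: null_mod_def)
  ultimately have "3 dvd signed_count 9 (add_mset x M) 0" using cong_dvd_iff by blast
  moreover have "signed_count 9 (add_mset x M) 0 = 1" using zsf_9[of y] by (simp add: S' M)
  ultimately show False by simp
qed

definition total_orientation :: int where "total_orientation = (\<Prod>x\<in>#S. orientation x)"

lemma orientation_lookup:
  assumes x: "x \<in># S"
  shows "total_orientation * orientation x * tval (lookup (decr (line x) (profile S))) = 1"
proof -
  have "\<forall>y\<in>#S - {#x#}. \<not> null_mod 3 y" using not_null_3 by (auto dest: in_diffD)
  moreover have "size (S - {#x#}) = 16" using size_S x by (simp add: size_Diff_singleton)
  ultimately have "1 \<equiv>\<^sub>3 (\<Prod>y\<in>#S - {#x#}. orientation y) * tval (lookup (profile (S - {#x#})))"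
    using signed_count_profile[of "S - {#x#}"] zsf_9[OF x] by simp
  then have "(\<Prod>y\<in>#S - {#x#}. orientation y) * tval (lookup (profile (S - {#x#}))) = 1"
    by (rule eq_1_of_cong[OF prod_orientation_cases])
  moreover have "total_orientation * orientation x = (\<Prod>y\<in>#S - {#x#}. orientation y)"
  proof -
    have "total_orientation = orientation x * (\<Prod>y\<in>#S - {#x#}. orientation y)"
      unfolding total_orientation_def using x by (metis image_mset_add_mset insert_DiffM prod_mset.add_mset)
    then show ?thesis using orientation_cases[of x] by auto
  qed
  ultimately show ?thesis by (simp add: profile_remove[OF x])
qed

text \<open>The table value in \<open>orientation_lookup\<close> depends only on the line, so it
  forces equal orientations.\<close>

lemma same_line_cong:
  assumes "x \<in># S" "y \<in># S" "line x = line y" shows "null_mod 3 (x - y)"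
proof -
  have "total_orientation * orientation x * tval (lookup (decr (line x) (profile S)))
      = total_orientation * orientation y * tval (lookup (decr (line x) (profile S)))"
    using orientation_lookup[OF assms(1)] orientation_lookup[OF assms(2)] assms(3) by simp
  moreover have "total_orientation \<noteq> 0" "tval (lookup (decr (line x) (profile S))) \<noteq> 0"
    using orientation_lookup[OF assms(1)] by auto
  ultimately have "orientation x = orientation y" by simp
  then have "fst x \<equiv>\<^sub>3 fst y" "snd x \<equiv>\<^sub>3 snd y"
    using direction_cong[OF not_null_3[OF assms(1)]] direction_cong[OF not_null_3[OF assms(2)]] assms(3)
    by (metis cong_sym cong_trans)+
  then show ?thesis by (simp add: null_mod_def cong_iff_dvd_diff)
qed

text \<open>Multiplying \<open>orientation_lookup\<close> over all 17 elements, the unknown sign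
  \<open>total_orientation\<close> occurs 17 + 1 times and cancels; the remaining condition involves
  the profile alone.\<close>

lemma admissible_profile_S: "admissible_profile (profile S)"
proof -
  define g where "g d = tval (lookup (decr d (profile S)))" for d
  have "(\<Prod>x\<in>#M. total_orientation * orientation x * g (line x)) = 1" if "M \<subseteq># S" for M
    using that
  proof (induction M)
    case (add x M)
    then show ?case using orientation_lookup[of x] subset_add_mset_self[of M x]
      by (auto simp: g_def mset_subset_eqD dest: subset_mset.order_trans mset_subset_eq_insertD)
  qed simp
  from this[of S] have "(\<Prod>x\<in>#S. total_orientation * orientation x * g (line x)) = 1" by simp
  moreover have "(\<Prod>x\<in>#M. total_orientation * orientation x * g (line x))
    = total_orientation ^ size M * (\<Prod>x\<in>#M. orientation x) * (\<Prod>x\<in>#M. g (line x))" for M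
    by (induction M) auto
  ultimately have "total_orientation ^ 17 * total_orientation * (\<Prod>x\<in>#S. g (line x)) = 1"
    by (simp add: size_S total_orientation_def)
  moreover have "total_orientation = 1 \<or> total_orientation = - 1"
    unfolding total_orientation_def by (rule prod_orientation_cases)
  ultimately have prod: "(\<Prod>x\<in>#S. g (line x)) = 1" by auto
  have w: "tval (if profile S ! d = 0 then P else tpow (profile S ! d) (lookup (decr d (profile S)))) = g d ^ line_count S d" if "d < 4" for d
    using that by (simp add: profile_nth tval_tpow g_def)
  have "tval (foldr (\<lambda>d. tmul (if profile S ! d = 0 then P else tpow (profile S ! d) (lookup (decr d (profile S))))) [0, 1, 2, 3] P)
     = (\<Prod>x\<in>#S. g (line x))"
    unfolding prod_line_count by (simp only: foldr.simps comp_apply id_apply tval_tmul w) (simp add: w[simplified])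
  then have "tval (foldr (\<lambda>d. tmul (if profile S ! d = 0 then P else tpow (profile S ! d) (lookup (decr d (profile S))))) [0, 1, 2, 3] P) = tval P"
    by (simp add: prod)
  then show ?thesis unfolding admissible_profile_def tval_eq_iff .
qed

text \<open>Remove k, k' and two further elements, leaving \<open>T\<close>. Both k and k' = k + 3u
  extend \<open>T\<close> to a zero-sum free multiset, so 3u contributes 0. By Frobenius the factor
  for 3u is three factors for u, which brings the size to 13 + 3 = 16, and the table value must
  vanish.\<close>

lemma exchangeable_line:
  assumes k: "k \<in># S" and k': "k' \<in># S" "k' = k + (3 * fst u, 3 * snd u)" "line k' = line k" and u: "\<not> null_mod 3 u"
  shows "exchangeable (profile S) (line k) (line u)"
proof -
  have "k \<noteq> k'" using u k'(2) by (auto simp: null_mod_def prod_eq_iff)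
  let ?n2 = "decr (line k) (decr (line k) (profile S))"
  have main: "lookup ((decr b (decr a ?n2))[line u := decr b (decr a ?n2) ! line u + 3]) = Z"
    if ab: "a < 4" "b < 4" "?n2 ! a \<noteq> 0" "decr a ?n2 ! b \<noteq> 0" for a b
  proof -
    define M2 where "M2 = S - {#k#} - {#k'#}"
    have k'in: "k' \<in># S - {#k#}" using \<open>k \<noteq> k'\<close> k'(1) by (simp add: in_diff_count)
    have S2: "S = add_mset k (add_mset k' M2)" using k k'in unfolding M2_def by (metis insert_DiffM)
    have n2: "profile M2 = ?n2" unfolding M2_def profile_remove[OF k'in] profile_remove[OF k] k'(3) ..
    then obtain s where s: "s \<in># M2" "line s = a" using line_count_pos[of M2 a] ab profile_nth[of a M2] by auto
    define M3 where "M3 = M2 - {#s#}"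
    have n3: "profile M3 = decr a ?n2" unfolding M3_def profile_remove[OF s(1)] n2 s(2) ..
    then obtain r where r: "r \<in># M3" "line r = b" using line_count_pos[of M3 b] ab profile_nth[of b M3] by auto
    define T where "T = M3 - {#r#}"
    have nT: "profile T = decr b (decr a ?n2)" unfolding T_def profile_remove[OF r(1)] n3 r(2) ..
    have S: "S = add_mset k (add_mset k' (add_mset s (add_mset r T)))" proof -
      have "M2 = add_mset s M3" using s(1) by (simp add: M3_def)
      moreover have "M3 = add_mset r T" using r(1) by (simp add: T_def)
      ultimately show ?thesis using S2 by simp
    qed
    have sT: "size T = 13" using size_S by (simp add: S)
    have "zsf 9 (add_mset k T)" "zsf 9 (add_mset k' T)"
      by (rule mzs_zsf[OF mzs]; simp add: S subset_mset.less_le; simp add: mset_subset_eq_exists_conv; fail)+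
    then have one: "signed_count 9 (add_mset k T) 0 = 1" "signed_count 9 (add_mset k' T) 0 = 1" by (simp_all add: signed_count_zsf)
    have "signed_count 9 (add_mset (3 * fst u, 3 * snd u) T) k = 0"
      using one signed_count_add[of 9 k "(3 * fst u, 3 * snd u)" T 0] by (simp add: k'(2))
    moreover have "signed_count 9 (replicate_mset 3 u + T) k \<equiv>\<^sub>3 signed_count 9 (add_mset (3 * fst u, 3 * snd u) T) k"
      using nine.sc_frobenius[of u T k] by simp
    moreover have "signed_count 9 (replicate_mset 3 u + T) k \<equiv>\<^sub>3 signed_count 9 (replicate_mset 3 u + T) 0"
      using nine.sc_top_const[of "replicate_mset 3 u + T" k] sT by simp
    moreover have "signed_count 9 (replicate_mset 3 u + T) 0 \<equiv>\<^sub>3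
      (\<Prod>x\<in>#replicate_mset 3 u + T. orientation x) * tval (lookup (profile (replicate_mset 3 u + T)))"
    proof (rule signed_count_profile)
      show "\<forall>x\<in>#replicate_mset 3 u + T. \<not> null_mod 3 x" using u not_null_3 by (auto simp: S split: if_splits)
    qed (simp add: sT)
    ultimately have "0 \<equiv>\<^sub>3 (\<Prod>x\<in>#replicate_mset 3 u + T. orientation x) * tval (lookup (profile (replicate_mset 3 u + T)))"
      by (metis cong_sym cong_trans)
    then have "tval (lookup (profile (replicate_mset 3 u + T))) = 0"
      using prod_orientation_cases[of "replicate_mset 3 u + T"]
      by (cases "lookup (profile (replicate_mset 3 u + T))") (auto simp: cong_def)
    then show ?thesis unfolding profile_add_3 nT by (cases "lookup ((decr b (decr a ?n2))[line u := decr b (decr a ?n2) ! line u + 3])") simp_all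
  qed
  show ?thesis unfolding exchangeable_def list_all_iff Ball_def mem_lines using main by presburger
qed

lemma line_class:
  assumes d: "line_count S d = 8" "d < 4" and k: "k \<in># S" "k' \<in># S" "line k = d" "line k' = d" "k \<noteq> k'"
  obtains u where "k' = k + (3 * fst u, 3 * snd u)" "\<not> null_mod 3 u" "line u \<noteq> d" "line_count S (line u) = 8"
proof -
  have "null_mod 3 (k' - k)" using same_line_cong[of k' k] k by simp
  then obtain a b where ab: "fst k' - fst k = 3 * a" "snd k' - snd k = 3 * b" by (auto simp: null_mod_def elim!: dvdE)
  define u where "u = (a, b)"
  have k': "k' = k + (3 * fst u, 3 * snd u)" using ab by (simp add: u_def prod_eq_iff algebra_simps)
  have u: "\<not> null_mod 3 u"
  proof
    assume "null_mod 3 u"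
    then have "null_mod 9 (k' - k)" unfolding k' by (auto simp: null_mod_def)
    then show False using reduced k by (auto simp: reduced_def)
  qed
  have "exchangeable (profile S) d (line u)"
    using exchangeable_line[OF k(1,2) k' _ u] k by simp
  moreover have "profile_check (profile S)"
    using profile_check[of "line_count S 0" "line_count S 1" "line_count S 2" "line_count S 3"] sum_line_count[of S] size_S
    by (simp add: profile_def)
  ultimately have "line u \<noteq> d" "profile S ! line u = 8"
    using profile_checkD(2)[OF _ admissible_profile_S d(2) _ line_less] d(1) profile_nth[OF d(2)] by metis+
  then show ?thesis using that k' u line_less[of u] by (simp add: profile_nth)
qed

text \<open>Two classes of size 8: modulo 9 the elements of the first are \<open>k + 3 b l\<close> and those of the second
  are \<open>l + 3 a k\<close>.\<close>

lemma class_coordinates: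
  assumes de: "line_count S d = 8" "line_count S e = 8" "d < 4" "e < 4" "d \<noteq> e"
    and l: "l \<in># S" "line l = e" and k: "k \<in># S" "line k = d"
  obtains b where "\<And>x. x \<in># S \<Longrightarrow> line x = d \<Longrightarrow> b x \<in> {- 1, 0, 1 :: int} \<and> null_mod 9 (x - k - (3 * b x * fst l, 3 * b x * snd l))"
proof -
  have "\<exists>c. c \<in> {- 1, 0, 1 :: int} \<and> null_mod 9 (x - k - (3 * c * fst l, 3 * c * snd l))" if x: "x \<in># S" "line x = d" for x
  proof (cases "x = k")
    case True
    then show ?thesis by (intro exI[of _ 0]) (simp add: null_mod_def)
  next
    case False
    then obtain u where u: "x = k + (3 * fst u, 3 * snd u)" "\<not> null_mod 3 u" "line u \<noteq> d" "line_count S (line u) = 8"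
      using line_class[OF de(1,3) k(1) x(1) k(2) x(2)] by metis
    \<comment> \<open>Three lines with eight elements each would exceed the size 17.\<close>
    have "line u = e"
    proof (rule ccontr)
      assume "line u \<noteq> e"
      have "line_count S d + line_count S e + line_count S (line u) \<le> size S"
      proof -
        have "line_count M d + line_count M e + line_count M (line u) \<le> size M" for M
          using de(5) u(3) \<open>line u \<noteq> e\<close> by (induction M) (auto simp: line_count_add, simp_all add: line_count_def)
        then show ?thesis .
      qed
      then show False using de u(4) size_S by simp
    qed
    define c where "c = orientation u * orientation l"
    have c: "c \<in> {- 1, 0, 1}" using orientation_cases[of u] orientation_cases[of l] by (auto simp: c_def)
    have coord: "3 dvd f u - c * f l" if f: "\<And>y. \<not> null_mod 3 y \<Longrightarrow> f y \<equiv>\<^sub>3 orientation y * f (direction (line y))" for f :: "int \<times> int \<Rightarrow> int"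
    proof -
      have 1: "3 dvd f u - orientation u * f (direction e)" "3 dvd f l - orientation l * f (direction e)"
        using f[OF u(2)] f[OF not_null_3[OF l(1)]] \<open>line u = e\<close> l(2) by (simp_all add: cong_iff_dvd_diff)
      have eq: "f u - c * f l = (f u - orientation u * f (direction e)) - c * (f l - orientation l * f (direction e))
        + (1 - orientation l * orientation l) * (orientation u * f (direction e))"
        by (simp add: c_def algebra_simps)
      show ?thesis using dvd_diff[OF 1(1) dvd_mult[OF 1(2), of c]]
        by (simp only: eq orientation_square diff_self mult_zero_left add_0_right)
    qed
    have "3 dvd fst u - c * fst l" by (rule coord[OF direction_cong(1)])
    moreover have "3 dvd snd u - c * snd l" by (rule coord[OF direction_cong(2)])
    moreover have "x - k - (3 * c * fst l, 3 * c * snd l) = (3 * (fst u - c * fst l), 3 * (snd u - c * snd l))"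
      using u(1) by (simp add: prod_eq_iff algebra_simps)
    moreover have "9 dvd 3 * y" if "3 dvd y" for y :: int using mult_dvd_mono[OF dvd_refl that, of 3] by simp
    ultimately have "null_mod 9 (x - k - (3 * c * fst l, 3 * c * snd l))" by (simp only: null_mod_def fst_conv snd_conv of_nat_numeral)
    then show ?thesis using c by blast
  qed
  then show ?thesis using that by metis
qed

lemma sum_coordinates:
  assumes "\<And>x. x \<in># I \<Longrightarrow> null_mod 9 (x - k - (3 * b x * fst l, 3 * b x * snd l))"
  shows "null_mod 9 (\<Sum>\<^sub># I - (int (size I) * fst k, int (size I) * snd k) - (3 * (\<Sum>x\<in>#I. b x) * fst l, 3 * (\<Sum>x\<in>#I. b x) * snd l))"
  using assms
proof (induction I)
  case (add x I)
  have "null_mod 9 ((x - k - (3 * b x * fst l, 3 * b x * snd l))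
    + (\<Sum>\<^sub># I - (int (size I) * fst k, int (size I) * snd k) - (3 * (\<Sum>x\<in>#I. b x) * fst l, 3 * (\<Sum>x\<in>#I. b x) * snd l)))"
    using add by (intro null_mod_add) auto
  moreover have "(x - k - (3 * b x * fst l, 3 * b x * snd l))
    + (\<Sum>\<^sub># I - (int (size I) * fst k, int (size I) * snd k) - (3 * (\<Sum>x\<in>#I. b x) * fst l, 3 * (\<Sum>x\<in>#I. b x) * snd l))
    = \<Sum>\<^sub># (add_mset x I) - (int (size (add_mset x I)) * fst k, int (size (add_mset x I)) * snd k)
      - (3 * (\<Sum>x\<in>#add_mset x I. b x) * fst l, 3 * (\<Sum>x\<in>#add_mset x I. b x) * snd l)"
    by (simp add: prod_eq_iff algebra_simps)
  ultimately show ?case by (simp only:)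
qed (simp add: null_mod_def)

lemma coordinates_differ:
  assumes "x \<in># S" "y \<in># S" "x \<noteq> y" "null_mod 9 (x - k - (3 * c * fst l, 3 * c * snd l))"
    "null_mod 9 (y - k - (3 * c' * fst l, 3 * c' * snd l))"
  shows "c \<noteq> c'"
proof
  assume "c = c'"
  then have "null_mod 9 (x - y)" using null_mod_diff[OF assms(4,5)] by simp
  then show False using reduced assms(1-3) by (auto simp: reduced_def)
qed

text \<open>Both classes vary in the direction of the other, so parts \<open>I\<close> and
  \<open>J\<close> can be chosen whose deviations complete multiples of k and l to multiples of 9.
  This is a zero-sum with at most 12 of the 17 elements.\<close>

lemma two_large_classes:
  assumes de: "line_count S d = 8" "line_count S e = 8" "d < 4" "e < 4" "d \<noteq> e"
    and k: "k \<in># S" "line k = d" "k' \<in># S" "line k' = d" "k \<noteq> k'"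
    and l: "l \<in># S" "line l = e" "l' \<in># S" "line l' = e" "l \<noteq> l'"
  shows False
proof -
  obtain b where b: "\<And>x. x \<in># S \<Longrightarrow> line x = d \<Longrightarrow> b x \<in> {- 1, 0, 1 :: int} \<and> null_mod 9 (x - k - (3 * b x * fst l, 3 * b x * snd l))"
    using class_coordinates[OF de l(1,2) k(1,2)] by metis
  obtain a where a: "\<And>x. x \<in># S \<Longrightarrow> line x = e \<Longrightarrow> a x \<in> {- 1, 0, 1 :: int} \<and> null_mod 9 (x - l - (3 * a x * fst k, 3 * a x * snd k))"
    using class_coordinates[OF de(2,1,4,3) de(5)[symmetric] k(1,2) l(1,2)] by metis
  define D1 where "D1 = filter_mset (\<lambda>x. line x = d) S"
  define D2 where "D2 = filter_mset (\<lambda>x. line x = e) S"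
  have D: "size D1 = 8" "size D2 = 8" using de by (simp_all add: D1_def D2_def line_count_def)
  have "b k \<noteq> b k'" by (rule coordinates_differ[OF k(1,3,5)]) (use b k in blast)+
  then have "\<exists>t\<in>{1, - 1}. \<forall>s\<in>{3, 6}. \<exists>I. I \<subseteq># D1 \<and> size I = s \<and> 3 dvd (\<Sum>x\<in>#I. b x) - t"
    using b k by (intro subset_sums[OF D(1), of b k k']) (auto simp: D1_def)
  then obtain t where t: "t \<in> {1, - 1}" "\<And>s. s \<in> {3, 6} \<Longrightarrow> \<exists>I. I \<subseteq># D1 \<and> size I = s \<and> 3 dvd (\<Sum>x\<in>#I. b x) - t"
    by blast
  have "a l \<noteq> a l'" by (rule coordinates_differ[OF l(1,3,5)]) (use a l in blast)+
  then have "\<exists>t\<in>{1, - 1}. \<forall>s\<in>{3, 6}. \<exists>I. I \<subseteq># D2 \<and> size I = s \<and> 3 dvd (\<Sum>x\<in>#I. a x) - t"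
    using a l by (intro subset_sums[OF D(2), of a l l']) (auto simp: D2_def)
  then obtain r where r: "r \<in> {1, - 1}" "\<And>s. s \<in> {3, 6} \<Longrightarrow> \<exists>I. I \<subseteq># D2 \<and> size I = s \<and> 3 dvd (\<Sum>x\<in>#I. a x) - r"
    by blast
  \<comment> \<open>\<open>I\<close> sums to |I| k + 3 B l and \<open>J\<close> to |J| l + 3 A k,
    with A = r and B = t modulo 3. The sizes 3 and 6 are chosen so that 9 divides |I| + 3 r and |J|
    + 3 t.\<close>
  obtain I where I: "I \<subseteq># D1" "size I = (if r = 1 then 6 else 3)" "3 dvd (\<Sum>x\<in>#I. b x) - t"
    using t(2)[of "if r = 1 then 6 else 3"] by (cases "r = 1") auto
  obtain J where J: "J \<subseteq># D2" "size J = (if t = 1 then 6 else 3)" "3 dvd (\<Sum>x\<in>#J. a x) - r"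
    using r(2)[of "if t = 1 then 6 else 3"] by (cases "t = 1") auto
  define B A where "B = (\<Sum>x\<in>#I. b x)" and "A = (\<Sum>x\<in>#J. a x)"
  have "null_mod 9 (\<Sum>\<^sub># I - (int (size I) * fst k, int (size I) * snd k) - (3 * B * fst l, 3 * B * snd l))"
    unfolding B_def using b mset_subset_eqD[OF I(1)] by (intro sum_coordinates) (auto simp: D1_def)
  moreover have "null_mod 9 (\<Sum>\<^sub># J - (int (size J) * fst l, int (size J) * snd l) - (3 * A * fst k, 3 * A * snd k))"
    unfolding A_def using a mset_subset_eqD[OF J(1)] by (intro sum_coordinates) (auto simp: D2_def)
  ultimately have sum: "null_mod 9 ((\<Sum>\<^sub># I - (int (size I) * fst k, int (size I) * snd k) - (3 * B * fst l, 3 * B * snd l))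
    + (\<Sum>\<^sub># J - (int (size J) * fst l, int (size J) * snd l) - (3 * A * fst k, 3 * A * snd k)))"
    by (rule null_mod_add)
  have "9 dvd int (size I) + 3 * A" "9 dvd int (size J) + 3 * B"
    using I(2,3) J(2,3) t(1) r(1) unfolding A_def[symmetric] B_def[symmetric] by (auto split: if_splits) presburger+
  then have "null_mod 9 (((int (size I) + 3 * A) * fst k, (int (size I) + 3 * A) * snd k) + ((int (size J) + 3 * B) * fst l, (int (size J) + 3 * B) * snd l))"
    by (intro null_mod_add) (simp_all add: null_mod_def)
  from null_mod_add[OF sum this] have "null_mod 9 (\<Sum>\<^sub># (I + J))"
    by (simp add: algebra_simps null_mod_def)
  moreover have "I + J \<subset># S"
  proof -
    have "D1 + D2 \<subseteq># S" using de(5) by (auto simp: subseteq_mset_def D1_def D2_def)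
    then have "I + J \<subseteq># S" using subset_mset.add_mono[OF I(1) J(1)] subset_mset.order_trans by blast
    moreover have "size (I + J) < size S" using I(2) J(2) size_S by simp
    ultimately show ?thesis by (metis less_irrefl subset_mset.less_le)
  qed
  moreover have "I + J \<noteq> {#}" using I(2) by (auto split: if_splits)
  ultimately show False using mzs unfolding mzs_def by blast
qed

theorem ex_count_ge_8: "\<exists>x\<in>#S. count S x \<ge> 8"
proof (rule ccontr)
  assume no: "\<not> ?thesis"
  have two: "\<exists>k k'. k \<in># S \<and> k' \<in># S \<and> line k = d \<and> line k' = d \<and> k \<noteq> k'" if d: "line_count S d = 8" for d
  proof (rule ccontr)
    assume const: "\<not> ?thesis"
    define D where "D = filter_mset (\<lambda>x. line x = d) S"
    have D: "size D = 8" using d by (simp add: D_def line_count_def)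
    then have "D \<noteq> {#}" by auto
    then obtain k where k: "k \<in># D" by (meson multiset_nonemptyE)
    have inD: "x \<in># D \<longleftrightarrow> x \<in># S \<and> line x = d" for x by (auto simp: D_def)
    have "x = k" if "x \<in># D" for x using const k that unfolding inD by blast
    then have "count D k = size D" by (rule count_eq_size)
    moreover have "count D k \<le> count S k" by (simp add: D_def)
    ultimately show False using no k D by (auto simp: D_def)
  qed
  have "profile_check (profile S)"
    using profile_check[of "line_count S 0" "line_count S 1" "line_count S 2" "line_count S 3"] sum_line_count[of S] size_S
    by (simp add: profile_def)
  then obtain d where d: "d < 4" "line_count S d = 8"
    using profile_checkD(1)[OF _ admissible_profile_S] profile_nth by metis
  obtain k k' where k: "k \<in># S" "line k = d" "k' \<in># S" "line k' = d" "k \<noteq> k'" using two[OF d(2)] by blast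
  obtain u where u: "line u \<noteq> d" "line_count S (line u) = 8"
    using line_class[OF d(2,1) k(1,3,2,4,5)] by metis
  obtain l l' where l: "l \<in># S" "line l = line u" "l' \<in># S" "line l' = line u" "l \<noteq> l'" using two[OF u(2)] by blast
  show False using two_large_classes[OF d(2) u(2) d(1) line_less u(1)[symmetric] k l] .
qed

end

lemma inverse_property_9: "inverse_property 9"
  unfolding inverse_property_def using ex_count_ge_8 by simp

theorem theorem3:
  shows "(\<forall>(p::nat) (A::(int \<times> int) multiset) (m1::nat) (m2::nat) (m3::nat).
      prime p \<longrightarrow>
      set_mset A \<subseteq> carrier (Z_squared p) \<longrightarrow>
      size A = 2 * p - 2 \<longrightarrow>
      m1 = largest_multiplicity 1 A \<longrightarrow>
      m2 = largest_multiplicity 2 A \<longrightarrow>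
      m3 = largest_multiplicity 3 A \<longrightarrow>
      int m1 \<le> int p - 3 \<longrightarrow>
      (p \<le> 23 \<or>
       (real m2 \<ge> 2 * real p / 3 \<and> int m1 + int m2 \<ge> 2 * int p - 14) \<or>
       (p \<le> 37 \<and> int m1 + int m2 + int m3 \<ge> 2 * int p - 5)) \<longrightarrow>
      contains_zero_sum (Z_squared p) A)
    \<and> property_B 8 \<and> property_B 9 \<and> property_B 10"
proof (intro conjI allI impI)
  fix p :: nat and A :: "(int \<times> int) multiset" and m1 m2 m3 :: nat
  assume p: "prime p" and A: "set_mset A \<subseteq> carrier (Z_squared p)" and size_A: "size A = 2 * p - 2"
    and m1: "m1 = largest_multiplicity 1 A" and le: "int m1 \<le> int p - 3"
  show "contains_zero_sum (Z_squared p) A"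
  proof (rule ccontr)
    assume "\<not> contains_zero_sum (Z_squared p) A"
    then have free: "zero_sum_free (Z_squared p) A" by (simp add: zero_sum_free_def)
    have "\<exists>x\<in>#A. p - 2 \<le> count A x"
    proof (cases "5 \<le> p")
      case True
      then show ?thesis by (intro property_B_of_inverse[OF inverse_property_prime] p A size_A free) auto
    next
      case False
      \<comment> \<open>The bound on m1 leaves only p = 3 here, where p - 2 = 1 and any element
        suffices.\<close>
      have "p \<noteq> 4" using p by auto
      then have "p = 3" using False le by linarith
      then have "A \<noteq> {#}" using size_A by auto
      then obtain x where "x \<in># A" by (meson multiset_nonemptyE)
      then show ?thesis using \<open>p = 3\<close> by (intro bexI[of _ x]) auto
    qed
    then obtain x where "x \<in># A" "p - 2 \<le> count A x" by blast
    then have "p - 2 \<le> m1" using count_le_largest_multiplicity[of x A] unfolding m1 by linarith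
    then show False using le by linarith
  qed
qed (use property_B_of_inverse[OF inverse_property_8] property_B_of_inverse[OF inverse_property_9]
    property_B_of_inverse[OF inverse_property_10] in \<open>auto simp: property_B_def\<close>)

end
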